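(* The following statements hold: (1) $\mathsf{TM}=\llbracket \phi^{\omega}(x)=\phi^{\omega}(y)\rrbracket$, where $\phi$ is the continuous endomorphism of the free profinite semigroup on $\{x,y\}$ such that $\phi(x)=xy$ and $\phi(y)=yx$. (2) For $i=2,3$, $\mathsf{MN}^{(i)}=\llbracket \psi(\phi^{\omega}(x))=\psi(\phi^{\omega}(y))\rrbracket$, where $\phi$ is the continuous endomorphism of the free profinite semigroup on $\{x,y,z,t\}$ such that $\phi(x)=xzytyzx$, $\phi(y)=yzxtxzy$, $\phi(z)=z$, $\phi(t)=t$, and $\psi$ runs over all homomorphisms from $\{x,y,z,t\}^+$ to $\{a_1,\ldots,a_i\}^+$.
   Context: For a semigroup $S$, $S^1=S$ if $S$ has an identity element, and otherwise $S^1=S\cup\{1\}$ with an adjoined identity. For $x,y\in S$ and $z_1,z_2,\ldots\in S^1$ put $\lambda_0=x$, $\rho_0=y$, $\lambda_{n+1}=\lambda_n z_{n+1}\rho_n$, $\rho_{n+1}=\rho_n z_{n+1}\lambda_n$, with $\lambda_n=\lambda_n(x,y,z_1,\ldots,z_n)$, $\rho_n=\rho_n(x,y,z_1,\ldots,z_n)$. $\mathsf{TM}$: finite semigroups $S$ for which there is $n\ge0$ with $\lambda_n(a,b,1,\ldots,1)=\rho_n(a,b,1,\ldots,1)$ for all $a,b\in S$. $\mathsf{MN}$: finite semigroups $S$ for which there is $n\ge0$ with $\lambda_n(a,b,c_1,\ldots,c_n)=\rho_n(a,b,c_1,\ldots,c_n)$ for all $a,b\in S$, $c_1,\ldots,c_n\in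 S^1$. $\mathsf{MN}^{(i)}$: finite semigroups all of whose subsemigroups generated by at most $i$ elements belong to $\mathsf{MN}$. For a continuous endomorphism $\varphi$ of a finitely generated profinite semigroup, $\varphi^\omega$ denotes the pointwise limit of $(\varphi^{n!})_n$. For elements $\pi,\rho$ of the free profinite semigroup on a finite set $A$, a finite semigroup $S$ satisfies the pseudoidentity $\pi=\rho$ if $\theta(\pi)=\theta(\rho)$ for every continuous homomorphism $\theta$ from the free profinite semigroup on $A$ to $S$ (discrete topology); $\llbracket\Sigma\rrbracket$ is the class of all finite semigroups satisfying all pseudoidentities in $\Sigma$. $A^+$ is the free semigroup on $A$; a homomorphism $\psi:\{x,y,z,t\}^+\to\{a_1,\ldots,a_i\}^+$ is identified with its unique continuous extension to a homomorphism between the free profinite semigroups on $\{x,y,z,t\}$ and on $\{a_1,\ldots,a_i\}$. In (2) the set $\Sigma$ consists of one pseudoidentity for each such $\psi$. *)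

theory Defs
  imports "HOL-Analysis.Analysis" "HOL-Algebra.Congruence"
begin

section \<open>Semigroups with explicit carrier\<close>

record 'a sgp = "'a partial_object" +
  sg_mult :: "'a \<Rightarrow> 'a \<Rightarrow> 'a"  (infixl \<open>\<cdot>\<index>\<close> 70)

definition finite_semigroup :: "'a sgp \<Rightarrow> bool" where
  "finite_semigroup S \<longleftrightarrow>
     finite (carrier S) \<and> carrier S \<noteq> {} \<and>
     (\<forall>x\<in>carrier S. \<forall>y\<in>carrier S. x \<cdot>\<^bsub>S\<^esub> y \<in> carrier S) \<and>
     (\<forall>x\<in>carrier S. \<forall>y\<in>carrier S. \<forall>z\<in>carrier S.
        (x \<cdot>\<^bsub>S\<^esub> y) \<cdot>\<^bsub>S\<^esub> z = x \<cdot>\<^bsub>S\<^esub> (y \<cdot>\<^bsub>S\<^esub> z))"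

definition sg_hom :: "'a sgp \<Rightarrow> 'b sgp \<Rightarrow> ('a \<Rightarrow> 'b) set" where
  "sg_hom S T = {h \<in> carrier S \<rightarrow> carrier T.
     \<forall>x\<in>carrier S. \<forall>y\<in>carrier S. h (x \<cdot>\<^bsub>S\<^esub> y) = h x \<cdot>\<^bsub>T\<^esub> h y}"

definition is_identity :: "'a sgp \<Rightarrow> 'a \<Rightarrow> bool" where
  "is_identity S e \<longleftrightarrow> e \<in> carrier S \<and> (\<forall>x\<in>carrier S. e \<cdot>\<^bsub>S\<^esub> x = x \<and> x \<cdot>\<^bsub>S\<^esub> e = x)"

definition sg_one :: "'a sgp \<Rightarrow> 'a" where
  "sg_one S = (THE e. is_identity S e)"

text \<open>The semigroup \<open>S\<^sup>1\<close>. An element \<open>x\<close> of \<open>S\<close> is represented by \<open>Some x\<close>; the value \<open>None\<close>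
  is the adjoined identity, and it belongs to the carrier only if \<open>S\<close> has no identity of its own.\<close>

definition adjoin_one :: "'a sgp \<Rightarrow> 'a option sgp" where
  "adjoin_one S =
     \<lparr>carrier = Some ` carrier S \<union> (if \<exists>e. is_identity S e then {} else {None}),
      sg_mult = (\<lambda>u v. case u of
          None \<Rightarrow> v
        | Some x \<Rightarrow> (case v of None \<Rightarrow> Some x | Some y \<Rightarrow> Some (x \<cdot>\<^bsub>S\<^esub> y)))\<rparr>"

inductive_set sg_span :: "'a sgp \<Rightarrow> 'a set \<Rightarrow> 'a set" for S X where
  base: "x \<in> X \<Longrightarrow> x \<in> sg_span S X"
| mult: "x \<in> sg_span S X \<Longrightarrow> y \<in> sg_span S X \<Longrightarrow> x \<cdot>\<^bsub>S\<^esub> y \<in> sg_span S X"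

definition subsg :: "'a sgp \<Rightarrow> 'a set \<Rightarrow> 'a sgp" where
  "subsg S X = S\<lparr>carrier := sg_span S X\<rparr>"


section \<open>The classes TM, MN and \<open>MN\<^sup>(\<^sup>i\<^sup>)\<close>\<close>

fun lam :: "'a sgp \<Rightarrow> 'a \<Rightarrow> 'a \<Rightarrow> (nat \<Rightarrow> 'a) \<Rightarrow> nat \<Rightarrow> 'a"
  and rho :: "'a sgp \<Rightarrow> 'a \<Rightarrow> 'a \<Rightarrow> (nat \<Rightarrow> 'a) \<Rightarrow> nat \<Rightarrow> 'a" where
  "lam S x y z 0 = x"
| "rho S x y z 0 = y"
| "lam S x y z (Suc n) = lam S x y z n \<cdot>\<^bsub>S\<^esub> z (Suc n) \<cdot>\<^bsub>S\<^esub> rho S x y z n"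
| "rho S x y z (Suc n) = rho S x y z n \<cdot>\<^bsub>S\<^esub> z (Suc n) \<cdot>\<^bsub>S\<^esub> lam S x y z n"

definition TM :: "'a sgp set" where
  "TM = {S. finite_semigroup S \<and>
     (\<exists>n. \<forall>a\<in>carrier S. \<forall>b\<in>carrier S.
        lam (adjoin_one S) (Some a) (Some b) (\<lambda>_. sg_one (adjoin_one S)) n =
        rho (adjoin_one S) (Some a) (Some b) (\<lambda>_. sg_one (adjoin_one S)) n)}"

definition MN :: "'a sgp set" where
  "MN = {S. finite_semigroup S \<and>
     (\<exists>n. \<forall>a\<in>carrier S. \<forall>b\<in>carrier S. \<forall>c.
        (\<forall>k\<in>{1..n}. c k \<in> carrier (adjoin_one S)) \<longrightarrow>
        lam (adjoin_one S) (Some a) (Some b) c n = rho (adjoin_one S) (Some a) (Some b) c n)}"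

definition MN_gen :: "nat \<Rightarrow> 'a sgp set" where
  "MN_gen i = {S. finite_semigroup S \<and>
     (\<forall>X. X \<subseteq> carrier S \<and> X \<noteq> {} \<and> card X \<le> i \<longrightarrow> subsg S X \<in> MN)}"


section \<open>Free profinite semigroups\<close>

definition free_sg :: "'x set \<Rightarrow> 'x list sgp" where
  "free_sg A = \<lparr>carrier = {w \<in> lists A. w \<noteq> []}, sg_mult = (@)\<rparr>"

definition fin_congs :: "'x set \<Rightarrow> ('x list \<times> 'x list) set set" where
  "fin_congs A = {r. equiv (carrier (free_sg A)) r \<and>
     (\<forall>(u, u') \<in> r. \<forall>(v, v') \<in> r. (u @ v, u' @ v') \<in> r) \<and>
     finite (carrier (free_sg A) // r)}"

text \<open>The free profinite semigroup on a finite set \<open>A\<close>, constructed as the inverse limit of all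
  finite quotients of the free semigroup on \<open>A\<close>. An element is a family \<open>p\<close> that chooses one class
  \<open>p r\<close> for every congruence \<open>r\<close> of finite index, compatibly with the projections: the class of a
  finer congruence is contained in the class of a coarser one.\<close>

type_synonym 'x profin = "('x list \<times> 'x list) set \<Rightarrow> 'x list set"

definition free_prof :: "'x set \<Rightarrow> 'x profin sgp" where
  "free_prof A =
     \<lparr>carrier = {p \<in> (\<Pi>\<^sub>E r\<in>fin_congs A. carrier (free_sg A) // r).
        \<forall>r\<in>fin_congs A. \<forall>s\<in>fin_congs A. r \<subseteq> s \<longrightarrow> p r \<subseteq> p s},
      sg_mult = (\<lambda>p q. \<lambda>r\<in>fin_congs A. \<Union>u\<in>p r. \<Union>v\<in>q r. r `` {u @ v})\<rparr>"

definition prof_topology :: "'x set \<Rightarrow> 'x profin topology" where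
  "prof_topology A =
     subtopology
       (product_topology (\<lambda>r. discrete_topology (carrier (free_sg A) // r)) (fin_congs A))
       (carrier (free_prof A))"

text \<open>The canonical embedding of the free semigroup on \<open>A\<close> into the free profinite semigroup.\<close>

definition emb :: "'x set \<Rightarrow> 'x list \<Rightarrow> 'x profin" where
  "emb A w = (\<lambda>r\<in>fin_congs A. r `` {w})"

text \<open>Maps are taken to be extensional, so that they are determined by their values on the
  carrier.\<close>

definition prof_hom :: "'x set \<Rightarrow> 'y set \<Rightarrow> ('x profin \<Rightarrow> 'y profin) set" where
  "prof_hom A B = {f \<in> sg_hom (free_prof A) (free_prof B) \<inter> extensional (carrier (free_prof A)).
     continuous_map (prof_topology A) (prof_topology B) f}"

text \<open>The unique continuous homomorphism that extends \<open>h \<in> sg_hom (free_sg A) (free_sg B)\<close>.\<close>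

definition prof_ext :: "'x set \<Rightarrow> 'y set \<Rightarrow> ('x list \<Rightarrow> 'y list) \<Rightarrow> 'x profin \<Rightarrow> 'y profin" where
  "prof_ext A B h = (THE f. f \<in> prof_hom A B \<and>
     (\<forall>w\<in>carrier (free_sg A). f (emb A w) = emb B (h w)))"

definition omega_power :: "'x set \<Rightarrow> ('x profin \<Rightarrow> 'x profin) \<Rightarrow> 'x profin \<Rightarrow> 'x profin" where
  "omega_power A f p =
     (THE q. limitin (prof_topology A) (\<lambda>n. (f ^^ fact n) p) q sequentially)"

definition satisfies :: "'a sgp \<Rightarrow> 'x set \<Rightarrow> 'x profin \<Rightarrow> 'x profin \<Rightarrow> bool" where
  "satisfies S A p q \<longleftrightarrow>
     (\<forall>\<theta>\<in>sg_hom (free_prof A) S.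
        continuous_map (prof_topology A) (discrete_topology (carrier S)) \<theta> \<longrightarrow> \<theta> p = \<theta> q)"

definition models :: "'x set \<Rightarrow> ('x profin \<times> 'x profin) set \<Rightarrow> 'a sgp set" where
  "models A \<Sigma> = {S. finite_semigroup S \<and> (\<forall>(p, q)\<in>\<Sigma>. satisfies S A p q)}"


section \<open>The two endomorphisms\<close>

datatype letter = Lx | Ly | Lz | Lt

definition phi_TM :: "letter profin \<Rightarrow> letter profin" where
  "phi_TM = (THE f. f \<in> prof_hom {Lx, Ly} {Lx, Ly} \<and>
     f (emb {Lx, Ly} [Lx]) = emb {Lx, Ly} [Lx, Ly] \<and>
     f (emb {Lx, Ly} [Ly]) = emb {Lx, Ly} [Ly, Lx])"

definition phi_MN :: "letter profin \<Rightarrow> letter profin" where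
  "phi_MN = (THE f. f \<in> prof_hom {Lx, Ly, Lz, Lt} {Lx, Ly, Lz, Lt} \<and>
     f (emb {Lx, Ly, Lz, Lt} [Lx]) = emb {Lx, Ly, Lz, Lt} [Lx, Lz, Ly, Lt, Ly, Lz, Lx] \<and>
     f (emb {Lx, Ly, Lz, Lt} [Ly]) = emb {Lx, Ly, Lz, Lt} [Ly, Lz, Lx, Lt, Lx, Lz, Ly] \<and>
     f (emb {Lx, Ly, Lz, Lt} [Lz]) = emb {Lx, Ly, Lz, Lt} [Lz] \<and>
     f (emb {Lx, Ly, Lz, Lt} [Lt]) = emb {Lx, Ly, Lz, Lt} [Lt])"

end

theory Submission
  imports Defs
begin

text \<open>Evaluated in a finite semigroup, the iterates of \<open>\<phi>\<close> run through the sequences \<open>\<lambda>\<^sub>n, \<rho>\<^sub>n\<close> with constant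
  parameter \<open>1\<close>, respectively with parameters alternating between two elements \<open>c\<close> and \<open>d\<close>, and the
  pseudoidentity says that the sequences meet. So the point is that a finite semigroup \<open>T\<close> in which
  all sequences with alternating parameters from \<open>T\<close> meet is in \<open>MN\<close>.

  If it is not, there is a periodic sequence \<open>(\<lambda>\<^sub>n, \<rho>\<^sub>n)\<close> with parameters \<open>w\<^sub>n\<close> in \<open>T\<^sup>1\<close> that never meets. All
  its members lie in one regular \<open>J\<close>-class; since \<open>T\<close> has no two-element left or right zero subsemigroup,
  idempotents are unique in their \<open>L\<close>- and \<open>R\<close>-classes. Let \<open>x = \<lambda>\<^sub>0\<close> be in \<open>R\<^sub>f \<inter> L\<^sub>e\<close> and \<open>y = \<rho>\<^sub>0\<close> in
  \<open>R\<^sub>f' \<inter> L\<^sub>e'\<close>. Unless \<open>e = e'\<close> and \<open>f = f'\<close>, the sequence from \<open>x, y\<close> with parameters alternating between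
  \<open>w\<^sub>0\<close> and \<open>w\<^sub>1\<close> stays in these classes and never meets; if one of \<open>w\<^sub>0, w\<^sub>1\<close> is \<open>1\<close>, the square of the other
  takes its place. Otherwise the sequence is moved into the maximal subgroup \<open>H\<^sub>f\<close>, and it remains to show
  that a finite group with the alternating property is nilpotent. In a minimal section \<open>H/K\<close> that is not,
  the centre is trivial. If \<open>H/K\<close> has a proper normal subgroup, that subgroup has a nontrivial abelian
  centre \<open>A\<close>, on which the sequences starting at \<open>1, v\<close> with parameters \<open>x, x\<^sup>-\<^sup>2\<close> force every \<open>x\<close> to have
  nontrivial fixed points, and hence \<open>A\<close> has a nontrivial common fixed point. If \<open>H/K\<close> is simple, its maximal subgroups
  intersect trivially, and with parameters \<open>1\<close> two elements outside a common maximal subgroup never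
  meet.\<close>

section \<open>Malcev sequences with arbitrary and with alternating parameters\<close>

text \<open>Indices are shifted: \<open>z k\<close> is the parameter \<open>z\<^sub>k\<^sub>+\<^sub>1\<close> of the informal definition.\<close>

definition malcev_seq :: "('a \<Rightarrow> 'a \<Rightarrow> 'a) \<Rightarrow> (nat \<Rightarrow> 'a) \<Rightarrow> (nat \<Rightarrow> 'a) \<Rightarrow> (nat \<Rightarrow> 'a) \<Rightarrow> bool" where
  "malcev_seq m z g h \<longleftrightarrow>
     (\<forall>k. g (Suc k) = m (m (g k) (z k)) (h k) \<and> h (Suc k) = m (m (h k) (z k)) (g k))"

text \<open>The two parameters stand for the letters z and t, which \<phi> fixes; they range over T
  itself, without an adjoined identity. The meeting index may depend on the sequence;
  \<open>MN_if_alternating_nilpotent\<close> recovers a uniform bound from finiteness.\<close>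

definition alternating_nilpotent :: "('a \<Rightarrow> 'a \<Rightarrow> 'a) \<Rightarrow> 'a set \<Rightarrow> bool" where
  "alternating_nilpotent m T \<longleftrightarrow>
     (\<forall>g h. \<forall>c\<in>T. \<forall>d\<in>T. malcev_seq m (\<lambda>k. if even k then c else d) g h \<longrightarrow>
        g 0 \<in> T \<longrightarrow> h 0 \<in> T \<longrightarrow> (\<exists>n. g n = h n))"

lemma malcev_seq_exists:
  obtains g h where "malcev_seq m z g h" "g 0 = a" "h 0 = b"
proof -
  define p where "p = rec_nat (a, b) (\<lambda>k (x, y). (m (m x (z k)) y, m (m y (z k)) x))"
  have "malcev_seq m z (fst \<circ> p) (snd \<circ> p)" "fst (p 0) = a" "snd (p 0) = b"
    by (auto simp: malcev_seq_def p_def split_beta)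
  then show thesis
    by (intro that[of "fst \<circ> p" "snd \<circ> p"]) auto
qed

section \<open>Groups\<close>

context group_add
begin

text \<open>For u = h - g in a group, a step with parameter z replaces u by
  \<open>comm u (g + z)\<close>; this links Malcev sequences to nilpotency. Groups are written
  additively although they need not be abelian.\<close>

abbreviation comm :: "'a \<Rightarrow> 'a \<Rightarrow> 'a" where
  "comm u g \<equiv> u + g - u - g"

definition subgrp :: "'a set \<Rightarrow> bool" where
  "subgrp H \<longleftrightarrow> 0 \<in> H \<and> (\<forall>a\<in>H. \<forall>b\<in>H. a - b \<in> H)"

definition normal_in :: "'a set \<Rightarrow> 'a set \<Rightarrow> bool" where
  "normal_in K H \<longleftrightarrow> (\<forall>h\<in>H. \<forall>k\<in>K. h + k - h \<in> K)"

text \<open>For finite \<open>H\<close> with normal subgroup \<open>K\<close> this expresses nilpotency of \<open>H/K\<close>: no set of nontrivial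
  elements allows one to go on taking commutators for ever. It avoids quotient groups and central
  series.\<close>

definition nil_mod :: "'a set \<Rightarrow> 'a set \<Rightarrow> bool" where
  "nil_mod H K \<longleftrightarrow>
     (\<forall>U\<subseteq>H. U \<noteq> {} \<longrightarrow> (\<forall>u\<in>U. \<exists>g\<in>H. comm u g \<in> U) \<longrightarrow> U \<inter> K \<noteq> {})"

lemma subgrp_zero: "subgrp H \<Longrightarrow> 0 \<in> H"
  and subgrp_diff: "subgrp H \<Longrightarrow> a \<in> H \<Longrightarrow> b \<in> H \<Longrightarrow> a - b \<in> H"
  by (auto simp: subgrp_def)

lemma subgrp_uminus: "subgrp H \<Longrightarrow> a \<in> H \<Longrightarrow> - a \<in> H"
  using subgrp_diff[OF _ subgrp_zero, of H a] by simp

lemma subgrp_add: "subgrp H \<Longrightarrow> a \<in> H \<Longrightarrow> b \<in> H \<Longrightarrow> a + b \<in> H"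
  using subgrp_diff[of H a "- b"] subgrp_uminus by simp

lemmas subgrp_closed = subgrp_zero subgrp_diff subgrp_uminus subgrp_add

lemma normal_inD: "normal_in K H \<Longrightarrow> h \<in> H \<Longrightarrow> k \<in> K \<Longrightarrow> h + k - h \<in> K"
  by (auto simp: normal_in_def)

lemma normal_inD': "normal_in K H \<Longrightarrow> subgrp H \<Longrightarrow> h \<in> H \<Longrightarrow> k \<in> K \<Longrightarrow> - h + k + h \<in> K"
  using normal_inD[of K H "- h" k] subgrp_uminus by simp

text \<open>Rewriting into right-nested sums, where identities between group words follow by
  cancellation. The opposite rule \<open>add_uminus_conv_diff\<close> has to be removed at each
  use.\<close>

lemmas word = add_assoc diff_conv_add_uminus minus_add

text \<open>Here and below the right-hand sides consist of conjugates of commutators and of their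
  negatives, so membership in a normal K carries over. This makes centralizers and centres modulo K
  subgroups.\<close>

lemma comm_add_left: "comm (a + b) g = (a + comm b g - a) + comm a g"
  by (simp add: word del: add_uminus_conv_diff)

lemma comm_uminus_left: "comm (- a) g = - a + - comm a g - - a"
  by (simp add: word del: add_uminus_conv_diff)

lemma comm_conj_left: "comm (h + a - h) g = h + comm a (- h + g + h) - h"
  by (simp add: word del: add_uminus_conv_diff)

lemma comm_add_right: "comm w (a + b) = comm w a + (a + comm w b - a)"
  by (simp add: word del: add_uminus_conv_diff)

lemma comm_uminus_right: "comm w (- a) = - a + - comm w a - - a"
  by (simp add: word del: add_uminus_conv_diff)

section \<open>Centres, centralizers and normalizers in a section H/K\<close>

definition centre_mod :: "'a set \<Rightarrow> 'a set \<Rightarrow> 'a set" where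
  "centre_mod H K = {z \<in> H. \<forall>g\<in>H. comm z g \<in> K}"

text \<open>The preimage in H of the centralizer of the coset of w in H/K, just as
  \<open>centre_mod\<close> is the preimage of the centre.\<close>

definition centralizer_mod :: "'a set \<Rightarrow> 'a set \<Rightarrow> 'a \<Rightarrow> 'a set" where
  "centralizer_mod H K w = {l \<in> H. comm w l \<in> K}"

text \<open>Conjugation in both directions is required, which makes this a subgroup even when M is
  infinite.\<close>

definition normalizer_in :: "'a set \<Rightarrow> 'a set \<Rightarrow> 'a set" where
  "normalizer_in H M = {x \<in> H. \<forall>m\<in>M. x + m - x \<in> M \<and> - x + m + x \<in> M}"

lemma subgrp_centralizer_mod:
  assumes "subgrp H" "subgrp K" "normal_in K H"
  shows "subgrp (centralizer_mod H K w)"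
proof -
  have "comm w (a - b) \<in> K" if "a \<in> H" "b \<in> H" "comm w a \<in> K" "comm w b \<in> K" for a b
  proof -
    have "comm w (- b) \<in> K"
      unfolding comm_uminus_right
      by (intro normal_inD[OF assms(3)] subgrp_uminus[OF assms(1)] subgrp_uminus[OF assms(2)] that)
    then show ?thesis
      unfolding diff_conv_add_uminus[of a b] comm_add_right using that assms
      by (intro subgrp_add normal_inD[of K H])
  qed
  moreover have "0 \<in> centralizer_mod H K w"
    using assms by (auto simp: centralizer_mod_def intro: subgrp_closed)
  ultimately show ?thesis
    using subgrp_diff[OF assms(1)] unfolding subgrp_def centralizer_mod_def by blast
qed

lemma subgrp_comm_left:
  assumes "subgrp H" "subgrp K" "normal_in K H"
    and "a \<in> H" "b \<in> H" "comm a g \<in> K" "comm b g \<in> K"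
  shows "comm (a - b) g \<in> K"
proof -
  have "comm (- b) g \<in> K"
    unfolding comm_uminus_left
    by (intro normal_inD[OF assms(3)] subgrp_uminus[OF assms(1)] subgrp_uminus[OF assms(2)] assms)
  then show ?thesis
    unfolding diff_conv_add_uminus[of a b] comm_add_left using assms
    by (intro subgrp_add normal_inD[of K H])
qed

lemma subgrp_centre_mod:
  assumes "subgrp H" "subgrp K" "normal_in K H"
  shows "subgrp (centre_mod H K)"
  unfolding subgrp_def
proof (intro conjI ballI)
  show "0 \<in> centre_mod H K"
    using assms by (auto simp: centre_mod_def intro: subgrp_closed)
next
  fix a b assume "a \<in> centre_mod H K" "b \<in> centre_mod H K"
  then show "a - b \<in> centre_mod H K"
    using subgrp_comm_left[OF assms] subgrp_diff[OF assms(1)] unfolding centre_mod_def by blast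
qed

lemma centre_mod_superset:
  assumes "subgrp H" "subgrp K" "normal_in K H" "K \<subseteq> H"
  shows "K \<subseteq> centre_mod H K"
proof
  fix k assume k: "k \<in> K"
  have "comm k g \<in> K" if "g \<in> H" for g
  proof -
    have "k + (g + - k - g) \<in> K"
      using that k assms by (intro subgrp_add normal_inD[of K H] subgrp_uminus)
    then show ?thesis
      by (simp add: word del: add_uminus_conv_diff)
  qed
  then show "k \<in> centre_mod H K"
    using k assms by (auto simp: centre_mod_def)
qed

lemma normal_in_centre_mod:
  assumes "subgrp H" "subgrp N" "N \<subseteq> H" "normal_in N H" "normal_in K H"
  shows "normal_in (centre_mod N K) H"
  unfolding normal_in_def
proof (intro ballI)
  fix h a assume h: "h \<in> H" and a: "a \<in> centre_mod N K"
  have "comm (h + a - h) g \<in> K" if "g \<in> N" for g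
    unfolding comm_conj_left using that h a assms
    by (intro normal_inD[of K H]) (auto simp: centre_mod_def intro: normal_inD')
  then show "h + a - h \<in> centre_mod N K"
    using h a assms by (auto simp: centre_mod_def intro: normal_inD)
qed

lemma normal_in_subset: "normal_in K H \<Longrightarrow> N \<subseteq> H \<Longrightarrow> normal_in K N"
  by (auto simp: normal_in_def)

text \<open>\<open>H - D\<close> misses K, so by nilpotency it cannot reproduce itself under
  commutators. This substitutes for the ascending central series, whose first term not contained in
  D would supply such an x.\<close>

lemma nil_mod_escape:
  assumes "nil_mod H K" "K \<subseteq> D" "D \<subset> H" "subgrp H"
  obtains x where "x \<in> H - D" "\<And>g. g \<in> H \<Longrightarrow> comm x g \<in> D"
proof -
  have "H - D \<subseteq> H" "H - D \<noteq> {}" "(H - D) \<inter> K = {}"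
    using assms by auto
  then have "\<not> (\<forall>u\<in>H - D. \<exists>g\<in>H. comm u g \<in> H - D)"
    using assms(1) unfolding nil_mod_def by blast
  then obtain x where "x \<in> H - D" "\<forall>g\<in>H. comm x g \<notin> H - D"
    by blast
  moreover have "comm x g \<in> H" if "g \<in> H" for g
    using \<open>x \<in> H - D\<close> that by (intro subgrp_diff subgrp_add assms(4)) auto
  ultimately show thesis
    using that[of x] by blast
qed

lemma subgrp_normalizer_in:
  assumes "subgrp H"
  shows "subgrp (normalizer_in H M)"
  unfolding subgrp_def
proof (intro conjI ballI)
  show "0 \<in> normalizer_in H M"
    using assms by (auto simp: normalizer_in_def intro: subgrp_closed)
next
  fix a b assume a: "a \<in> normalizer_in H M" and b: "b \<in> normalizer_in H M"
  have "(a - b) + m - (a - b) \<in> M \<and> - (a - b) + m + (a - b) \<in> M" if "m \<in> M" for m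
  proof
    have "a + (- b + m + b) - a \<in> M" "b + (- a + m + a) - b \<in> M"
      using a b that by (auto simp: normalizer_in_def)
    then show "(a - b) + m - (a - b) \<in> M" "- (a - b) + m + (a - b) \<in> M"
      by (simp_all add: word del: add_uminus_conv_diff)
  qed
  moreover have "a - b \<in> H"
    using a b by (intro subgrp_diff assms) (simp_all add: normalizer_in_def)
  ultimately show "a - b \<in> normalizer_in H M"
    unfolding normalizer_in_def by blast
qed

lemma subset_normalizer_in: "subgrp M \<Longrightarrow> M \<subseteq> H \<Longrightarrow> M \<subseteq> normalizer_in H M"
  by (auto simp: normalizer_in_def intro: subgrp_closed)

lemma normalizer_in_eq: "normalizer_in H M = H \<Longrightarrow> normal_in M H"
  by (auto simp: normalizer_in_def normal_in_def)

text \<open>\<open>x + m - x\<close> is \<open>comm x m + m\<close>. Together with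
  \<open>nil_mod_escape\<close> this gives the growth of normalizers in nilpotent sections.\<close>

lemma comm_in_imp_normalizer:
  assumes "subgrp H" "subgrp D" "D \<subseteq> H" "x \<in> H" and comm: "\<And>g. g \<in> H \<Longrightarrow> comm x g \<in> D"
  shows "x \<in> normalizer_in H D"
proof -
  have "x + m - x \<in> D \<and> - x + m + x \<in> D" if m: "m \<in> D" for m
  proof
    have "comm x m + m \<in> D"
      using assms(3) m by (intro subgrp_add assms comm) auto
    then show "x + m - x \<in> D"
      by (simp add: word del: add_uminus_conv_diff)
    have "m + comm x (- x - m + x) \<in> D"
      using assms(3) m by (intro subgrp_add[OF assms(2)] comm subgrp_add[OF assms(1)] subgrp_diff[OF assms(1)]
          subgrp_uminus[OF assms(1)] assms(4)) auto
    then show "- x + m + x \<in> D"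
      by (simp add: word del: add_uminus_conv_diff)
  qed
  then show ?thesis
    using assms by (auto simp: normalizer_in_def)
qed

text \<open>With parameters x and -2x the elements \<open>g k + z k\<close> fall alternately into
  the cosets B + x and B - x, and the difference u of the two sequences stays in B. The sequences
  meet, so u reaches K. A value of u outside K whose successor is in K commutes modulo K with some b
  + x or b - x, hence with x, because B is abelian modulo K.\<close>

lemma alternating_fixes_in_normalized:
  assumes alt: "alternating_nilpotent (+) G"
    and G: "subgrp G" and H: "subgrp H" "H \<subseteq> G" and K: "subgrp K" "normal_in K H"
    and B: "subgrp B" "B \<subseteq> H" and ab: "\<And>a b. a \<in> B \<Longrightarrow> b \<in> B \<Longrightarrow> comm a b \<in> K"
    and x: "x \<in> H" and conj: "\<And>b. b \<in> B \<Longrightarrow> x + b - x \<in> B" "\<And>b. b \<in> B \<Longrightarrow> - x + b + x \<in> B"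
    and v: "v \<in> B - K"
  obtains w where "w \<in> B - K" "comm w x \<in> K"
proof -
  \<comment> \<open>A step with x leads g from B to B + x, and a step with -2x leads it back to
    B.\<close>
  define z where "z k = (if even k then x else - x - x)" for k :: nat
  obtain g h where gh: "malcev_seq (+) z g h" "g 0 = 0" "h 0 = v"
    by (rule malcev_seq_exists)
  have g_Suc: "g (Suc k) = g k + z k + h k" and h_Suc: "h (Suc k) = h k + z k + g k" for k
    using gh(1) by (simp_all add: malcev_seq_def)
  define u where "u k = h k - g k" for k
  define y where "y k = (if even k then x else - x)" for k :: nat
  have h_eq: "h k = u k + g k" for k
    by (simp add: u_def)
  have u_Suc: "u (Suc k) = comm (u k) (g k + z k)" for k
    by (simp add: u_def g_Suc h_Suc word del: add_uminus_conv_diff)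
  have yB: "y k + b - y k \<in> B" if "b \<in> B" for k b
    using conj that by (auto simp: y_def)
  have inv: "u k \<in> B \<and> (\<exists>b\<in>B. g k + z k = b + y k)" for k
  proof (induction k)
    case 0
    then show ?case
      using v gh(2,3) subgrp_zero[OF B(1)]
      by (intro conjI bexI[of _ 0]) (simp_all add: u_def y_def z_def)
  next
    case (Suc k)
    then obtain b where b: "b \<in> B" "g k + z k = b + y k" and u: "u k \<in> B"
      by auto
    have "u k + (b + (y k + - u k - y k) - b) \<in> B"
      by (intro subgrp_add[OF B(1)] subgrp_diff[OF B(1)] subgrp_uminus[OF B(1)] yB u b)
    then have "u (Suc k) \<in> B"
      by (simp add: u_Suc b(2) word del: add_uminus_conv_diff)
    moreover have "\<exists>b\<in>B. g (Suc k) + z (Suc k) = b + y (Suc k)"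
    proof (cases "even k")
      case True
      have "g k = b"
        using b(2) True by (simp add: z_def y_def)
      have "b + (x + (u k + b) - x) \<in> B"
        by (intro subgrp_add[OF B(1)] conj u b)
      moreover have "g (Suc k) + z (Suc k) = b + (x + (u k + b) - x) + y (Suc k)"
        using True \<open>g k = b\<close>
        by (simp add: g_Suc h_eq z_def y_def word del: add_uminus_conv_diff)
      ultimately show ?thesis
        by blast
    next
      case False
      have gk: "g k = b + x"
      proof -
        have "g k = (g k + z k) + x + x"
          using False by (simp add: z_def word del: add_uminus_conv_diff)
        also have "\<dots> = b + x"
          using False unfolding b(2) by (simp add: y_def word del: add_uminus_conv_diff)
        finally show ?thesis .
      qed
      have "b + (- x + (u k + b) + x) \<in> B"
        by (intro subgrp_add[OF B(1)] conj u b)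
      moreover have "g (Suc k) + z (Suc k) = b + (- x + (u k + b) + x) + y (Suc k)"
        using False gk
        by (simp add: g_Suc h_eq z_def y_def word del: add_uminus_conv_diff)
      ultimately show ?thesis
        by blast
    qed
    ultimately show ?case ..
  qed
  have "\<exists>n. g n = h n"
  proof -
    have "v \<in> G" "x \<in> G" "- x - x \<in> G" "0 \<in> G"
      using v B H x G by (auto intro: subgrp_closed)
    then show ?thesis
      using alt[unfolded alternating_nilpotent_def, rule_format, of x "- x - x" g h] gh
      by (simp add: z_def[abs_def])
  qed
  then obtain n where "g n = h n" ..
  then have "u n \<in> K"
    using subgrp_zero[OF K(1)] by (simp add: u_def)
  moreover have "u 0 \<notin> K"
    using v gh by (simp add: u_def)
  moreover have "u n \<notin> K" if "\<And>k. u k \<notin> K \<Longrightarrow> u (Suc k) \<notin> K"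
    by (induction n) (use that \<open>u 0 \<notin> K\<close> in auto)
  ultimately obtain k where k: "u k \<notin> K" "u (Suc k) \<in> K"
    by blast
  obtain b where b: "b \<in> B" "g k + z k = b + y k" and u: "u k \<in> B"
    using inv by auto
  have bH: "b \<in> H"
    using b B by auto
  have "comm (u k) (b + y k) \<in> K"
    using k(2) by (simp only: u_Suc b(2))
  then have "- comm (u k) b + comm (u k) (b + y k) \<in> K"
    by (rule subgrp_add[OF K(1) subgrp_uminus[OF K(1) ab[OF u b(1)]]])
  then have "b + comm (u k) (y k) - b \<in> K"
    unfolding comm_add_right by (simp add: word del: add_uminus_conv_diff)
  then have "- b + (b + comm (u k) (y k) - b) + b \<in> K"
    by (rule normal_inD'[OF K(2) H(1) bH])
  then have "comm (u k) (y k) \<in> K"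
    by (simp add: word del: add_uminus_conv_diff)
  then have "comm (u k) x \<in> K"
  proof (cases "even k")
    case False
    then have "comm (u k) (- x) \<in> K"
      using \<open>comm (u k) (y k) \<in> K\<close> by (simp add: y_def)
    then have "- (- x) + - comm (u k) (- x) - - (- x) \<in> K"
      using x by (intro normal_inD[OF K(2)] subgrp_uminus[OF K(1)]) simp
    then show ?thesis
      unfolding comm_uminus_right[symmetric] by simp
  qed (simp add: y_def)
  then show thesis
    using that[of "u k"] k u by blast
qed

text \<open>Choose w in A - K with the largest centralizer L modulo K. It contains A; if it were not
  H, nilpotency of H modulo A would yield an x outside L that normalizes L. The set B of elements of
  A centralized by L is then stable under x, so by the previous lemma it contains some w' outside K
  that commutes with x modulo K. The centralizer of w' contains both L and x, against
  maximality.\<close>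

lemma nil_mod_abelian_normal:
  assumes alt: "alternating_nilpotent (+) G" and "finite G"
    and G: "subgrp G" and H: "subgrp H" "H \<subseteq> G" and K: "subgrp K" "normal_in K H" "K \<subseteq> H"
    and A: "subgrp A" "normal_in A H" "A \<subseteq> H" "K \<subset> A"
    and ab: "\<And>a b. a \<in> A \<Longrightarrow> b \<in> A \<Longrightarrow> comm a b \<in> K"
    and nil: "nil_mod H A"
  obtains a where "a \<in> A - K" "a \<in> centre_mod H K"
proof -
  define L where "L = centralizer_mod H K"
  have finH: "finite H"
    using H \<open>finite G\<close> finite_subset by blast
  have LH: "L w \<subseteq> H" for w
    by (auto simp: L_def centralizer_mod_def)
  have L: "subgrp (L w)" for w
    using H K by (simp add: L_def subgrp_centralizer_mod)
  have "finite (A - K)" "A - K \<noteq> {}"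
    using A finite_subset[OF _ finH, of A] by auto
  then have fin: "finite ((\<lambda>w. card (L w)) ` (A - K))" "(\<lambda>w. card (L w)) ` (A - K) \<noteq> {}"
    by auto
  from Max_in[OF this] obtain w
    where w: "w \<in> A - K" and "Max ((\<lambda>w. card (L w)) ` (A - K)) = card (L w)"
    by blast
  then have max: "card (L w') \<le> card (L w)" if "w' \<in> A - K" for w'
    using Max_ge[OF fin(1)] that by fastforce
  have "L w = H"
  proof (rule ccontr)
    assume "L w \<noteq> H"
    then have "L w \<subset> H"
      using LH by blast
    moreover have "A \<subseteq> L w"
      using w ab A by (auto simp: L_def centralizer_mod_def)
    ultimately obtain x where x: "x \<in> H - L w" and comm: "\<And>g. g \<in> H \<Longrightarrow> comm x g \<in> L w"
      using nil_mod_escape[OF nil] H by blast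
    then have xn: "x \<in> normalizer_in H (L w)"
      using H L LH by (intro comm_in_imp_normalizer) auto
    define B where "B = {b \<in> A. L w \<subseteq> L b}"
    have "comm (a - b) l \<in> K" if "a \<in> B" "b \<in> B" "l \<in> L w" for a b l
    proof (rule subgrp_comm_left[OF H(1) K(1,2)])
      show "a \<in> H" "b \<in> H" "comm a l \<in> K" "comm b l \<in> K"
        using that A by (auto simp: B_def L_def centralizer_mod_def)
    qed
    moreover have "0 \<in> B"
      using A K LH subgrp_zero by (auto simp: B_def L_def centralizer_mod_def)
    moreover have "a - b \<in> A" if "a \<in> B" "b \<in> B" for a b
      using that A(1) by (auto simp: B_def intro: subgrp_diff)
    ultimately have "subgrp B"
      using LH unfolding subgrp_def B_def by (auto simp: L_def centralizer_mod_def)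
    have conj: "y + b - y \<in> B" if b: "b \<in> B" and y: "y \<in> normalizer_in H (L w)" for b y
    proof -
      have yH: "y \<in> H"
        using y by (simp add: normalizer_in_def)
      have "y + b - y \<in> A"
        using b yH by (auto simp: B_def intro: normal_inD[OF A(2)])
      moreover have "comm (y + b - y) l \<in> K" if l: "l \<in> L w" for l
      proof -
        have "- y + l + y \<in> L w"
          using l y by (simp add: normalizer_in_def)
        then have "comm b (- y + l + y) \<in> K"
          using b by (auto simp: B_def L_def centralizer_mod_def)
        then show ?thesis
          unfolding comm_conj_left by (intro normal_inD[OF K(2) yH])
      qed
      ultimately show ?thesis
        using LH by (auto simp: B_def L_def centralizer_mod_def)
    qed
    have conj': "- x + b + x \<in> B" if "b \<in> B" for b
      using conj[OF that subgrp_uminus[OF subgrp_normalizer_in[OF H(1)] xn]] by simp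
    obtain w' where w': "w' \<in> B - K" "comm w' x \<in> K"
    proof (rule alternating_fixes_in_normalized[OF alt G H K(1,2) \<open>subgrp B\<close>, of x w])
      show "B \<subseteq> H" "x \<in> H" "w \<in> B - K"
        using A w x by (auto simp: B_def)
      show "comm a b \<in> K" if "a \<in> B" "b \<in> B" for a b
        using that ab by (auto simp: B_def)
      show "x + b - x \<in> B" if "b \<in> B" for b
        by (rule conj[OF that xn])
    qed (auto intro: conj')
    have "L w \<subset> L w'"
      using w' x by (auto simp: B_def L_def centralizer_mod_def)
    then have "card (L w) < card (L w')"
      by (intro psubset_card_mono finite_subset[OF LH finH])
    moreover have "w' \<in> A - K"
      using w' by (auto simp: B_def)
    ultimately show False
      using max[of w'] by simp
  qed
  then have "w \<in> centre_mod H K"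
    using w A by (auto simp: L_def centralizer_mod_def centre_mod_def)
  then show thesis
    using that w by blast
qed

section \<open>Proper and maximal subgroups of a section\<close>

definition proper_over :: "'a set \<Rightarrow> 'a set \<Rightarrow> 'a set set" where
  "proper_over H K = {M. subgrp M \<and> K \<subseteq> M \<and> M \<subset> H}"

definition maximal_over :: "'a set \<Rightarrow> 'a set \<Rightarrow> 'a set set" where
  "maximal_over H K = {M \<in> proper_over H K. \<forall>M'\<in>proper_over H K. M \<subseteq> M' \<longrightarrow> M' = M}"

lemma ex_maximal_over:
  assumes "finite H" "M \<in> proper_over H K"
  obtains M' where "M' \<in> maximal_over H K" "M \<subseteq> M'"
proof -
  have "finite (proper_over H K)"
    using assms(1) by (rule_tac finite_subset[of _ "Pow H"]) (auto simp: proper_over_def)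
  from finite_has_maximal2[OF this assms(2)] obtain M'
    where "M' \<in> proper_over H K" "M \<subseteq> M'" "\<forall>b\<in>proper_over H K. M' \<subseteq> b \<longrightarrow> M' = b"
    by blast
  then show thesis
    using that[of M'] by (auto simp: maximal_over_def)
qed

lemma maximal_over_proper: "M \<in> maximal_over H K \<Longrightarrow> M \<in> proper_over H K"
  by (auto simp: maximal_over_def)

lemma maximal_over_eq:
  "M \<in> maximal_over H K \<Longrightarrow> M' \<in> proper_over H K \<Longrightarrow> M \<subseteq> M' \<Longrightarrow> M' = M"
  by (auto simp: maximal_over_def)

text \<open>If two distinct maximal subgroups had an intersection larger than \<open>K\<close>, choose it as large
  as possible: its normalizer grows inside both of them and lies in a third maximal subgroup.\<close>

lemma maximal_over_inter:
  assumes "finite H" and H: "subgrp H"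
    and simple: "\<And>N. N \<in> proper_over H K \<Longrightarrow> normal_in N H \<Longrightarrow> N = K"
    and nil: "\<And>M. M \<in> proper_over H K \<Longrightarrow> nil_mod M K"
    and "M1 \<in> maximal_over H K" "M2 \<in> maximal_over H K" "M1 \<noteq> M2"
  shows "M1 \<inter> M2 = K"
  using assms(5-7)
proof (induction "card H - card (M1 \<inter> M2)" arbitrary: M1 M2 rule: less_induct)
  case (less M1 M2)
  define D where "D = M1 \<inter> M2"
  have M: "M1 \<in> proper_over H K" "M2 \<in> proper_over H K"
    using less.prems maximal_over_proper by auto
  show ?case
  proof (rule ccontr)
    assume "M1 \<inter> M2 \<noteq> K"
    then have "D \<noteq> K" by (simp add: D_def)
    have D: "D \<in> proper_over H K"
      using M unfolding D_def proper_over_def subgrp_def by blast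
    then have subD: "subgrp D" "D \<subseteq> H" "K \<subseteq> D"
      by (auto simp: proper_over_def)
    have "normalizer_in H D \<noteq> H"
      using simple[OF D normalizer_in_eq] \<open>D \<noteq> K\<close> by blast
    moreover have "normalizer_in H D \<subseteq> H"
      by (auto simp: normalizer_in_def)
    moreover have DN: "D \<subseteq> normalizer_in H D"
      by (rule subset_normalizer_in[OF subD(1,2)])
    ultimately have "normalizer_in H D \<in> proper_over H K"
      using subgrp_normalizer_in[OF H, of D] subD by (auto simp: proper_over_def)
    then obtain M3 where M3: "M3 \<in> maximal_over H K" "normalizer_in H D \<subseteq> M3"
      using ex_maximal_over[OF \<open>finite H\<close>] by blast
    have "M = M3" if M: "M \<in> maximal_over H K" and DM: "D \<subset> M" for M
    proof (rule ccontr)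
      assume "M \<noteq> M3"
      have Mp: "M \<in> proper_over H K" "subgrp M" "M \<subseteq> H"
        using M maximal_over_proper by (auto simp: proper_over_def)
      obtain x where x: "x \<in> M - D" "\<And>g. g \<in> M \<Longrightarrow> comm x g \<in> D"
        by (rule nil_mod_escape[OF nil[OF Mp(1)] subD(3) DM Mp(2)]) blast
      have "x \<in> normalizer_in M D"
        using x DM subD Mp by (intro comm_in_imp_normalizer) auto
      then have "x \<in> M3"
        using M3 Mp by (auto simp: normalizer_in_def)
      then have DM3: "D \<subset> M \<inter> M3"
        using x(1) DM DN M3(2) by blast
      have MH: "M \<inter> M3 \<subseteq> H"
        using Mp by blast
      have "card D < card (M \<inter> M3)"
        by (rule psubset_card_mono[OF finite_subset[OF MH \<open>finite H\<close>] DM3])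
      moreover have "card (M \<inter> M3) \<le> card H"
        by (rule card_mono[OF \<open>finite H\<close> MH])
      ultimately have "M \<inter> M3 = K"
        using less.hyps[OF _ M M3(1) \<open>M \<noteq> M3\<close>] unfolding D_def by linarith
      then show False
        using x(1) \<open>x \<in> M3\<close> subD(3) by blast
    qed
    moreover have "D \<subset> M1" "D \<subset> M2"
      using less.prems(3) maximal_over_eq[OF less.prems(1) M(2)] maximal_over_eq[OF less.prems(2) M(1)]
      unfolding D_def by blast+
    ultimately show False
      using less.prems(1-3) by metis
  qed
qed

text \<open>Call two elements joined if some maximal subgroup contains both. Since the centre is
  trivial, every element outside K has a proper centralizer, so each element is joined to itself.
  Being joined passes back from g + h, h + g to g, h. As sequences with parameter 0 meet, all pairs
  are joined. But distinct maximal subgroups intersect in K, so an element of M - K is not joined to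
  one outside M.\<close>

lemma nil_mod_simple:
  assumes alt: "alternating_nilpotent (+) G" and "finite G" "subgrp G"
    and H: "subgrp H" "H \<subseteq> G" and K: "subgrp K" "normal_in K H" "K \<subseteq> H"
    and simple: "\<And>N. N \<in> proper_over H K \<Longrightarrow> normal_in N H \<Longrightarrow> N = K"
    and nil: "\<And>M. M \<in> proper_over H K \<Longrightarrow> nil_mod M K"
    and centre: "centre_mod H K = K"
  shows "H = K"
proof (rule ccontr)
  assume "H \<noteq> K"
  have finH: "finite H"
    using assms finite_subset by blast
  have Kp: "K \<in> proper_over H K"
    using \<open>H \<noteq> K\<close> K by (auto simp: proper_over_def)
  have cover: "\<exists>M\<in>maximal_over H K. g \<in> M" if "g \<in> H" for g
  proof -
    have "\<exists>M\<in>proper_over H K. g \<in> M"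
    proof (cases "g \<in> K")
      case False
      define L where "L = centralizer_mod H K g"
      have "L \<noteq> H"
        using False that centre by (auto simp: L_def centralizer_mod_def centre_mod_def)
      moreover have "comm g k \<in> K" if k: "k \<in> K" for k
        using k \<open>g \<in> H\<close> by (intro subgrp_diff[OF K(1)] normal_inD[OF K(2)])
      then have "K \<subseteq> L"
        using K(3) by (auto simp: L_def centralizer_mod_def)
      moreover have "g \<in> L"
        using that subgrp_zero[OF K(1)] by (simp add: L_def centralizer_mod_def)
      ultimately have "L \<in> proper_over H K"
        using subgrp_centralizer_mod[OF H(1) K(1,2), of g]
        by (auto simp: L_def proper_over_def centralizer_mod_def)
      then show ?thesis
        using \<open>g \<in> L\<close> by blast
    qed (use Kp in blast)
    then show ?thesis
      using ex_maximal_over[OF finH] by (metis subsetD)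
  qed
  \<comment> \<open>By maximality the normalizer is M or H, and H is excluded because M would be a
    normal subgroup other than K.\<close>
  have normalizer: "normalizer_in H M \<subseteq> M" if M: "M \<in> maximal_over H K" "M \<noteq> K" for M
  proof (rule ccontr)
    assume *: "\<not> normalizer_in H M \<subseteq> M"
    have Mp: "M \<in> proper_over H K" "subgrp M" "M \<subseteq> H" "K \<subseteq> M"
      using M maximal_over_proper by (auto simp: proper_over_def)
    have "M \<subseteq> normalizer_in H M"
      using Mp by (intro subset_normalizer_in)
    moreover have "normalizer_in H M \<subseteq> H"
      by (auto simp: normalizer_in_def)
    ultimately have "normalizer_in H M \<in> proper_over H K \<or> normalizer_in H M = H"
      using subgrp_normalizer_in[OF H(1), of M] Mp by (auto simp: proper_over_def)
    then show False
    proof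
      assume "normalizer_in H M \<in> proper_over H K"
      then show False
        using maximal_over_eq[OF M(1) _ \<open>M \<subseteq> normalizer_in H M\<close>] * by blast
    next
      assume "normalizer_in H M = H"
      then show False
        using simple[OF Mp(1) normalizer_in_eq] M by blast
    qed
  qed
  have inter: "M1 \<inter> M2 = K"
    if "M1 \<in> maximal_over H K" "M2 \<in> maximal_over H K" "M1 \<noteq> M2" for M1 M2
    by (rule maximal_over_inter[OF finH H(1) simple nil that])
  define joined where "joined g h \<longleftrightarrow> (\<exists>M\<in>maximal_over H K. g \<in> M \<and> h \<in> M)" for g h
  \<comment> \<open>\<open>h + g\<close> arises from \<open>g + h\<close> by conjugation with g. If
    a maximal M contains both and \<open>g + h\<close> is not in K, then M and its conjugate share
    an element outside K and coincide; so g normalizes M and lies in M.\<close>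
  have joined_back: "joined g h" if gH: "g \<in> H" "h \<in> H" and j: "joined (g + h) (h + g)" for g h
  proof -
    obtain M where M: "M \<in> maximal_over H K" "g + h \<in> M" "h + g \<in> M"
      using j by (auto simp: joined_def)
    have Mp: "M \<in> proper_over H K" "subgrp M" "M \<subset> H" "K \<subseteq> M"
      using M maximal_over_proper by (auto simp: proper_over_def)
    show ?thesis
    proof (cases "g + h \<in> K")
      case True
      obtain M' where M': "M' \<in> maximal_over H K" "g \<in> M'"
        using cover[OF gH(1)] by blast
      have "subgrp M'" "K \<subseteq> M'"
        using maximal_over_proper[OF M'(1)] by (auto simp: proper_over_def)
      then have "- g + (g + h) \<in> M'"
        using M'(2) True subgrp_add[of M' "- g" "g + h"] subgrp_uminus[of M' g] by blast
      then show ?thesis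
        using M' by (auto simp: joined_def)
    next
      case False
      define C where "C = {x \<in> H. - g + x + g \<in> M}"
      have "subgrp C"
        unfolding subgrp_def
      proof (intro conjI ballI)
        show "0 \<in> C"
          using H(1) Mp(2) by (simp add: C_def subgrp_zero)
      next
        fix a b assume ab: "a \<in> C" "b \<in> C"
        then have "(- g + a + g) - (- g + b + g) \<in> M" "a - b \<in> H"
          using Mp H(1) by (simp_all only: C_def mem_Collect_eq subgrp_diff)
        then show "a - b \<in> C"
          by (simp add: C_def word del: add_uminus_conv_diff)
      qed
      moreover have "K \<subseteq> C"
        using normal_inD'[OF K(2) H(1) gH(1)] K(3) Mp(4) by (auto simp: C_def)
      moreover have "C \<noteq> H"
      proof
        assume "C = H"
        have "x \<in> M" if x: "x \<in> H" for x
        proof -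
          have "g + x - g \<in> C"
            unfolding \<open>C = H\<close> by (intro subgrp_diff subgrp_add H gH x)
          then show ?thesis
            by (simp add: C_def word del: add_uminus_conv_diff)
        qed
        then show False
          using Mp by blast
      qed
      ultimately have "C \<in> proper_over H K"
        by (auto simp: proper_over_def C_def)
      then obtain M' where M': "M' \<in> maximal_over H K" "C \<subseteq> M'"
        by (rule ex_maximal_over[OF finH])
      have "g + h \<in> C"
        using M(3) subgrp_add[OF H(1) gH] by (simp add: C_def)
      then have "M' = M"
        using inter[OF M'(1) M(1)] False M M' by blast
      then have conj: "g + m - g \<in> M" if "m \<in> M" for m
      proof -
        have "g + m - g \<in> H"
          using that Mp gH by (intro subgrp_diff subgrp_add H) auto
        then have "g + m - g \<in> C"
          using that by (simp add: C_def word del: add_uminus_conv_diff)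
        then show ?thesis
          using M' \<open>M' = M\<close> by blast
      qed
      \<comment> \<open>An injection of the finite set M into itself is onto; this supplies the
        inverse conjugation that \<open>normalizer_in\<close> asks for.\<close>
      have surj: "(\<lambda>m. g + m - g) ` M = M"
      proof (rule endo_inj_surj)
        show "finite M"
          using Mp finH finite_subset by blast
        show "inj_on (\<lambda>m. g + m - g) M"
          by (rule inj_onI) (simp add: diff_eq_eq)
      qed (use conj in auto)
      have "- g + m + g \<in> M" if "m \<in> M" for m
      proof -
        from that have "m \<in> (\<lambda>m. g + m - g) ` M"
          by (simp only: surj)
        then obtain m' where "m' \<in> M" and m': "m = g + m' - g" ..
        moreover have "- g + m + g = m'"
          unfolding m' by (simp add: word del: add_uminus_conv_diff)
        ultimately show ?thesis
          by simp
      qed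
      then have "g \<in> normalizer_in H M"
        using conj gH by (simp add: normalizer_in_def)
      then have "g \<in> M"
        using normalizer[OF M(1)] False M by blast
      moreover have "- g + (g + h) \<in> M"
        by (rule subgrp_add[OF Mp(2) subgrp_uminus[OF Mp(2) \<open>g \<in> M\<close>] M(2)])
      ultimately show ?thesis
        using M(1) by (auto simp: joined_def)
    qed
  qed
  have all_joined: "joined a b" if ab: "a \<in> H" "b \<in> H" for a b
  proof -
    obtain g h where gh: "malcev_seq (+) (\<lambda>k. if even k then 0 else 0) g h" "g 0 = a" "h 0 = b"
      by (rule malcev_seq_exists)
    have g_Suc: "g (Suc k) = g k + h k" and h_Suc: "h (Suc k) = h k + g k" for k
      using gh(1) by (simp_all add: malcev_seq_def)
    have ghH: "g k \<in> H \<and> h k \<in> H" for k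
      by (induction k) (simp_all add: gh ab g_Suc h_Suc subgrp_add[OF H(1)])
    obtain n where "g n = h n"
      using alt gh ab H subgrp_zero[OF assms(3)] unfolding alternating_nilpotent_def by blast
    then have "joined (g n) (h n)"
      using cover ghH[of n] by (auto simp: joined_def)
    then have "joined (g 0) (h 0)"
    proof (induction n)
      case (Suc n)
      then show ?case
        using joined_back ghH[of n] by (simp add: g_Suc h_Suc)
    qed
    then show ?thesis
      by (simp add: gh)
  qed
  obtain g where g: "g \<in> H - K"
    using \<open>H \<noteq> K\<close> K by blast
  obtain M where M: "M \<in> maximal_over H K" "g \<in> M"
    using cover g by blast
  obtain h where h: "h \<in> H - M"
    using maximal_over_proper[OF M(1)] by (auto simp: proper_over_def)
  obtain M' where M': "M' \<in> maximal_over H K" "g \<in> M'" "h \<in> M'"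
    using all_joined[of g h] g h by (auto simp: joined_def)
  then have "M \<inter> M' = K"
    using inter[OF M(1) M'(1)] h by blast
  then show False
    using g M M' by blast
qed

text \<open>The statement is about all sections H/K, so that one induction on
  \<open>card H - card K\<close> covers subgroups of H as well as quotients by a larger K. A
  nontrivial centre is factored out. With trivial centre, a proper normal subgroup would produce a
  central element by \<open>nil_mod_abelian_normal\<close>, and in the simple case
  \<open>nil_mod_simple\<close> leaves only H = K.\<close>

theorem nil_mod_if_alternating_nilpotent:
  assumes alt: "alternating_nilpotent (+) G" and G: "finite G" "subgrp G"
    and "subgrp H" "H \<subseteq> G" "subgrp K" "normal_in K H" "K \<subseteq> H"
  shows "nil_mod H K"
  using assms(4-)
proof (induction "card H - card K" arbitrary: H K rule: less_induct)
  case (less H K)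
  note H = \<open>subgrp H\<close> \<open>H \<subseteq> G\<close> and K = \<open>subgrp K\<close> \<open>normal_in K H\<close> \<open>K \<subseteq> H\<close>
  have finH: "finite H"
    using H G finite_subset by blast
  define Z where "Z = centre_mod H K"
  have Z: "subgrp Z" "K \<subseteq> Z" "Z \<subseteq> H" "normal_in Z H"
  proof -
    show "subgrp Z" "K \<subseteq> Z" "Z \<subseteq> H"
      using subgrp_centre_mod[OF H(1) K(1,2)] centre_mod_superset[OF H(1) K]
      by (auto simp: Z_def centre_mod_def)
    have "normal_in H H"
      using subgrp_diff[OF H(1)] subgrp_add[OF H(1)] by (simp add: normal_in_def)
    then show "normal_in Z H"
      unfolding Z_def by (intro normal_in_centre_mod H K) simp
  qed
  show ?case
  proof (cases "Z = K")
    case False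
    then have "card K < card Z" "card Z \<le> card H"
      using Z by (auto intro!: psubset_card_mono card_mono finH rev_finite_subset[OF finH])
    then have nil: "nil_mod H Z"
      using less.hyps[of H Z] H Z by simp
    show ?thesis
      unfolding nil_mod_def
    proof (intro allI impI)
      fix U assume U: "U \<subseteq> H" "U \<noteq> {}" "\<forall>u\<in>U. \<exists>g\<in>H. comm u g \<in> U"
      \<comment> \<open>An element of U that is central modulo K has all its commutators in K, and
        one of them is again in U.\<close>
      then obtain u where "u \<in> U" "u \<in> Z"
        using nil unfolding nil_mod_def by blast
      then show "U \<inter> K \<noteq> {}"
        using U unfolding Z_def centre_mod_def by blast
    qed
  next
    case True
    have simple: "N = K" if N: "N \<in> proper_over H K" "normal_in N H" for N
    proof (rule ccontr)
      assume "N \<noteq> K"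
      have N': "subgrp N" "K \<subset> N" "N \<subset> H"
        using N \<open>N \<noteq> K\<close> by (auto simp: proper_over_def)
      have "card N < card H" "card K < card N"
        using N' by (auto intro!: psubset_card_mono finH rev_finite_subset[OF finH])
      then have nilN: "nil_mod N K"
        using less.hyps[of N K] N' H K normal_in_subset[OF K(2), of N]
        by (meson diff_less_mono less_imp_le order_trans psubset_imp_subset)
      define A where "A = centre_mod N K"
      have KN: "normal_in K N"
        using N' K(2) normal_in_subset by blast
      have A: "subgrp A" "K \<subseteq> A" "normal_in A H"
        unfolding A_def using N'(2,3)
        by (intro subgrp_centre_mod centre_mod_superset normal_in_centre_mod N'(1) N(2) H K(1,2) KN;
            simp)+
      have "A \<subseteq> N"
        by (auto simp: A_def centre_mod_def)
      obtain x where "x \<in> N - K" "\<And>g. g \<in> N \<Longrightarrow> comm x g \<in> K"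
        by (rule nil_mod_escape[OF nilN _ N'(2,1)]) auto
      then have "A \<noteq> K"
        by (auto simp: A_def centre_mod_def)
      then have KA: "K \<subset> A"
        using A by blast
      have AH: "A \<subseteq> H"
        using \<open>A \<subseteq> N\<close> N' by blast
      have "card K < card A" "card A \<le> card H"
        using KA AH finH by (auto intro!: psubset_card_mono card_mono dest: finite_subset)
      then have nilA: "nil_mod H A"
        using less.hyps[of H A] H A AH by simp
      have ab: "comm a b \<in> K" if "a \<in> A" "b \<in> A" for a b
        using that by (auto simp: A_def centre_mod_def)
      obtain a where "a \<in> A - K" "a \<in> centre_mod H K"
        by (rule nil_mod_abelian_normal[OF alt G H K A(1,3) AH KA ab nilA])
      then show False
        using True by (simp add: Z_def)
    qed
    have nil: "nil_mod M K" if "M \<in> proper_over H K" for M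
    proof -
      have M: "subgrp M" "K \<subseteq> M" "M \<subset> H"
        using that by (auto simp: proper_over_def)
      then have "card M < card H" "card K \<le> card M"
        by (auto intro!: psubset_card_mono card_mono finH rev_finite_subset[OF finH])
      then show ?thesis
        using less.hyps[of M K] M H K normal_in_subset[OF K(2), of M]
        by (meson diff_less_mono order_trans psubset_imp_subset)
    qed
    have "H = K"
      by (rule nil_mod_simple[OF alt G H K simple nil True[unfolded Z_def]])
    then show ?thesis
      by (auto simp: nil_mod_def)
  qed
qed

text \<open>Each difference \<open>h k - g k\<close> has a commutator that is again such a
  difference, so nilpotency forces 0 among them.\<close>

corollary malcev_seq_meets_group:
  assumes "alternating_nilpotent (+) G" "finite G" "subgrp G"
    and seq: "malcev_seq (+) z g h" and in_G: "g 0 \<in> G" "h 0 \<in> G" "\<And>k. z k \<in> G"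
  shows "\<exists>n. g n = h n"
proof -
  have g_Suc: "g (Suc k) = g k + z k + h k" and h_Suc: "h (Suc k) = h k + z k + g k" for k
    using seq by (simp_all add: malcev_seq_def)
  have gh: "g k \<in> G \<and> h k \<in> G" for k
    by (induction k) (auto simp: g_Suc h_Suc in_G intro!: subgrp_add[OF assms(3)])
  define u where "u k = h k - g k" for k
  have "\<exists>x\<in>G. comm (u k) x \<in> range u" for k
  proof
    have "comm (u k) (g k + z k) = u (Suc k)"
      by (simp add: u_def g_Suc h_Suc word del: add_uminus_conv_diff)
    then show "comm (u k) (g k + z k) \<in> range u"
      by simp
    show "g k + z k \<in> G"
      using gh in_G by (intro subgrp_add[OF assms(3)]) auto
  qed
  then have "\<forall>v\<in>range u. \<exists>x\<in>G. comm v x \<in> range u"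
    by blast
  moreover have "range u \<subseteq> G"
    using gh subgrp_diff[OF assms(3)] by (auto simp: u_def)
  moreover have "nil_mod G {0}"
    using assms by (intro nil_mod_if_alternating_nilpotent[OF assms(1-3)])
      (auto simp: subgrp_def normal_in_def)
  ultimately have "range u \<inter> {0} \<noteq> {}"
    unfolding nil_mod_def by blast
  then obtain n where "u n = 0"
    by auto
  then have "g n = h n"
    by (simp add: u_def)
  then show ?thesis ..
qed

end

section \<open>Cayley representation\<close>

text \<open>Permutations under composition form an instance of \<open>group_add\<close>. By Cayley's
  theorem a group given by a carrier and a multiplication embeds into it, which makes the results on
  groups applicable.\<close>

typedef 'a bijection = "{f :: 'a \<Rightarrow> 'a. bij f}"
  morphisms apply_bijection Bijection
  by (rule exI[of _ id]) simp

setup_lifting type_definition_bijection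

instantiation bijection :: (type) group_add
begin

lift_definition zero_bijection :: "'a bijection" is id by simp
lift_definition plus_bijection :: "'a bijection \<Rightarrow> 'a bijection \<Rightarrow> 'a bijection" is "(\<circ>)"
  by (rule bij_comp)
lift_definition uminus_bijection :: "'a bijection \<Rightarrow> 'a bijection" is inv
  by (rule bij_imp_bij_inv)
lift_definition minus_bijection :: "'a bijection \<Rightarrow> 'a bijection \<Rightarrow> 'a bijection" is "\<lambda>f g. f \<circ> inv g"
  by (intro bij_comp bij_imp_bij_inv)

instance
  by standard (transfer; simp add: o_assoc bij_is_inj)+

end

section \<open>Transfer of Malcev sequences along homomorphisms\<close>

lemma malcev_seq_map:
  assumes "malcev_seq m z g h" and "\<And>k. g k \<in> M" "\<And>k. h k \<in> M" "\<And>k. z k \<in> M"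
    and "\<And>a b. a \<in> M \<Longrightarrow> b \<in> M \<Longrightarrow> m a b \<in> M"
    and "\<And>a b. a \<in> M \<Longrightarrow> b \<in> M \<Longrightarrow> \<phi> (m a b) = m' (\<phi> a) (\<phi> b)"
  shows "malcev_seq m' (\<phi> \<circ> z) (\<phi> \<circ> g) (\<phi> \<circ> h)"
  using assms unfolding malcev_seq_def by simp

lemma malcev_seq_in:
  assumes "malcev_seq m z g h" and "g 0 \<in> T" "h 0 \<in> T" "\<And>k. z k \<in> M" "T \<subseteq> M"
    and "\<And>a b. a \<in> T \<Longrightarrow> b \<in> M \<Longrightarrow> m a b \<in> T"
  shows "g k \<in> T \<and> h k \<in> T"
  using assms by (induction k) (auto simp: malcev_seq_def)

lemma alternating_nilpotent_hom_image:
  assumes alt: "alternating_nilpotent m T"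
    and closed: "\<And>a b. a \<in> T \<Longrightarrow> b \<in> T \<Longrightarrow> m a b \<in> T"
    and hom: "\<And>a b. a \<in> T \<Longrightarrow> b \<in> T \<Longrightarrow> \<phi> (m a b) = m' (\<phi> a) (\<phi> b)"
  shows "alternating_nilpotent m' (\<phi> ` T)"
  unfolding alternating_nilpotent_def
proof (intro allI ballI impI)
  fix g' h' c' d'
  assume "c' \<in> \<phi> ` T" "d' \<in> \<phi> ` T" "g' 0 \<in> \<phi> ` T" "h' 0 \<in> \<phi> ` T"
    and seq': "malcev_seq m' (\<lambda>k. if even k then c' else d') g' h'"
  then obtain a b c d where abcd: "a \<in> T" "b \<in> T" "c \<in> T" "d \<in> T"
    "g' 0 = \<phi> a" "h' 0 = \<phi> b" "c' = \<phi> c" "d' = \<phi> d"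
    by blast
  obtain g h where gh: "malcev_seq m (\<lambda>k. if even k then c else d) g h" "g 0 = a" "h 0 = b"
    by (rule malcev_seq_exists)
  have in_T: "g k \<in> T \<and> h k \<in> T" for k
    using malcev_seq_in[OF gh(1), of T T k] gh abcd closed by auto
  have "g' k = \<phi> (g k) \<and> h' k = \<phi> (h k)" for k
  proof (induction k)
    case 0
    then show ?case
      using abcd gh by simp
  next
    case (Suc k)
    then show ?case
      using seq' gh(1) in_T[of k] abcd by (simp add: malcev_seq_def hom closed)
  qed
  moreover obtain n where "g n = h n"
    using alt gh abcd unfolding alternating_nilpotent_def by blast
  ultimately show "\<exists>n. g' n = h' n"
    by metis
qed

text \<open>An element a acts by left multiplication on G and trivially elsewhere, which is a
  bijection of the whole type. It sends e to a, so the representation is faithful and a meeting of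
  the images is a meeting in G.\<close>

lemma malcev_seq_meets_finite_group:
  assumes fin: "finite G" and closed: "\<And>a b. a \<in> G \<Longrightarrow> b \<in> G \<Longrightarrow> m a b \<in> G"
    and assoc: "\<And>a b c. a \<in> G \<Longrightarrow> b \<in> G \<Longrightarrow> c \<in> G \<Longrightarrow> m (m a b) c = m a (m b c)"
    and e: "e \<in> G" "\<And>a. a \<in> G \<Longrightarrow> m e a = a" "\<And>a. a \<in> G \<Longrightarrow> m a e = a"
    and inv: "\<And>a. a \<in> G \<Longrightarrow> \<exists>b\<in>G. m b a = e"
    and alt: "alternating_nilpotent m G"
    and seq: "malcev_seq m z g h" and in_G: "g 0 \<in> G" "h 0 \<in> G" "\<And>k. z k \<in> G"
  shows "\<exists>n. g n = h n"
proof -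
  define L where "L a = (\<lambda>x. if x \<in> G then m a x else x)" for a
  define \<phi> where "\<phi> a = Bijection (L a)" for a
  have "bij (L a)" if a: "a \<in> G" for a
  proof -
    obtain b where b: "b \<in> G" "m b a = e"
      using inv[OF a] by blast
    have "inj_on (m a) G"
    proof (rule inj_onI)
      fix x y assume xy: "x \<in> G" "y \<in> G" "m a x = m a y"
      have "x = m b (m a x)"
        using a b xy(1,2) e by (simp flip: assoc)
      also have "\<dots> = y"
        unfolding xy(3) using a b xy(1,2) e by (simp flip: assoc)
      finally show "x = y" .
    qed
    moreover from this have "m a ` G = G"
      using fin closed[OF a] by (intro endo_inj_surj) auto
    ultimately have "bij_betw (m a) G G"
      by (simp add: bij_betw_def)
    then have "bij_betw (L a) G G"
      by (rule bij_betw_cong[THEN iffD1, rotated]) (simp add: L_def)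
    moreover have "bij_betw (L a) (- G) (- G)"
      by (rule bij_betw_cong[THEN iffD1, of _ id]) (simp_all add: L_def)
    ultimately have "bij_betw (L a) (G \<union> - G) (G \<union> - G)"
      by (rule bij_betw_combine) simp
    then show ?thesis
      by simp
  qed
  then have app: "apply_bijection (\<phi> a) = L a" if "a \<in> G" for a
    using that by (simp add: \<phi>_def Bijection_inverse)
  have hom: "\<phi> (m a b) = \<phi> a + \<phi> b" if "a \<in> G" "b \<in> G" for a b
  proof -
    have "apply_bijection (\<phi> (m a b)) = apply_bijection (\<phi> a + \<phi> b)"
      using that closed assoc by (auto simp: app plus_bijection.rep_eq L_def)
    then show ?thesis
      by (simp add: apply_bijection_inject)
  qed
  have inj: "a = b" if "a \<in> G" "b \<in> G" "\<phi> a = \<phi> b" for a b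
  proof -
    have "L a e = L b e"
      using that app by metis
    then show ?thesis
      using that e by (simp add: L_def)
  qed
  have e0: "\<phi> e = 0"
  proof -
    have "\<phi> e + \<phi> e = \<phi> e + 0"
      using hom[OF e(1) e(1)] e by simp
    then show ?thesis
      by (rule add_left_imp_eq)
  qed
  have "subgrp (\<phi> ` G)"
    unfolding subgrp_def
  proof (intro conjI ballI)
    show "0 \<in> \<phi> ` G"
      using e0 e by (metis image_eqI)
    fix x y assume "x \<in> \<phi> ` G" "y \<in> \<phi> ` G"
    then obtain a b where ab: "a \<in> G" "b \<in> G" "x = \<phi> a" "y = \<phi> b"
      by blast
    obtain c where c: "c \<in> G" "m c b = e"
      using inv ab by blast
    have "\<phi> c + \<phi> b = 0"
      using hom[OF c(1) ab(2)] c e0 by simp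
    then have "\<phi> b = - \<phi> c"
      by (rule minus_unique[symmetric])
    then have "- \<phi> b = \<phi> c"
      by (simp only: minus_minus)
    then have "x - y = \<phi> (m a c)"
      using ab c hom by (simp add: diff_conv_add_uminus del: add_uminus_conv_diff)
    then show "x - y \<in> \<phi> ` G"
      using ab c closed by simp
  qed
  moreover have "alternating_nilpotent (+) (\<phi> ` G)"
    by (rule alternating_nilpotent_hom_image[where \<phi> = \<phi>, OF alt]) (simp_all add: closed hom)
  moreover from in_G have gh: "g k \<in> G \<and> h k \<in> G" for k
    using malcev_seq_in[OF seq, of G G k] closed by simp
  moreover have "malcev_seq (+) (\<phi> \<circ> z) (\<phi> \<circ> g) (\<phi> \<circ> h)"
    by (rule malcev_seq_map[where M = G, OF seq]) (simp_all add: gh in_G closed hom)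
  ultimately have "\<exists>n. (\<phi> \<circ> g) n = (\<phi> \<circ> h) n"
    using fin in_G by (intro malcev_seq_meets_group[of "\<phi> ` G" "\<phi> \<circ> z" "\<phi> \<circ> g" "\<phi> \<circ> h"])
      (simp_all add: o_def)
  then show ?thesis
    using inj gh by auto
qed

section \<open>Finite semigroups\<close>

context monoid_mult
begin

text \<open>For idempotents \<open>e\<close>, \<open>f\<close> and \<open>M = T\<^sup>1\<close>, \<open>H_class M f e\<close> is \<open>R\<^sub>f \<inter> L\<^sub>e\<close> for Green's relations. In a regular
  \<open>J\<close>-class, \<open>linked M e w f\<close> says that \<open>e w f\<close> stays in it, i.e. that an entry of a sandwich matrix
  does not vanish.\<close>

definition H_class :: "'a set \<Rightarrow> 'a \<Rightarrow> 'a \<Rightarrow> 'a set" where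
  "H_class M f e = {x. f * x = x \<and> x * e = x \<and> (\<exists>t\<in>M. x * t = f) \<and> (\<exists>s\<in>M. s * x = e)}"

definition linked :: "'a set \<Rightarrow> 'a \<Rightarrow> 'a \<Rightarrow> 'a \<Rightarrow> bool" where
  "linked M e w f \<longleftrightarrow> (\<exists>t\<in>M. e * w * f * t = e) \<and> (\<exists>s\<in>M. s * (e * w * f) = f)"

context
  fixes T M :: "'a set"
  assumes T_mult: "\<And>a b. a \<in> T \<Longrightarrow> b \<in> T \<Longrightarrow> a * b \<in> T"
    and fin_T: "finite T"
    and alt: "alternating_nilpotent (*) T"
  defines "M \<equiv> insert 1 T"
begin

section \<open>Idempotents and nonvanishing sandwich entries in a finite semigroup T\<close>

lemma M_one: "1 \<in> M"
  and T_M: "a \<in> T \<Longrightarrow> a \<in> M"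
  and M_mult: "a \<in> M \<Longrightarrow> b \<in> M \<Longrightarrow> a * b \<in> M"
  and TM_mult: "a \<in> T \<Longrightarrow> b \<in> M \<Longrightarrow> a * b \<in> T"
  and MT_mult: "a \<in> M \<Longrightarrow> b \<in> T \<Longrightarrow> a * b \<in> T"
  using T_mult by (auto simp: M_def)

lemmas M_closed = M_one T_M M_mult TM_mult MT_mult

text \<open>Two distinct such elements would form a right zero semigroup, on which the sequence
  with parameter \<open>a\<close> just swaps \<open>a\<close> and \<open>b\<close>.\<close>

lemma right_zero_trivial:
  assumes ab: "a \<in> T" "b \<in> T" "a * b = b" "b * a = a"
  shows "a = b"
proof (rule ccontr)
  assume "a \<noteq> b"
  obtain g h where gh: "malcev_seq (*) (\<lambda>k. if even k then a else a) g h" "g 0 = a" "h 0 = b"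
    by (rule malcev_seq_exists)
  have idem: "a * a = a"
    using ab by (metis mult_assoc)
  have Suc_eqs: "g (Suc k) = g k * a * h k" "h (Suc k) = h k * a * g k" for k
    using gh(1) by (simp_all add: malcev_seq_def)
  have "(g k = a \<and> h k = b) \<or> (g k = b \<and> h k = a)" for k
  proof (induction k)
    case (Suc k)
    then show ?case
      by (elim disjE conjE) (simp_all add: Suc_eqs ab idem)
  qed (simp add: gh(2,3))
  moreover obtain n where "g n = h n"
    using alt gh ab unfolding alternating_nilpotent_def by blast
  ultimately show False
    using \<open>a \<noteq> b\<close> by metis
qed

text \<open>Dually, on a left zero semigroup the sequence with parameter a stays at (a, b).\<close>

lemma left_zero_trivial:
  assumes ab: "a \<in> T" "b \<in> T" "a * b = a" "b * a = b"
  shows "a = b"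
proof (rule ccontr)
  assume "a \<noteq> b"
  obtain g h where gh: "malcev_seq (*) (\<lambda>k. if even k then a else a) g h" "g 0 = a" "h 0 = b"
    by (rule malcev_seq_exists)
  have idem: "a * a = a"
    using ab by (metis mult_assoc)
  have Suc_eqs: "g (Suc k) = g k * a * h k" "h (Suc k) = h k * a * g k" for k
    using gh(1) by (simp_all add: malcev_seq_def)
  have "g k = a \<and> h k = b" for k
    by (induction k) (auto simp: gh(2,3) Suc_eqs ab idem)
  moreover obtain n where "g n = h n"
    using alt gh ab unfolding alternating_nilpotent_def by blast
  ultimately show False
    using \<open>a \<noteq> b\<close> by metis
qed

text \<open>For u = e w and r = f t e one has u r = e. Then f and r u satisfy the right zero
  relations, so f = r u and u f = u r u = u. Thus e w already lies in the L-class of f.\<close>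

lemma linked_absorb:
  assumes e: "e \<in> T" "e * e = e" and f: "f \<in> T" "f * f = f"
    and w: "w \<in> M" and link: "linked M e w f"
  shows "e * w * f = e * w"
proof -
  obtain t s where ts: "t \<in> M" "s \<in> M" and t: "e * w * f * t = e" and s: "s * (e * w * f) = f"
    using link by (auto simp: linked_def)
  define u where "u = e * w"
  define r where "r = f * t * e"
  have ut: "u * f * t = e" and us: "s * (u * f) = f" and eu: "e * u = u"
    using t s e by (simp_all add: u_def flip: mult_assoc)
  have ur: "u * r = e"
    using ut e by (simp add: r_def flip: mult_assoc)
  have fr: "f * r = r"
    using f by (simp add: r_def flip: mult_assoc)
  have rT: "r * u \<in> T"
    unfolding r_def u_def using f ts e w by (simp add: M_closed)
  have "r * u * f = f * (r * u * f)"
    using fr by (simp flip: mult_assoc)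
  also have "\<dots> = s * (u * f) * (r * u * f)"
    by (simp only: us)
  also have "\<dots> = s * ((u * (f * r)) * u * f)"
    by (simp add: mult_assoc)
  also have "\<dots> = f"
    using us by (simp add: fr ur eu)
  finally have "r * u * f = f" .
  moreover have "f * (r * u) = r * u"
    using fr by (simp flip: mult_assoc)
  ultimately have "f = r * u"
    using right_zero_trivial[OF f(1) rT] by simp
  then have "u * f = u * r * u"
    by (simp add: mult_assoc)
  also have "\<dots> = u"
    unfolding ur by (rule eu)
  finally show ?thesis
    unfolding u_def .
qed

lemma linked_one:
  assumes e: "e \<in> T" "e * e = e" and f: "f \<in> T" "f * f = f" and link: "linked M e 1 f"
  shows "e = f"
proof -
  have ef: "e * f = e"
    using linked_absorb[OF e f M_one link] by simp
  obtain s where "s \<in> M" "s * e = f"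
    using link by (auto simp: linked_def ef)
  then have "f * e = s * (e * e)"
    by (simp flip: mult_assoc)
  then have "f * e = f"
    using \<open>s * e = f\<close> e(2) by simp
  then show ?thesis
    by (rule left_zero_trivial[OF e(1) f(1) ef])
qed

text \<open>By absorption e d d e factors as (e d f)(f d e). This prepares the replacement of a
  parameter 1: if d exchanges e and f, its square fixes e.\<close>

lemma linked_square:
  assumes e: "e \<in> T" "e * e = e" and f: "f \<in> T" "f * f = f" and d: "d \<in> M"
    and l1: "linked M e d f" and l2: "linked M f d e"
  shows "linked M e (d * d) e"
proof -
  have *: "e * (d * d) * e = e * d * f * (f * d * e)"
    using linked_absorb[OF e f d l1] f(2) by (metis mult_assoc)
  obtain t1 s1 where 1: "t1 \<in> M" "s1 \<in> M" "e * d * f * t1 = e" "s1 * (e * d * f) = f"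
    using l1 by (auto simp: linked_def)
  obtain t2 s2 where 2: "t2 \<in> M" "s2 \<in> M" "f * d * e * t2 = f" "s2 * (f * d * e) = e"
    using l2 by (auto simp: linked_def)
  have "e * (d * d) * e * (t2 * t1) = e * d * f * (f * d * e * t2) * t1"
    unfolding * by (simp add: mult_assoc)
  also have "\<dots> = e * d * (f * f) * t1"
    unfolding 2 by (simp add: mult_assoc)
  also have "\<dots> = e"
    using 1(3) f(2) by simp
  finally have t: "e * (d * d) * e * (t2 * t1) = e" .
  have "s2 * s1 * (e * (d * d) * e) = s2 * (s1 * (e * d * f)) * (f * d * e)"
    unfolding * by (simp add: mult_assoc)
  also have "\<dots> = s2 * (f * f * d * e)"
    unfolding 1 by (simp add: mult_assoc)
  also have "\<dots> = e"
    using 2(4) f(2) by simp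
  finally have "s2 * s1 * (e * (d * d) * e) = e" .
  then show ?thesis
    using t 1 2 M_mult unfolding linked_def by blast
qed

text \<open>Multiplication as in a Rees matrix semigroup: if the entry at e, c, f' does not vanish,
  the product takes its R-class from the left factor and its L-class from the right one.\<close>

lemma H_class_mult:
  assumes G: "G \<in> H_class M f e" and H: "H \<in> H_class M f' e'" and link: "linked M e c f'"
  shows "G * c * H \<in> H_class M f e'"
proof -
  obtain tG sG where G: "f * G = G" "G * e = G" "tG \<in> M" "G * tG = f" "sG \<in> M" "sG * G = e"
    using G by (auto simp: H_class_def)
  obtain tH sH where H: "f' * H = H" "H * e' = H" "tH \<in> M" "H * tH = f'" "sH \<in> M" "sH * H = e'"
    using H by (auto simp: H_class_def)
  obtain t s where link: "t \<in> M" "s \<in> M" "e * c * f' * t = e" "s * (e * c * f') = f'"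
    using link by (auto simp: linked_def)
  have "G * c * H * (tH * (t * tG)) = (G * e) * c * (H * tH) * t * tG"
    unfolding G by (simp add: mult_assoc)
  also have "\<dots> = G * (e * c * f' * t) * tG"
    unfolding H by (simp add: mult_assoc)
  also have "\<dots> = f"
    unfolding link by (simp add: G)
  finally have right: "G * c * H * (tH * (t * tG)) = f" .
  have "(sH * (s * sG)) * (G * c * H) = sH * s * (sG * G) * c * (f' * H)"
    unfolding H by (simp add: mult_assoc)
  also have "\<dots> = sH * (s * (e * c * f')) * H"
    unfolding G by (simp add: mult_assoc)
  also have "\<dots> = e'"
    unfolding link by (simp add: H mult_assoc)
  finally have left: "(sH * (s * sG)) * (G * c * H) = e'" .
  have "f * (G * c * H) = f * G * c * H" "G * c * H * e' = G * c * (H * e')"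
    by (simp_all add: mult_assoc)
  then have "f * (G * c * H) = G * c * H" "G * c * H * e' = G * c * H"
    by (simp_all only: G(1) H(2))
  moreover have "tH * (t * tG) \<in> M" "sH * (s * sG) \<in> M"
    using G H link M_mult by blast+
  ultimately show ?thesis
    using right left unfolding H_class_def by blast
qed

text \<open>Two idempotents R-related to x form a right zero semigroup, and two that are L-related
  to x a left zero semigroup.\<close>

lemma H_class_idems_eq:
  assumes x: "x \<in> H_class M f e" "x \<in> H_class M f' e'"
    and T: "e \<in> T" "f \<in> T" "e' \<in> T" "f' \<in> T"
  shows "f = f' \<and> e = e'"
proof
  obtain t s t' s' where *: "f * x = x" "x * e = x" "x * t = f" "s * x = e"
    "f' * x = x" "x * e' = x" "x * t' = f'" "s' * x = e'"
    using x by (auto simp: H_class_def)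
  have "f * (x * t') = x * t'" "f' * (x * t) = x * t"
    using *(1,5) by (simp_all flip: mult_assoc)
  moreover have "s * x * e' = s * x" "s' * x * e = s' * x"
    using *(2,6) by (simp_all add: mult_assoc)
  ultimately have "f * f' = f'" "f' * f = f" "e * e' = e" "e' * e = e'"
    by (simp_all only: *)
  then show "f = f'" "e = e'"
    by (auto intro: right_zero_trivial[OF T(2,4)] left_zero_trivial[OF T(1,3)])
qed

section \<open>Green's relations along a periodic sequence\<close>

context
  fixes w g h :: "nat \<Rightarrow> 'a" and p :: nat
  assumes seq: "malcev_seq (*) w g h" and w: "\<And>k. w k \<in> M" and T0: "g 0 \<in> T" "h 0 \<in> T"
    and p: "0 < p" "even p" and g_periodic: "\<And>k. g (k + p) = g k"
begin

lemma g_Suc: "g (Suc k) = g k * w k * h k" and h_Suc: "h (Suc k) = h k * w k * g k"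
  using seq by (simp_all add: malcev_seq_def)

lemma seq_in_T: "g k \<in> T" "h k \<in> T"
  by (induction k) (simp_all add: g_Suc h_Suc T0 w M_closed)

lemma g_periodic_mult: "g (k + p * n) = g k"
proof (induction n)
  case (Suc n)
  then show ?case
    using g_periodic[of "k + p * n"] by (simp add: ac_simps)
qed simp

lemma g_right: "\<exists>t\<in>M. g (k + n) = g k * t"
proof (induction n)
  case (Suc n)
  then obtain t where "t \<in> M" "g (k + n) = g k * t" ..
  then have "g (k + Suc n) = g k * (t * w (k + n) * h (k + n))"
    by (simp add: g_Suc mult_assoc)
  moreover have "t * w (k + n) * h (k + n) \<in> M"
    by (intro M_mult \<open>t \<in> M\<close> w T_M seq_in_T)
  ultimately show ?case ..
qed (auto intro!: bexI[of _ 1] M_one)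

lemma g_right_back: "\<exists>t\<in>M. g (k + n) * t = g k"
proof -
  have "n \<le> p * n"
    using p by simp
  then obtain t where "t \<in> M" "g (k + n + (p * n - n)) = g (k + n) * t"
    using g_right by blast
  then show ?thesis
    using \<open>n \<le> p * n\<close> g_periodic_mult[of k n] by (auto simp: add.assoc)
qed

lemma h_Suc_left: "\<exists>s\<in>M. h (Suc k) = s * g k"
  using h_Suc[of k] by (intro bexI[of _ "h k * w k"]) (auto intro: M_mult T_M seq_in_T w)

lemma g_Suc_left: "\<exists>s\<in>M. g (Suc k) = s * h k"
  using g_Suc[of k] by (intro bexI[of _ "g k * w k"]) (auto intro: M_mult T_M seq_in_T w)

text \<open>All \<open>g k\<close> are R-related, but for L only every second term is compared:
  \<open>g (k + 2)\<close> ends with \<open>h (k + 1)\<close>, which ends with \<open>g k\<close>.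
  So the L-classes of g and h change places with the parity of the index, and an even period is
  wanted.\<close>

lemma g_left: "\<exists>s\<in>M. g (k + 2 * n) = s * g k"
proof (induction n)
  case (Suc n)
  then obtain s where s: "s \<in> M" "g (k + 2 * n) = s * g k" ..
  obtain s1 s2 where "s1 \<in> M" "s2 \<in> M" "g (Suc (Suc (k + 2 * n))) = s1 * h (Suc (k + 2 * n))"
    "h (Suc (k + 2 * n)) = s2 * g (k + 2 * n)"
    using g_Suc_left h_Suc_left by blast
  then have "g (k + 2 * Suc n) = s1 * s2 * s * g k"
    by (simp add: s(2) mult_assoc)
  moreover have "s1 * s2 * s \<in> M"
    by (intro M_mult s \<open>s1 \<in> M\<close> \<open>s2 \<in> M\<close>)
  ultimately show ?case ..
qed (auto intro!: bexI[of _ 1] M_one)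

lemma g_left_back: "\<exists>s\<in>M. s * g (k + 2 * n) = g k"
proof -
  have "n \<le> p * n"
    using p by simp
  then obtain s where "s \<in> M" "g (k + 2 * n + 2 * (p * n - n)) = s * g (k + 2 * n)"
    using g_left by blast
  moreover have "k + 2 * n + 2 * (p * n - n) = k + p * (2 * n)"
    using \<open>n \<le> p * n\<close> by (simp add: algebra_simps)
  ultimately show ?thesis
    using g_periodic_mult[of k "2 * n"] by auto
qed

lemma h_Suc_left_back: "\<exists>s\<in>M. s * h (Suc k) = g k"
proof -
  obtain s1 where 1: "s1 \<in> M" "g (Suc (Suc k)) = s1 * h (Suc k)"
    using g_Suc_left by blast
  obtain s2 where 2: "s2 \<in> M" "s2 * g (k + 2 * 1) = g k"
    using g_left_back by blast
  have "s2 * s1 * h (Suc k) = g k"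
    using 1 2 by (simp add: mult_assoc)
  then show ?thesis
    using M_mult[OF 2(1) 1(1)] by blast
qed

text \<open>For p = 2 j + 2 the element g 0 = g p begins with g 0; it ends with h at p - 1, hence
  with g at p - 2 = 2 j, hence with g 0.\<close>

lemma g_0_regular: "\<exists>q\<in>M. g 0 * q * g 0 = g 0"
proof -
  obtain i where i: "p = 2 * i" "0 < i"
    using p by auto
  define j where "j = i - 1"
  have j: "p = Suc (Suc (2 * j))"
    using i by (simp add: j_def)
  obtain t where t: "t \<in> M" "g (0 + Suc (2 * j)) = g 0 * t"
    using g_right by blast
  obtain s1 where s1: "s1 \<in> M" "h (Suc (2 * j)) = s1 * g (2 * j)"
    using h_Suc_left by blast
  obtain s2 where s2: "s2 \<in> M" "g (0 + 2 * j) = s2 * g 0"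
    using g_left by blast
  have "g 0 = g (Suc (Suc (2 * j)))"
    using g_periodic[of 0] j by simp
  also have "\<dots> = g (Suc (2 * j)) * w (Suc (2 * j)) * h (Suc (2 * j))"
    by (rule g_Suc)
  also have "\<dots> = g 0 * (t * w (Suc (2 * j)) * s1 * s2) * g 0"
    using t s1 s2 by (simp add: mult_assoc)
  finally have "g 0 * (t * w (Suc (2 * j)) * s1 * s2) * g 0 = g 0" ..
  moreover have "t * w (Suc (2 * j)) * s1 * s2 \<in> M"
    by (intro M_mult t s1 s2 w)
  ultimately show ?thesis ..
qed

context
  fixes q assumes q: "q \<in> M" "g 0 * q * g 0 = g 0"
begin

lemma idems: "g 0 * q \<in> T" "q * g 0 \<in> T"
  "g 0 * q * (g 0 * q) = g 0 * q" "q * g 0 * (q * g 0) = q * g 0"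
  using q T0 by (simp_all add: M_closed flip: mult_assoc) (simp add: mult_assoc)

lemma g_right_idem: "g 0 * q * g k = g k" "\<exists>t\<in>M. g k * t = g 0 * q"
proof -
  obtain t where "t \<in> M" "g (0 + k) = g 0 * t"
    using g_right by blast
  then show "g 0 * q * g k = g k"
    using q by (simp flip: mult_assoc)
  obtain t where "t \<in> M" "g (0 + k) * t = g 0"
    using g_right_back by blast
  then have "g k * (t * q) = g 0 * q"
    by (simp flip: mult_assoc)
  then show "\<exists>t\<in>M. g k * t = g 0 * q"
    using M_mult[OF \<open>t \<in> M\<close> q(1)] by blast
qed

lemma left_idem:
  assumes "s1 \<in> M" "x = s1 * g 0" and "s2 \<in> M" "s2 * x = g 0"
  shows "x * (q * g 0) = x" "\<exists>s\<in>M. s * x = q * g 0"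
proof -
  show "x * (q * g 0) = x"
    using assms q by (simp add: mult_assoc)
  have "q * s2 * x = q * g 0"
    using assms by (simp add: mult_assoc)
  then show "\<exists>s\<in>M. s * x = q * g 0"
    using M_mult[OF q(1) assms(3)] by blast
qed

lemma g_even_left_idem:
  assumes "even k"
  shows "g k * (q * g 0) = g k" "\<exists>s\<in>M. s * g k = q * g 0"
proof -
  obtain n where n: "k = 0 + 2 * n"
    using assms by auto
  obtain s1 s2 where "s1 \<in> M" "g k = s1 * g 0" "s2 \<in> M" "s2 * g k = g 0"
    using g_left g_left_back unfolding n by blast
  then show "g k * (q * g 0) = g k" "\<exists>s\<in>M. s * g k = q * g 0"
    using left_idem by blast+
qed

lemma h_odd_left_idem:
  assumes "odd k"
  shows "h k * (q * g 0) = h k" "\<exists>s\<in>M. s * h k = q * g 0"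
proof -
  obtain n where n: "k = Suc (0 + 2 * n)"
    using assms by (auto elim: oddE)
  obtain s1 s2 where s: "s1 \<in> M" "g (0 + 2 * n) = s1 * g 0" "s2 \<in> M" "s2 * g (0 + 2 * n) = g 0"
    using g_left g_left_back by blast
  obtain r1 r2 where r: "r1 \<in> M" "h k = r1 * g (0 + 2 * n)" "r2 \<in> M" "r2 * h k = g (0 + 2 * n)"
    using h_Suc_left h_Suc_left_back unfolding n by blast
  have "r1 * s1 \<in> M" "h k = r1 * s1 * g 0" "s2 * r2 \<in> M" "s2 * r2 * h k = g 0"
    using r s M_mult by (simp_all add: mult_assoc)
  then show "h k * (q * g 0) = h k" "\<exists>s\<in>M. s * h k = q * g 0"
    using left_idem by blast+
qed

end
end

text \<open>A converse of \<open>H_class_mult\<close>: the multipliers that return from g w h to g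
  and to h survive after g is cut down to e on its left and h to f' on its right.\<close>

lemma linked_if_consecutive:
  assumes g: "g \<in> H_class M f e" and h: "h \<in> H_class M f' e'"
    and M: "g \<in> M" "h \<in> M"
    and t: "t \<in> M" "g * w * h * t = g" and s: "s \<in> M" "s * (g * w * h) = h"
  shows "linked M e w f'"
proof -
  obtain s1 where g: "g * e = g" "s1 \<in> M" "s1 * g = e"
    using g by (auto simp: H_class_def)
  obtain t1 where h: "f' * h = h" "t1 \<in> M" "h * t1 = f'"
    using h by (auto simp: H_class_def)
  have "e * w * f' * (h * t) = s1 * g * w * (f' * h) * t"
    unfolding g by (simp add: mult_assoc)
  also have "\<dots> = s1 * (g * w * h * t)"
    unfolding h by (simp add: mult_assoc)
  also have "\<dots> = e"
    unfolding t g ..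
  finally have right: "e * w * f' * (h * t) = e" .
  have "s * g * (e * w * f') = s * (g * e) * w * (h * t1)"
    unfolding h by (simp add: mult_assoc)
  also have "\<dots> = s * (g * w * h) * t1"
    unfolding g by (simp add: mult_assoc)
  also have "\<dots> = f'"
    unfolding s h ..
  finally have left: "s * g * (e * w * f') = f'" .
  show ?thesis
    using right left M_mult[OF M(2) t(1)] M_mult[OF s(1) M(1)] unfolding linked_def by blast
qed

text \<open>In the alternating sequence g keeps the R-class of f and h that of f', while the
  L-classes of e and e' are exchanged at each step; hence different pairs have to be linked by c at
  even steps and by d at odd ones. A common member then identifies the classes.\<close>

lemma alternating_H_classes:
  assumes T: "e \<in> T" "f \<in> T" "e' \<in> T" "f' \<in> T" "c \<in> T" "d \<in> T" "x \<in> T" "y \<in> T"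
    and x: "x \<in> H_class M f e" and y: "y \<in> H_class M f' e'"
    and c: "linked M e c f'" "linked M e' c f"
    and d: "linked M e' d f'" "linked M e d f"
  shows "f = f' \<and> e = e'"
proof -
  obtain g h where gh: "malcev_seq (*) (\<lambda>k. if even k then c else d) g h" "g 0 = x" "h 0 = y"
    by (rule malcev_seq_exists)
  have Suc_eqs: "g (Suc k) = g k * (if even k then c else d) * h k"
    "h (Suc k) = h k * (if even k then c else d) * g k" for k
    using gh(1) by (simp_all add: malcev_seq_def)
  have classes: "if even k then g k \<in> H_class M f e \<and> h k \<in> H_class M f' e'
    else g k \<in> H_class M f e' \<and> h k \<in> H_class M f' e" for k
  proof (induction k)
    case 0
    then show ?case
      using gh x y by simp
  next
    case (Suc k)
    show ?case
    proof (cases "even k")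
      case True
      then have "g k \<in> H_class M f e" "h k \<in> H_class M f' e'"
        using Suc.IH by simp_all
      then show ?thesis
        using True H_class_mult[OF _ _ c(1)] H_class_mult[OF _ _ c(2)] by (simp add: Suc_eqs)
    next
      case False
      then have "g k \<in> H_class M f e'" "h k \<in> H_class M f' e"
        using Suc.IH by simp_all
      then show ?thesis
        using False H_class_mult[OF _ _ d(1)] H_class_mult[OF _ _ d(2)] by (simp add: Suc_eqs)
    qed
  qed
  obtain n where "g n = h n"
    using alt gh T unfolding alternating_nilpotent_def by blast
  then show ?thesis
    using classes[of n] H_class_idems_eq[of "g n"] T by (metis (full_types))
qed

theorem malcev_seq_meets_periodic:
  assumes seq: "malcev_seq (*) w g h" and w: "\<And>k. w k \<in> M" and T0: "g 0 \<in> T" "h 0 \<in> T"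
    and p: "0 < p" "even p"
    and g_periodic: "\<And>k. g (k + p) = g k" and h_periodic: "\<And>k. h (k + p) = h k"
  shows "\<exists>n. g n = h n"
proof -
  have seq': "malcev_seq (*) w h g"
    using seq by (auto simp: malcev_seq_def)
  note G = seq w T0 p g_periodic and H = seq' w T0(2,1) p h_periodic
  obtain q where q: "q \<in> M" "g 0 * q * g 0 = g 0"
    using g_0_regular[OF G] by blast
  obtain q' where q': "q' \<in> M" "h 0 * q' * h 0 = h 0"
    using g_0_regular[OF H] by blast
  define e f e' f' where efs: "e = q * g 0" "f = g 0 * q" "e' = q' * h 0" "f' = h 0 * q'"
  have T: "e \<in> T" "f \<in> T" "e' \<in> T" "f' \<in> T"
    and idem: "e * e = e" "f * f = f" "e' * e' = e'" "f' * f' = f'"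
    using idems[OF G q] idems[OF H q'] by (simp_all add: efs)
  have even_class: "g k \<in> H_class M f e" "h k \<in> H_class M f' e'" if "even k" for k
    using that g_right_idem[OF G q] g_right_idem[OF H q']
      g_even_left_idem[OF G q] g_even_left_idem[OF H q']
    unfolding efs H_class_def by blast+
  have odd_class: "g k \<in> H_class M f e'" "h k \<in> H_class M f' e" if "odd k" for k
    using that g_right_idem[OF G q] g_right_idem[OF H q']
      h_odd_left_idem[OF G q] h_odd_left_idem[OF H q']
    unfolding efs H_class_def by blast+
  have returns: "\<exists>t\<in>M. g k * w k * h k * t = g k" "\<exists>s\<in>M. s * (g k * w k * h k) = h k"
    "\<exists>t\<in>M. h k * w k * g k * t = h k" "\<exists>s\<in>M. s * (h k * w k * g k) = g k" for k
    using g_right_back[OF G, of k 1] g_right_back[OF H, of k 1]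
      h_Suc_left_back[OF G, of k] h_Suc_left_back[OF H, of k]
    by (simp_all add: g_Suc[OF G] h_Suc[OF G])
  have in_M: "g k \<in> M" "h k \<in> M" for k
    using seq_in_T[OF G] T_M by blast+
  have even_link: "linked M e (w k) f'" "linked M e' (w k) f" if "even k" for k
    using returns[of k] linked_if_consecutive[OF even_class[OF that] in_M]
      linked_if_consecutive[OF even_class(2,1)[OF that] in_M(2,1)] by blast+
  have odd_link: "linked M e' (w k) f'" "linked M e (w k) f" if "odd k" for k
    using returns[of k] linked_if_consecutive[OF odd_class[OF that] in_M]
      linked_if_consecutive[OF odd_class(2,1)[OF that] in_M(2,1)] by blast+
  \<comment> \<open>Otherwise the sequence with only the first two parameters in alternation never
    meets. A parameter 1 may lie outside T and is replaced: it identifies idempotents in pairs, the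
    other parameter then exchanges e and e', and the square of the latter has the links that 1
    had.\<close>
  have "f = f' \<and> e = e'"
  proof (rule ccontr)
    assume *: "\<not> ?thesis"
    note contra = alternating_H_classes[OF T _ _ T0 even_class[of 0]]
    have l0: "linked M e (w 0) f'" "linked M e' (w 0) f"
      and l1: "linked M e' (w 1) f'" "linked M e (w 1) f"
      using even_link[of 0] odd_link[of 1] by simp_all
    show False
    proof (cases "w 0 = 1")
      case True
      then have eqs: "e = f'" "e' = f"
        using l0 linked_one T idem by metis+
      have "w 1 \<noteq> 1"
        using * eqs l1 linked_one T idem by metis
      then have "w 1 \<in> T"
        using w[of 1] by (auto simp: M_def)
      moreover have "linked M e (w 1 * w 1) f'" "linked M e' (w 1 * w 1) f"
        using linked_square[OF T(1) idem(1) T(3) idem(3) w] linked_square[OF T(3) idem(3) T(1) idem(1) w]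
          l1 eqs by simp_all
      ultimately show False
        using contra[of "w 1 * w 1" "w 1"] l1 T_mult * by simp
    next
      case False
      then have w0: "w 0 \<in> T"
        using w[of 0] by (auto simp: M_def)
      show False
      proof (cases "w 1 = 1")
        case True
        then have eqs: "e' = f'" "e = f"
          using l1 linked_one T idem by metis+
        have "linked M e' (w 0 * w 0) f'" "linked M e (w 0 * w 0) f"
          using linked_square[OF T(1) idem(1) T(3) idem(3) w] linked_square[OF T(3) idem(3) T(1) idem(1) w]
            l0 eqs by simp_all
        then show False
          using contra[of "w 0" "w 0 * w 0"] l0 T_mult w0 * by simp
      next
        case False
        then have "w 1 \<in> T"
          using w[of 1] by (auto simp: M_def)
        then show False
          using contra[of "w 0" "w 1"] l0 l1 w0 * by simp
      qed
    qed
  qed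
  then have eq: "f' = f" "e' = e"
    by simp_all
  have g_class: "g k \<in> H_class M f e" and h_class: "h k \<in> H_class M f e" for k
    using even_class[of k] odd_class[of k] eq by (cases "even k"; simp)+
  have link: "linked M e (w k) f" for k
    using even_link[of k] odd_link[of k] eq by (cases "even k"; simp)
  \<comment> \<open>All members now lie in the H-class of \<open>g 0\<close>. Right multiplication
    by r, an inverse of \<open>g 0\<close>, moves this class into the maximal subgroup of f; right
    multiplication by \<open>g 0\<close> moves it back.\<close>
  define G where "G = H_class M f f \<inter> T"
  define r where "r = q * g 0 * q"
  have f_class: "f \<in> H_class M f f"
    using idem T M_closed by (auto simp: H_class_def)
  have f_link: "linked M f f f"
    using idem T M_closed by (auto simp: linked_def)
  have r: "r * g 0 = e" "g 0 * r = f" "r * f = r" "r \<in> T"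
    using q T0(1) by (simp_all add: r_def efs M_closed flip: mult_assoc)
      (simp_all add: mult_assoc)
  have mult_r: "x * r \<in> G" if x: "x \<in> H_class M f e" "x \<in> T" for x
  proof -
    obtain t s where *: "f * x = x" "x * e = x" "t \<in> M" "x * t = f" "s \<in> M" "s * x = e"
      using x by (auto simp: H_class_def)
    have "x * r * (g 0 * t) = x * (r * g 0) * t"
      by (simp add: mult_assoc)
    then have right: "x * r * (g 0 * t) = f"
      by (simp add: r *)
    have "g 0 * s * (x * r) = g 0 * (s * x) * r"
      by (simp add: mult_assoc)
    then have left: "g 0 * s * (x * r) = f"
      using g_class[of 0] by (simp add: r * H_class_def)
    have "f * (x * r) = f * x * r" "x * r * f = x * (r * f)"
      by (simp_all add: mult_assoc)
    then have "f * (x * r) = x * r" "x * r * f = x * r"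
      by (simp_all only: * r)
    then have "x * r \<in> H_class M f f"
      using right left M_mult[OF in_M(1) *(3)] M_mult[OF in_M(1) *(5)]
      unfolding H_class_def by blast
    then show ?thesis
      using x r T_mult by (simp add: G_def)
  qed
  have inv: "\<exists>y\<in>G. y * x = f" if x: "x \<in> G" for x
  proof -
    obtain t s where *: "f * x = x" "x * f = x" "t \<in> M" "x * t = f" "s \<in> M" "s * x = f"
      using x by (auto simp: G_def H_class_def)
    have "f * t * f = s * (x * t) * f"
      using *(6) by (simp flip: mult_assoc)
    also have "\<dots> = s * f"
      by (simp add: * idem mult_assoc)
    finally have y: "f * t * f = s * f" .
    then have yx: "f * t * f * x = f"
      by (simp add: * mult_assoc)
    have "x * (f * t * f) = x * f * t * f"
      by (simp add: mult_assoc)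
    then have xy: "x * (f * t * f) = f"
      by (simp add: * idem)
    have "f * (f * t * f) = f * t * f" "f * t * f * f = f * t * f"
      using idem(2) by (simp_all add: mult_assoc) (simp flip: mult_assoc)
    moreover have "x \<in> M"
      using x T_M by (simp add: G_def)
    ultimately have "f * t * f \<in> H_class M f f"
      using xy yx unfolding H_class_def by blast
    then have "f * t * f \<in> G"
      using T(2) *(3) M_closed by (simp add: G_def)
    then show ?thesis
      using yx by blast
  qed
  have f_id: "f * x = x" "x * f = x" if "x \<in> G" for x
    using that by (simp_all add: G_def H_class_def)
  \<comment> \<open>The parameters become \<open>g 0 * w k * f\<close>: the product of r and
    \<open>g 0\<close> is e, which is absorbed by the element on its left, and f by the one on its
    right.\<close>
  have "\<exists>n. g n * r = h n * r"
  proof (rule malcev_seq_meets_finite_group[where m = "(*)" and G = G and e = f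
        and z = "\<lambda>k. g 0 * w k * f" and g = "\<lambda>k. g k * r" and h = "\<lambda>k. h k * r"])
    show "finite G"
      using fin_T by (simp add: G_def)
    show "a * b \<in> G" if "a \<in> G" "b \<in> G" for a b
      using H_class_mult[OF _ _ f_link, of a f b f] f_id(2)[OF that(1)] that T_mult
      by (simp add: G_def)
    show "alternating_nilpotent (*) G"
      using alt unfolding alternating_nilpotent_def G_def by blast
    have "g (Suc k) * r = g k * r * (g 0 * w k * f) * (h k * r) \<and>
      h (Suc k) * r = h k * r * (g 0 * w k * f) * (g k * r)" for k
    proof -
      have "a * r * (g 0 * w k * f) * (b * r) = a * e * w k * (f * b) * r" for a b
        by (simp add: mult_assoc flip: r(1))
      moreover have "g k * e = g k" "f * g k = g k" "h k * e = h k" "f * h k = h k"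
        using g_class[of k] h_class[of k] by (simp_all add: H_class_def)
      ultimately show ?thesis
        by (simp add: g_Suc[OF G] h_Suc[OF G])
    qed
    then show "malcev_seq (*) (\<lambda>k. g 0 * w k * f) (\<lambda>k. g k * r) (\<lambda>k. h k * r)"
      by (simp add: malcev_seq_def)
    show "g 0 * w k * f \<in> G" for k
      using H_class_mult[OF g_class[of 0] f_class link[of k]] w[of k] T T0 M_closed
      by (simp add: G_def)
    show "f \<in> G"
      using f_class T by (simp add: G_def)
  qed (use T0 g_class h_class mult_r inv f_id in \<open>auto simp: mult_assoc\<close>)
  then obtain n where "g n * r * g 0 = h n * r * g 0"
    by metis
  then have "g n * e = h n * e"
    by (simp add: mult_assoc r)
  then show ?thesis
    using g_class h_class by (auto simp: H_class_def)
qed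

text \<open>By finiteness a pair of values recurs, and the segment in between, repeated for ever
  together with its parameters, is a periodic Malcev sequence. Only pairs at even indices are
  compared because the period has to be even.\<close>

theorem malcev_seq_meets:
  assumes seq: "malcev_seq (*) w g h" and w: "\<And>k. w k \<in> M" and T0: "g 0 \<in> T" "h 0 \<in> T"
  shows "\<exists>n. g n = h n"
proof -
  have Suc_eqs: "g (Suc k) = g k * w k * h k" "h (Suc k) = h k * w k * g k" for k
    using seq by (simp_all add: malcev_seq_def)
  have in_T: "g k \<in> T" "h k \<in> T" for k
    by (induction k) (simp_all add: Suc_eqs T0 w M_closed)
  define s where "s k = (g (2 * k), h (2 * k))" for k
  have "finite (range s)"
    by (rule finite_subset[of _ "T \<times> T"]) (auto simp: s_def in_T fin_T)
  then have "\<not> inj s"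
    using finite_imageD infinite_UNIV_nat by blast
  then obtain i j where ij: "i < j" "s i = s j"
    unfolding inj_on_def by (metis linorder_neqE_nat)
  define p where "p = 2 * (j - i)"
  have p: "0 < p" "even p" "g (2 * i + p) = g (2 * i)" "h (2 * i + p) = h (2 * i)"
    using ij by (simp_all add: p_def s_def diff_mult_distrib2)
  \<comment> \<open>The index is folded into one period. At its end the successor is right because
    the values at \<open>2 * i + p\<close> and \<open>2 * i\<close> agree.\<close>
  define r where "r k = 2 * i + k mod p" for k
  have "g (r (Suc k)) = g (Suc (r k)) \<and> h (r (Suc k)) = h (Suc (r k))" for k
  proof (cases "Suc (k mod p) = p")
    case True
    then have "Suc (r k) = 2 * i + p" "r (Suc k) = 2 * i"
      by (simp_all add: r_def mod_Suc)
    then show ?thesis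
      using p by simp
  qed (simp add: r_def mod_Suc)
  then have "malcev_seq (*) (w \<circ> r) (g \<circ> r) (h \<circ> r)"
    by (simp add: malcev_seq_def Suc_eqs)
  then have "\<exists>n. (g \<circ> r) n = (h \<circ> r) n"
    using p(1,2) by (intro malcev_seq_meets_periodic[of "w \<circ> r" "g \<circ> r" "h \<circ> r" p])
      (simp_all add: w in_T, simp_all add: r_def)
  then show ?thesis
    by auto
qed

end
end

section \<open>Finite semigroups as records\<close>

lemma finite_semigroupD:
  assumes "finite_semigroup S"
  shows "finite (carrier S)" "carrier S \<noteq> {}"
    and "x \<in> carrier S \<Longrightarrow> y \<in> carrier S \<Longrightarrow> sg_mult S x y \<in> carrier S"
    and "x \<in> carrier S \<Longrightarrow> y \<in> carrier S \<Longrightarrow> z \<in> carrier S \<Longrightarrow>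
      sg_mult S (sg_mult S x y) z = sg_mult S x (sg_mult S y z)"
  using assms by (simp_all add: finite_semigroup_def)

lemma adjoin_one_simps [simp]:
  "sg_mult (adjoin_one S) None v = v"
  "sg_mult (adjoin_one S) u None = u"
  "sg_mult (adjoin_one S) (Some x) (Some y) = Some (sg_mult S x y)"
  by (auto simp: adjoin_one_def split: option.splits)

lemma carrier_adjoin_one_subset: "carrier (adjoin_one S) \<subseteq> insert None (Some ` carrier S)"
  and Some_in_adjoin_one: "x \<in> carrier S \<Longrightarrow> Some x \<in> carrier (adjoin_one S)"
  by (auto simp: adjoin_one_def)

lemma sg_one_adjoin_one:
  assumes "finite_semigroup S" "x \<in> carrier S"
  shows "sg_mult (adjoin_one S) (Some x) (sg_one (adjoin_one S)) = Some x"
proof -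
  have "\<exists>u. is_identity (adjoin_one S) u"
  proof (cases "\<exists>e. is_identity S e")
    case True
    then obtain e where e: "is_identity S e" ..
    then have "is_identity (adjoin_one S) (Some e)"
      using True by (auto simp: is_identity_def adjoin_one_def)
    then show ?thesis ..
  next
    case False
    then have "carrier (adjoin_one S) = insert None (Some ` carrier S)"
      by (simp add: adjoin_one_def)
    then have "is_identity (adjoin_one S) None"
      by (simp add: is_identity_def)
    then show ?thesis ..
  qed
  then obtain u where u: "is_identity (adjoin_one S) u" ..
  have uniq: "v = u" if "is_identity (adjoin_one S) v" for v
  proof -
    have "sg_mult (adjoin_one S) v u = u" "sg_mult (adjoin_one S) v u = v"
      using u that unfolding is_identity_def by blast+
    then show ?thesis
      by simp
  qed
  have "is_identity (adjoin_one S) (sg_one (adjoin_one S))"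
    unfolding sg_one_def by (rule theI[of "is_identity (adjoin_one S)", OF u uniq])
  then show ?thesis
    using Some_in_adjoin_one[OF assms(2)] unfolding is_identity_def by blast
qed

section \<open>From the sequences lambda and rho to Malcev sequences\<close>

lemma malcev_seq_eq_mono:
  assumes "malcev_seq m z g h" "g n = h n" "n \<le> k"
  shows "g k = h k"
  using assms(3,1,2) by (induction k rule: dec_induct) (simp_all add: malcev_seq_def)

lemma malcev_seq_lam_rho:
  "malcev_seq (sg_mult S) (\<lambda>k. z (Suc k)) (lam S x y z) (rho S x y z)"
  by (simp add: malcev_seq_def)

text \<open>The recursion peels off the last parameter; here the first step is split off, as is
  needed to follow a bad pair to its successor.\<close>

lemma lam_rho_Suc_shift:
  "lam S x y z (Suc n) = lam S (sg_mult S (sg_mult S x (z 1)) y) (sg_mult S (sg_mult S y (z 1)) x)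
      (\<lambda>k. z (Suc k)) n \<and>
   rho S x y z (Suc n) = rho S (sg_mult S (sg_mult S x (z 1)) y) (sg_mult S (sg_mult S y (z 1)) x)
      (\<lambda>k. z (Suc k)) n"
  by (induction n) simp_all

lemma lam_rho_eq_mono:
  "lam S x y z n = rho S x y z n \<Longrightarrow> n \<le> m \<Longrightarrow> lam S x y z m = rho S x y z m"
  using malcev_seq_eq_mono[OF malcev_seq_lam_rho] .

text \<open>The results on monoids are applied to maps under composition: an element of S or None
  acts by left multiplication, extended by the identity to the whole type. None is always included
  in the set acted on, and makes the action faithful because it is sent to the acting
  element.\<close>

lemma malcev_seq_meets_adjoin_one:
  assumes S: "finite_semigroup S" and alt: "alternating_nilpotent (sg_mult S) (carrier S)"
    and seq: "malcev_seq (sg_mult (adjoin_one S)) w G H"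
    and w: "\<And>k. w k \<in> carrier (adjoin_one S)"
    and GH: "G 0 \<in> Some ` carrier S" "H 0 \<in> Some ` carrier S"
  shows "\<exists>n. G n = H n"
proof -
  define M where "M = insert None (Some ` carrier S)"
  define L where "L u = (\<lambda>v. if v \<in> M then sg_mult (adjoin_one S) u v else v)" for u
  define T where "T = L ` Some ` carrier S"
  note D = finite_semigroupD[OF S]
  have L_None: "L None = id"
    by (auto simp: L_def)
  have L_mult: "L (sg_mult (adjoin_one S) u v) = L u \<circ> L v" if "u \<in> M" "v \<in> M" for u v
    using that D(3,4) by (auto simp: L_def M_def fun_eq_iff)
  have L_inj: "u = v" if "L u = L v" for u v
    using fun_cong[OF that, of None] by (simp add: L_def M_def)
  have closed: "sg_mult (adjoin_one S) u v \<in> M" if "u \<in> M" "v \<in> M" for u v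
    using that D(3) by (auto simp: M_def)
  have wM: "w k \<in> M" for k
    using w[of k] carrier_adjoin_one_subset[of S] by (auto simp: M_def)
  have GHM: "G k \<in> M \<and> H k \<in> M" for k
    using malcev_seq_in[OF seq, of M M k] GH wM closed by (auto simp: M_def)
  interpret comp: monoid_mult id "(\<circ>)"
    by standard (simp_all add: o_assoc)
  have "\<exists>n. (L \<circ> G) n = (L \<circ> H) n"
  proof (rule comp.malcev_seq_meets[where T = T and w = "L \<circ> w"])
    show "finite T"
      using D(1) by (simp add: T_def)
    show "a \<circ> b \<in> T" if "a \<in> T" "b \<in> T" for a b
      using that D(3) unfolding T_def by (auto simp: M_def simp flip: L_mult)
    have "alternating_nilpotent (\<circ>) ((\<lambda>x. L (Some x)) ` carrier S)"
      by (rule alternating_nilpotent_hom_image[OF alt])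
        (simp_all add: D(3) M_def flip: L_mult)
    then show "alternating_nilpotent (\<circ>) T"
      by (simp add: T_def image_image)
    show "malcev_seq (\<circ>) (L \<circ> w) (L \<circ> G) (L \<circ> H)"
      by (rule malcev_seq_map[where M = M, OF seq]) (simp_all add: GHM wM closed L_mult)
    show "(L \<circ> w) k \<in> insert id T" for k
      using wM[of k] by (auto simp: M_def T_def L_None)
    show "(L \<circ> G) 0 \<in> T" "(L \<circ> H) 0 \<in> T"
      using GH by (auto simp: T_def)
  qed
  then show ?thesis
    using L_inj by auto
qed

text \<open>The sets \<open>bad n\<close> of pairs that some n parameters keep apart decrease, so
  \<open>bad (Suc n) = bad n\<close> for some n. If this set were nonempty, each member would have a
  successor in it for a suitable parameter, and dependent choice would give a sequence that never
  meets. Hence n is a uniform bound.\<close>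

theorem MN_if_alternating_nilpotent:
  assumes S: "finite_semigroup S" and alt: "alternating_nilpotent (sg_mult S) (carrier S)"
  shows "S \<in> MN"
proof -
  define A where "A = adjoin_one S"
  note D = finite_semigroupD[OF S]
  define bad where "bad n = {(a, b) \<in> carrier S \<times> carrier S. \<exists>c. (\<forall>k\<in>{1..n}. c k \<in> carrier A) \<and>
    lam A (Some a) (Some b) c n \<noteq> rho A (Some a) (Some b) c n}" for n
  have fin: "finite (bad n)" for n
    by (rule finite_subset[of _ "carrier S \<times> carrier S"]) (auto simp: bad_def D(1))
  have anti: "bad (Suc n) \<subseteq> bad n" for n
    unfolding bad_def using lam_rho_eq_mono[of A _ _ _ n "Suc n"] by fastforce
  have "\<exists>n. bad (Suc n) = bad n"
  proof (rule ccontr)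
    assume "\<not> ?thesis"
    then have less: "card (bad (Suc n)) < card (bad n)" for n
      using anti[of n] fin by (intro psubset_card_mono) auto
    have "card (bad n) + n \<le> card (bad 0)" for n
    proof (induction n)
      case (Suc n)
      then show ?case
        using less[of n] by linarith
    qed simp
    from this[of "Suc (card (bad 0))"] show False
      by simp
  qed
  then obtain n where n: "bad (Suc n) = bad n" ..
  have step: "\<exists>c\<in>carrier A. \<exists>a' b'. (a', b') \<in> bad n \<and>
      Some a' = sg_mult A (sg_mult A (Some a) c) (Some b) \<and>
      Some b' = sg_mult A (sg_mult A (Some b) c) (Some a)" if ab: "(a, b) \<in> bad n" for a b
  proof -
    obtain c where c: "\<And>k. k \<in> {1..Suc n} \<Longrightarrow> c k \<in> carrier A"
      "lam A (Some a) (Some b) c (Suc n) \<noteq> rho A (Some a) (Some b) c (Suc n)"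
      and in_S: "a \<in> carrier S" "b \<in> carrier S"
      using ab unfolding n[symmetric] unfolding bad_def by blast
    have c1: "c 1 \<in> carrier A"
      using c(1) by simp
    have "c 1 = None \<or> (\<exists>x\<in>carrier S. c 1 = Some x)"
      using c1 carrier_adjoin_one_subset[of S] unfolding A_def by blast
    then obtain a' b' where ab': "a' \<in> carrier S" "b' \<in> carrier S"
      "Some a' = sg_mult A (sg_mult A (Some a) (c 1)) (Some b)"
      "Some b' = sg_mult A (sg_mult A (Some b) (c 1)) (Some a)"
      using in_S D(3) by (auto simp: A_def)
    have "lam A (Some a') (Some b') (\<lambda>k. c (Suc k)) n \<noteq> rho A (Some a') (Some b') (\<lambda>k. c (Suc k)) n"
      using c(2) unfolding ab'(3,4) by (metis lam_rho_Suc_shift)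
    moreover have "\<forall>k\<in>{1..n}. c (Suc k) \<in> carrier A"
      using c(1) by simp
    ultimately have "(a', b') \<in> bad n"
      using ab'(1,2) by (auto simp: bad_def intro!: exI[of _ "\<lambda>k. c (Suc k)"])
    then show ?thesis
      using c1 ab' by blast
  qed
  have "bad n = {}"
  proof (rule ccontr)
    assume "bad n \<noteq> {}"
    then obtain p0 where "p0 \<in> bad n"
      by blast
    define R where "R p q c \<longleftrightarrow> c \<in> carrier A \<and>
      Some (fst q) = sg_mult A (sg_mult A (Some (fst p)) c) (Some (snd p)) \<and>
      Some (snd q) = sg_mult A (sg_mult A (Some (snd p)) c) (Some (fst p))" for p q c
    have "\<exists>f. \<forall>k. f k \<in> bad n \<and> (\<exists>c. R (f k) (f (Suc k)) c)"
    proof (rule dependent_nat_choice)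
      show "\<exists>x. x \<in> bad n"
        using \<open>p0 \<in> bad n\<close> ..
      show "\<exists>y. y \<in> bad n \<and> (\<exists>c. R x y c)" if "x \<in> bad n" for x and k :: nat
        using step[of "fst x" "snd x"] that unfolding R_def by auto
    qed
    then obtain f where f: "\<And>k. f k \<in> bad n" "\<And>k. \<exists>c. R (f k) (f (Suc k)) c"
      by blast
    then obtain c where c: "\<And>k. R (f k) (f (Suc k)) (c k)"
      by metis
    have "malcev_seq (sg_mult A) c (Some \<circ> fst \<circ> f) (Some \<circ> snd \<circ> f)"
      using c by (simp add: malcev_seq_def R_def)
    then have "\<exists>k. (Some \<circ> fst \<circ> f) k = (Some \<circ> snd \<circ> f) k"
      unfolding A_def
    proof (rule malcev_seq_meets_adjoin_one[OF S alt])
      show "c k \<in> carrier (adjoin_one S)" for k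
        using c[of k] by (simp add: R_def A_def)
    qed (use f(1)[of 0] in \<open>auto simp: bad_def\<close>)
    then obtain k where "fst (f k) = snd (f k)"
      by auto
    moreover have "lam A x x z m = rho A x x z m" for x z m
      using lam_rho_eq_mono[of A x x z 0 m] by simp
    ultimately show False
      using f(1)[of k] by (auto simp: bad_def)
  qed
  then have "\<forall>a\<in>carrier S. \<forall>b\<in>carrier S. \<forall>c. (\<forall>k\<in>{1..n}. c k \<in> carrier A) \<longrightarrow>
      lam A (Some a) (Some b) c n = rho A (Some a) (Some b) c n"
    unfolding bad_def by blast
  then show ?thesis
    using S unfolding MN_def A_def by blast
qed

lemma alternating_nilpotent_if_MN:
  assumes "S \<in> MN"
  shows "alternating_nilpotent (sg_mult S) (carrier S)"
  unfolding alternating_nilpotent_def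
proof (intro allI ballI impI)
  fix g h c d assume cd: "c \<in> carrier S" "d \<in> carrier S" "g 0 \<in> carrier S" "h 0 \<in> carrier S"
    and seq: "malcev_seq (sg_mult S) (\<lambda>k. if even k then c else d) g h"
  \<comment> \<open>\<open>lam\<close> and \<open>rho\<close> count parameters from 1 and Malcev
    sequences from 0; hence c stands at the odd places.\<close>
  define z where "z k = Some (if even k then d else c)" for k :: nat
  have "lam (adjoin_one S) (Some (g 0)) (Some (h 0)) z n = Some (g n) \<and>
    rho (adjoin_one S) (Some (g 0)) (Some (h 0)) z n = Some (h n)" for n
    using seq by (induction n) (auto simp: malcev_seq_def z_def)
  moreover obtain n where "\<forall>a\<in>carrier S. \<forall>b\<in>carrier S. \<forall>c.
        (\<forall>k\<in>{1..n}. c k \<in> carrier (adjoin_one S)) \<longrightarrow>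
        lam (adjoin_one S) (Some a) (Some b) c n = rho (adjoin_one S) (Some a) (Some b) c n"
    using assms unfolding MN_def by blast
  moreover have "z k \<in> carrier (adjoin_one S)" for k
    using cd by (simp add: z_def Some_in_adjoin_one)
  ultimately show "\<exists>n. g n = h n"
    using cd by (metis option.inject)
qed

text \<open>Multiplication by the identity disappears, and the common n is traded for one n per
  pair: the maximum over the finitely many pairs serves all, since equality persists.\<close>

lemma TM_iff:
  "S \<in> TM \<longleftrightarrow> finite_semigroup S \<and>
    (\<forall>a\<in>carrier S. \<forall>b\<in>carrier S. \<forall>g h. g 0 = a \<longrightarrow> h 0 = b \<longrightarrow>
      (\<forall>k. g (Suc k) = sg_mult S (g k) (h k) \<and> h (Suc k) = sg_mult S (h k) (g k)) \<longrightarrow>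
      (\<exists>n. g n = h n))"
proof (cases "finite_semigroup S")
  case True
  note D = finite_semigroupD[OF True]
  define A where "A = adjoin_one S"
  define l r where "l a b = lam A (Some a) (Some b) (\<lambda>_. sg_one A)"
    and "r a b = rho A (Some a) (Some b) (\<lambda>_. sg_one A)" for a b
  have lr: "l (g 0) (h 0) k = Some (g k) \<and> r (g 0) (h 0) k = Some (h k)"
    if in_S: "g 0 \<in> carrier S" "h 0 \<in> carrier S"
      and Suc_eqs: "\<And>k. g (Suc k) = sg_mult S (g k) (h k)" "\<And>k. h (Suc k) = sg_mult S (h k) (g k)"
    for g h k
  proof -
    have "g k \<in> carrier S \<and> h k \<in> carrier S" for k
      by (induction k) (simp_all add: in_S Suc_eqs D(3))
    then show ?thesis
      using sg_one_adjoin_one[OF True]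
      by (induction k) (simp_all add: l_def r_def A_def Suc_eqs)
  qed
  show ?thesis
  proof (intro iffI conjI ballI allI impI)
    fix a b g h
    assume "S \<in> TM" "a \<in> carrier S" "b \<in> carrier S" "g 0 = a" "h 0 = b"
      "\<forall>k. g (Suc k) = sg_mult S (g k) (h k) \<and> h (Suc k) = sg_mult S (h k) (g k)"
    moreover from this obtain n where "l a b n = r a b n"
      unfolding TM_def l_def r_def A_def by blast
    ultimately show "\<exists>n. g n = h n"
      using lr[of g h] by auto
  next
    assume *: "finite_semigroup S \<and>
      (\<forall>a\<in>carrier S. \<forall>b\<in>carrier S. \<forall>g h. g 0 = a \<longrightarrow> h 0 = b \<longrightarrow>
        (\<forall>k. g (Suc k) = sg_mult S (g k) (h k) \<and> h (Suc k) = sg_mult S (h k) (g k)) \<longrightarrow>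
        (\<exists>n. g n = h n))"
    have "\<exists>n. l a b n = r a b n" if ab: "a \<in> carrier S" "b \<in> carrier S" for a b
    proof -
      define p where "p = rec_nat (a, b) (\<lambda>_ (x, y). (sg_mult S x y, sg_mult S y x))"
      have p: "fst (p 0) = a" "snd (p 0) = b" "fst (p (Suc k)) = sg_mult S (fst (p k)) (snd (p k))"
        "snd (p (Suc k)) = sg_mult S (snd (p k)) (fst (p k))" for k
        by (simp_all add: p_def split_beta)
      then obtain n where "fst (p n) = snd (p n)"
        using *[THEN conjunct2, rule_format, OF ab, of "fst \<circ> p" "snd \<circ> p"] by auto
      then have "l a b n = r a b n"
        using lr[of "fst \<circ> p" "snd \<circ> p" n] p ab by simp
      then show ?thesis ..
    qed
    then obtain N where N: "l a b (N a b) = r a b (N a b)"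
      if "a \<in> carrier S" "b \<in> carrier S" for a b
      by metis
    define n where "n = Max ((\<lambda>(a, b). N a b) ` (carrier S \<times> carrier S))"
    have "l a b n = r a b n" if "a \<in> carrier S" "b \<in> carrier S" for a b
    proof -
      have "N a b \<le> n"
        unfolding n_def using that D(1) by (intro Max_ge) auto
      then show ?thesis
        using N[OF that] lam_rho_eq_mono unfolding l_def r_def by metis
    qed
    then show "S \<in> TM"
      using True unfolding TM_def l_def r_def A_def by blast
  qed (simp add: True)
qed (simp add: TM_def)

section \<open>Free profinite semigroups\<close>

lemma carrier_free_sg: "w \<in> carrier (free_sg A) \<longleftrightarrow> w \<in> lists A \<and> w \<noteq> []"
  and mult_free_sg: "sg_mult (free_sg A) = (@)"
  by (auto simp: free_sg_def)

lemma append_free_sg: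
  "u \<in> carrier (free_sg A) \<Longrightarrow> v \<in> carrier (free_sg A) \<Longrightarrow> u @ v \<in> carrier (free_sg A)"
  by (auto simp: carrier_free_sg)

lemma fin_congsD:
  assumes "r \<in> fin_congs A"
  shows "equiv (carrier (free_sg A)) r"
    and "(u, u') \<in> r \<Longrightarrow> (v, v') \<in> r \<Longrightarrow> (u @ v, u' @ v') \<in> r"
    and "finite (carrier (free_sg A) // r)"
  using assms by (auto simp: fin_congs_def)

lemma fin_congs_class_eq:
  assumes "r \<in> fin_congs A" "w \<in> r `` {u}"
  shows "r `` {w} = r `` {u}" "w \<in> carrier (free_sg A)" "u \<in> carrier (free_sg A)"
proof -
  have uw: "(u, w) \<in> r"
    using assms(2) by simp
  show "r `` {w} = r `` {u}"
    by (rule equiv_class_eq[OF fin_congsD(1)[OF assms(1)] uw, symmetric])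
  show "w \<in> carrier (free_sg A)" "u \<in> carrier (free_sg A)"
    using uw equiv_type[OF fin_congsD(1)[OF assms(1)]] by blast+
qed

lemma class_self: "r \<in> fin_congs A \<Longrightarrow> w \<in> carrier (free_sg A) \<Longrightarrow> w \<in> r `` {w}"
  using fin_congsD(1) equiv_class_self by fast

lemma quotient_class:
  assumes "r \<in> fin_congs A" "X \<in> carrier (free_sg A) // r" "w \<in> X"
  shows "X = r `` {w}" "w \<in> carrier (free_sg A)"
proof -
  obtain v where v: "v \<in> carrier (free_sg A)" "X = r `` {v}"
    using assms(2) by (rule quotientE)
  then show "X = r `` {w}" "w \<in> carrier (free_sg A)"
    using fin_congs_class_eq[OF assms(1), of w v] assms(3) by simp_all
qed

lemma class_append:
  assumes r: "r \<in> fin_congs A" and u: "u \<in> carrier (free_sg A)" and v: "v \<in> carrier (free_sg A)"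
  shows "(\<Union>u'\<in>r `` {u}. \<Union>v'\<in>r `` {v}. r `` {u' @ v'}) = r `` {u @ v}"
proof -
  have "r `` {u' @ v'} = r `` {u @ v}" if "u' \<in> r `` {u}" "v' \<in> r `` {v}" for u' v'
    using fin_congsD(2)[OF r, of u u' v v'] that
    by (intro fin_congs_class_eq(1)[OF r]) auto
  then show ?thesis
    using class_self[OF r u] class_self[OF r v] by blast
qed

text \<open>The common source of the congruences below: kernels of homomorphisms into finite
  semigroups, preimages of congruences under homomorphisms, and the total congruence.\<close>

lemma fin_congs_pullback:
  assumes h: "h ` carrier (free_sg A) \<subseteq> X" "finite (g ` X)"
    and comp: "\<And>u u' v v'. {u, u', v, v'} \<subseteq> carrier (free_sg A) \<Longrightarrow> g (h u) = g (h u') \<Longrightarrow>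
      g (h v) = g (h v') \<Longrightarrow> g (h (u @ v)) = g (h (u' @ v'))"
  shows "{(u, v). u \<in> carrier (free_sg A) \<and> v \<in> carrier (free_sg A) \<and> g (h u) = g (h v)} \<in> fin_congs A"
    (is "?r \<in> _")
proof -
  have "equiv (carrier (free_sg A)) ?r"
    by (rule equivI) (auto simp: refl_on_def sym_def trans_def)
  moreover have "\<forall>(u, u')\<in>?r. \<forall>(v, v')\<in>?r. (u @ v, u' @ v') \<in> ?r"
    using comp by (auto simp: append_free_sg)
  moreover have "carrier (free_sg A) // ?r \<subseteq>
      (\<lambda>y. {v \<in> carrier (free_sg A). y = g (h v)}) ` g ` X"
    using h(1) by (auto simp: quotient_def)
  then have "finite (carrier (free_sg A) // ?r)"
    using h(2) finite_surj by blast
  ultimately show ?thesis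
    unfolding fin_congs_def by blast
qed

lemma fin_congs_total: "carrier (free_sg A) \<times> carrier (free_sg A) \<in> fin_congs A"
proof -
  have "carrier (free_sg A) \<times> carrier (free_sg A) =
      {(u, v). u \<in> carrier (free_sg A) \<and> v \<in> carrier (free_sg A) \<and> () = ()}"
    by auto
  also have "\<dots> \<in> fin_congs A"
    by (rule fin_congs_pullback[of "\<lambda>_. ()" A UNIV "\<lambda>_. ()"]) auto
  finally show ?thesis .
qed

lemma fin_congs_Int:
  assumes r: "r \<in> fin_congs A" and s: "s \<in> fin_congs A"
  shows "r \<inter> s \<in> fin_congs A"
proof -
  have "refl_on (carrier (free_sg A)) (r \<inter> s)" "sym (r \<inter> s)" "trans (r \<inter> s)"
    using fin_congsD(1)[OF r] fin_congsD(1)[OF s] refl_on_Int[of "carrier (free_sg A)" r "carrier (free_sg A)" s]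
    by (simp_all add: equiv_def sym_Int trans_Int)
  then have "equiv (carrier (free_sg A)) (r \<inter> s)"
    using equiv_type[OF fin_congsD(1)[OF r]] by (intro equivI) auto
  moreover have "\<forall>(u, u')\<in>r \<inter> s. \<forall>(v, v')\<in>r \<inter> s. (u @ v, u' @ v') \<in> r \<inter> s"
    by (auto intro: fin_congsD(2)[OF r] fin_congsD(2)[OF s])
  moreover have "carrier (free_sg A) // (r \<inter> s) \<subseteq>
      (\<lambda>(X, Y). X \<inter> Y) ` ((carrier (free_sg A) // r) \<times> (carrier (free_sg A) // s))"
  proof
    fix X assume "X \<in> carrier (free_sg A) // (r \<inter> s)"
    then obtain v where v: "v \<in> carrier (free_sg A)" "X = (r \<inter> s) `` {v}"
      by (rule quotientE)
    have "X = (\<lambda>(X, Y). X \<inter> Y) (r `` {v}, s `` {v})"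
      using v(2) by auto
    moreover have "(r `` {v}, s `` {v}) \<in> (carrier (free_sg A) // r) \<times> (carrier (free_sg A) // s)"
      using v(1) by (simp add: quotientI)
    ultimately show "X \<in> (\<lambda>(X, Y). X \<inter> Y) ` ((carrier (free_sg A) // r) \<times> (carrier (free_sg A) // s))"
      by (rule image_eqI)
  qed
  then have "finite (carrier (free_sg A) // (r \<inter> s))"
    by (rule finite_subset) (intro finite_imageI finite_cartesian_product fin_congsD(3) r s)
  ultimately show ?thesis
    unfolding fin_congs_def by blast
qed

lemma fin_congs_lower_bound:
  assumes "finite R" "R \<subseteq> fin_congs A"
  obtains r where "r \<in> fin_congs A" "\<And>s. s \<in> R \<Longrightarrow> r \<subseteq> s"
proof -
  have "\<exists>r\<in>fin_congs A. \<forall>s\<in>R. r \<subseteq> s"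
    using assms
  proof (induction R)
    case empty
    then show ?case
      using fin_congs_total by blast
  next
    case (insert s R)
    then obtain r where "r \<in> fin_congs A" "\<forall>s\<in>R. r \<subseteq> s"
      by auto
    then show ?case
      using insert.prems fin_congs_Int[of r A s] by blast
  qed
  then show thesis
    using that by blast
qed

section \<open>The inverse limit and its topology\<close>

lemma carrier_free_prof:
  "p \<in> carrier (free_prof A) \<longleftrightarrow> p \<in> (\<Pi>\<^sub>E r\<in>fin_congs A. carrier (free_sg A) // r) \<and>
    (\<forall>r\<in>fin_congs A. \<forall>s\<in>fin_congs A. r \<subseteq> s \<longrightarrow> p r \<subseteq> p s)"
  and mult_free_prof:
  "sg_mult (free_prof A) p q = (\<lambda>r\<in>fin_congs A. \<Union>u\<in>p r. \<Union>v\<in>q r. r `` {u @ v})"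
  by (simp_all add: free_prof_def)

lemma free_profD:
  assumes "p \<in> carrier (free_prof A)" "r \<in> fin_congs A"
  shows "p r \<in> carrier (free_sg A) // r"
    and "s \<in> fin_congs A \<Longrightarrow> r \<subseteq> s \<Longrightarrow> p r \<subseteq> p s"
    and "w \<in> p r \<Longrightarrow> p r = r `` {w}" "w \<in> p r \<Longrightarrow> w \<in> carrier (free_sg A)"
    and "\<exists>w. w \<in> p r"
proof -
  show q: "p r \<in> carrier (free_sg A) // r"
    and "s \<in> fin_congs A \<Longrightarrow> r \<subseteq> s \<Longrightarrow> p r \<subseteq> p s"
    using assms by (auto simp: carrier_free_prof)
  show "w \<in> p r \<Longrightarrow> p r = r `` {w}" "w \<in> p r \<Longrightarrow> w \<in> carrier (free_sg A)"
    using quotient_class[OF assms(2) q] by simp_all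
  show "\<exists>w. w \<in> p r"
    using q fin_congsD(1)[OF assms(2)] in_quotient_imp_non_empty by blast
qed

lemma free_prof_eqI:
  assumes "p \<in> carrier (free_prof A)" "q \<in> carrier (free_prof A)"
    and "\<And>r. r \<in> fin_congs A \<Longrightarrow> p r = q r"
  shows "p = q"
  using assms by (intro PiE_ext[of p "fin_congs A" _ q]) (auto simp: carrier_free_prof)

lemma emb_apply: "r \<in> fin_congs A \<Longrightarrow> emb A w r = r `` {w}"
  by (simp add: emb_def)

lemma emb_in_carrier: "w \<in> carrier (free_sg A) \<Longrightarrow> emb A w \<in> carrier (free_prof A)"
  by (auto simp: carrier_free_prof emb_def quotientI)

lemma mult_free_prof_apply:
  assumes "p \<in> carrier (free_prof A)" "q \<in> carrier (free_prof A)" "r \<in> fin_congs A" "u \<in> p r" "v \<in> q r"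
  shows "sg_mult (free_prof A) p q r = r `` {u @ v}"
  using assms free_profD(3,4)[OF assms(1,3)] free_profD(3,4)[OF assms(2,3)]
    class_append[OF assms(3), of u v] by (simp add: mult_free_prof)

lemma mult_in_free_prof:
  assumes "p \<in> carrier (free_prof A)" "q \<in> carrier (free_prof A)"
  shows "sg_mult (free_prof A) p q \<in> carrier (free_prof A)"
  unfolding carrier_free_prof
proof (intro conjI ballI impI PiE_I)
  fix r assume r: "r \<in> fin_congs A"
  obtain u v where uv: "u \<in> p r" "v \<in> q r"
    using free_profD(5)[OF assms(1) r] free_profD(5)[OF assms(2) r] by blast
  have "u @ v \<in> carrier (free_sg A)"
    using uv free_profD(4)[OF assms(1) r] free_profD(4)[OF assms(2) r] by (intro append_free_sg)
  then show "sg_mult (free_prof A) p q r \<in> carrier (free_sg A) // r"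
    by (simp add: mult_free_prof_apply[OF assms r uv] quotientI)
  fix s assume s: "s \<in> fin_congs A" "r \<subseteq> s"
  have "u \<in> p s" "v \<in> q s"
    using uv free_profD(2)[OF assms(1) r s] free_profD(2)[OF assms(2) r s] by blast+
  then show "sg_mult (free_prof A) p q r \<subseteq> sg_mult (free_prof A) p q s"
    using s(2) by (auto simp: mult_free_prof_apply[OF assms r uv] mult_free_prof_apply[OF assms s(1)])
qed (simp add: mult_free_prof)

lemma mult_emb:
  assumes "u \<in> carrier (free_sg A)" "v \<in> carrier (free_sg A)"
  shows "sg_mult (free_prof A) (emb A u) (emb A v) = emb A (u @ v)"
  unfolding mult_free_prof emb_def by (rule restrict_ext) (simp add: class_append assms)

lemma topspace_prof: "topspace (prof_topology A) = carrier (free_prof A)"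
proof -
  have "carrier (free_prof A) \<subseteq> (\<Pi>\<^sub>E r\<in>fin_congs A. carrier (free_sg A) // r)"
    by (rule subsetI) (simp only: carrier_free_prof)
  then show ?thesis
    by (simp add: prof_topology_def Int_absorb1)
qed

lemma Hausdorff_prof: "Hausdorff_space (prof_topology A)"
  unfolding prof_topology_def
  by (intro Hausdorff_space_subtopology) (simp add: Hausdorff_space_product_topology)

lemma continuous_map_coordinate:
  assumes "r \<in> fin_congs A"
  shows "continuous_map (prof_topology A) (discrete_topology (carrier (free_sg A) // r)) (\<lambda>p. p r)"
  unfolding prof_topology_def
  by (intro continuous_map_from_subtopology continuous_map_product_projection[OF assms])

lemma emb_approximates:
  assumes "p \<in> carrier (free_prof A)" "finite R" "R \<subseteq> fin_congs A"
  obtains w where "w \<in> carrier (free_sg A)" "\<And>s. s \<in> R \<Longrightarrow> emb A w s = p s"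
proof -
  obtain r where r: "r \<in> fin_congs A" "\<And>s. s \<in> R \<Longrightarrow> r \<subseteq> s"
    using fin_congs_lower_bound[OF assms(2,3)] by blast
  obtain w where w: "w \<in> p r"
    using free_profD(5)[OF assms(1) r(1)] by blast
  have "emb A w s = p s" if "s \<in> R" for s
  proof -
    have s: "s \<in> fin_congs A" "w \<in> p s"
      using that assms(3) w free_profD(2)[OF assms(1) r(1) _ r(2)[OF that]] by blast+
    then show ?thesis
      using free_profD(3)[OF assms(1) s] by (simp add: emb_apply)
  qed
  then show thesis
    using that free_profD(4)[OF assms(1) r(1) w] by blast
qed

text \<open>A basic open set of the product restricts only finitely many coordinates; there a word
  from the class of p at a common refinement agrees with p.\<close>

lemma emb_dense:
  assumes "openin (prof_topology A) U" "p \<in> U"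
  obtains w where "w \<in> carrier (free_sg A)" "emb A w \<in> U"
proof -
  let ?X = "\<lambda>r. discrete_topology (carrier (free_sg A) // r)"
  obtain V where V: "openin (product_topology ?X (fin_congs A)) V" "U = V \<inter> carrier (free_prof A)"
    using assms(1) unfolding prof_topology_def openin_subtopology by blast
  obtain W where W: "finite {r \<in> fin_congs A. W r \<noteq> topspace (?X r)}"
    "p \<in> Pi\<^sub>E (fin_congs A) W" "Pi\<^sub>E (fin_congs A) W \<subseteq> V"
    using V(1)[unfolded openin_product_topology_alt, rule_format, of p] assms(2) V(2) by auto
  have p: "p \<in> carrier (free_prof A)"
    using assms(2) V(2) by blast
  obtain w where w: "w \<in> carrier (free_sg A)"
    "\<And>s. s \<in> {r \<in> fin_congs A. W r \<noteq> topspace (?X r)} \<Longrightarrow> emb A w s = p s"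
    using emb_approximates[OF p W(1)] by blast
  have "emb A w r \<in> W r" if "r \<in> fin_congs A" for r
  proof (cases "W r = topspace (?X r)")
    case True
    then show ?thesis
      using that w(1) by (simp add: emb_apply quotientI)
  next
    case False
    then show ?thesis
      using w(2)[of r] that W(2) by auto
  qed
  then have "emb A w \<in> Pi\<^sub>E (fin_congs A) W"
    by (auto simp: emb_def)
  with W(3) have "emb A w \<in> V"
    by (rule subsetD)
  then have "emb A w \<in> U"
    using V(2) emb_in_carrier[OF w(1)] by simp
  then show thesis
    by (rule that[OF w(1)])
qed

lemma continuous_eq_if_eq_on_emb:
  assumes f: "continuous_map (prof_topology A) Y f" and g: "continuous_map (prof_topology A) Y g"
    and Y: "Hausdorff_space Y" and p: "p \<in> carrier (free_prof A)"
    and eq: "\<And>w. w \<in> carrier (free_sg A) \<Longrightarrow> f (emb A w) = g (emb A w)"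
  shows "f p = g p"
proof (rule ccontr)
  assume "f p \<noteq> g p"
  moreover have "f p \<in> topspace Y" "g p \<in> topspace Y"
    using f g p by (auto simp: continuous_map_def topspace_prof)
  ultimately obtain U V where UV: "openin Y U" "openin Y V" "f p \<in> U" "g p \<in> V" "disjnt U V"
    using Y unfolding Hausdorff_space_def by blast
  have "openin (prof_topology A)
      ({q \<in> topspace (prof_topology A). f q \<in> U} \<inter> {q \<in> topspace (prof_topology A). g q \<in> V})"
    using f g UV by (intro openin_Int openin_continuous_map_preimage)
  moreover have "p \<in> {q \<in> topspace (prof_topology A). f q \<in> U} \<inter> {q \<in> topspace (prof_topology A). g q \<in> V}"
    using p UV by (simp add: topspace_prof)
  ultimately obtain w where "w \<in> carrier (free_sg A)" "f (emb A w) \<in> U" "g (emb A w) \<in> V"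
    by (rule emb_dense) auto
  then show False
    using eq UV by (auto simp: disjnt_iff)
qed

section \<open>Continuous extension of homomorphisms\<close>

lemma sg_hom_freeD:
  assumes "h \<in> sg_hom (free_sg A) S"
  shows "w \<in> carrier (free_sg A) \<Longrightarrow> h w \<in> carrier S"
    and "u \<in> carrier (free_sg A) \<Longrightarrow> v \<in> carrier (free_sg A) \<Longrightarrow> h (u @ v) = sg_mult S (h u) (h v)"
  using assms by (auto simp: sg_hom_def mult_free_sg)

text \<open>The extension reads off only the coordinate at the kernel of h, a congruence of finite
  index, and is therefore continuous.\<close>

lemma extend_to_finite_semigroup:
  assumes h: "h \<in> sg_hom (free_sg A) S" and fin: "finite (carrier S)"
  obtains \<theta> where "\<theta> \<in> sg_hom (free_prof A) S"
    "continuous_map (prof_topology A) (discrete_topology (carrier S)) \<theta>"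
    "\<And>w. w \<in> carrier (free_sg A) \<Longrightarrow> \<theta> (emb A w) = h w"
proof -
  define k where "k = {(u, v). u \<in> carrier (free_sg A) \<and> v \<in> carrier (free_sg A) \<and> h u = h v}"
  have k: "k \<in> fin_congs A"
    unfolding k_def
  proof (rule fin_congs_pullback[of h A "carrier S" "\<lambda>x. x"])
    show "h ` carrier (free_sg A) \<subseteq> carrier S"
      using sg_hom_freeD(1)[OF h] by blast
  qed (use fin in \<open>simp_all add: sg_hom_freeD(2)[OF h]\<close>)
  have kD: "h u = h v" if "(u, v) \<in> k" for u v
    using that by (simp add: k_def)
  define \<theta> where "\<theta> p = h (SOME w. w \<in> p k)" for p
  have \<theta>: "\<theta> p = h w" if p: "p \<in> carrier (free_prof A)" "w \<in> p k" for p w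
  proof -
    define x where "x = (SOME w. w \<in> p k)"
    have "x \<in> p k"
      unfolding x_def using p(2) by (rule someI)
    also have "p k = k `` {w}"
      by (rule free_profD(3)[OF p(1) k p(2)])
    finally show ?thesis
      by (auto simp: \<theta>_def x_def[symmetric] dest: kD)
  qed
  have ex: "\<exists>w\<in>carrier (free_sg A). w \<in> p k" if "p \<in> carrier (free_prof A)" for p
    using free_profD(4,5)[OF that k] by blast
  have "continuous_map (prof_topology A) (discrete_topology (carrier S))
      ((\<lambda>X. h (SOME w. w \<in> X)) \<circ> (\<lambda>p. p k))"
  proof (rule continuous_map_compose[OF continuous_map_coordinate[OF k]])
    have "h (SOME w. w \<in> X) \<in> carrier S" if X: "X \<in> carrier (free_sg A) // k" for X
    proof -
      have "\<exists>w. w \<in> X"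
        using X fin_congsD(1)[OF k] in_quotient_imp_non_empty by blast
      then have "(SOME w. w \<in> X) \<in> X"
        by (rule someI_ex)
      then show ?thesis
        using quotient_class(2)[OF k X] sg_hom_freeD(1)[OF h] by blast
    qed
    then show "continuous_map (discrete_topology (carrier (free_sg A) // k))
        (discrete_topology (carrier S)) (\<lambda>X. h (SOME w. w \<in> X))"
      by auto
  qed
  then have "continuous_map (prof_topology A) (discrete_topology (carrier S)) \<theta>"
    by (simp add: o_def \<theta>_def[abs_def])
  moreover have "\<theta> (emb A w) = h w" if "w \<in> carrier (free_sg A)" for w
    using \<theta>[OF emb_in_carrier[OF that], of w] class_self[OF k that] k by (simp add: emb_apply)
  moreover have "\<theta> \<in> sg_hom (free_prof A) S"
    unfolding sg_hom_def
  proof (intro CollectI conjI ballI funcsetI)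
    show "\<theta> p \<in> carrier S" if "p \<in> carrier (free_prof A)" for p
      using ex[OF that] \<theta>[OF that] sg_hom_freeD(1)[OF h] by auto
    fix p q assume pq: "p \<in> carrier (free_prof A)" "q \<in> carrier (free_prof A)"
    obtain u v where uv: "u \<in> carrier (free_sg A)" "u \<in> p k" "v \<in> carrier (free_sg A)" "v \<in> q k"
      using ex pq by meson
    define c where "c = sg_mult (free_prof A) p q"
    have c: "c k = k `` {u @ v}"
      unfolding c_def by (rule mult_free_prof_apply[OF pq k uv(2,4)])
    then have "u @ v \<in> c k"
      using class_self[OF k append_free_sg[OF uv(1,3)]] by simp
    moreover have "c \<in> carrier (free_prof A)"
      unfolding c_def by (rule mult_in_free_prof[OF pq])
    ultimately have "\<theta> c = h (u @ v)"
      using \<theta> by blast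
    then show "\<theta> (sg_mult (free_prof A) p q) = sg_mult S (\<theta> p) (\<theta> q)"
      using \<theta>[OF pq(1) uv(2)] \<theta>[OF pq(2) uv(4)] sg_hom_freeD(2)[OF h uv(1,3)] by (simp add: c_def)
  qed
  ultimately show thesis
    using that by blast
qed

lemma prof_homD:
  assumes "f \<in> prof_hom A B"
  shows "continuous_map (prof_topology A) (prof_topology B) f"
    and "p \<in> carrier (free_prof A) \<Longrightarrow> f p \<in> carrier (free_prof B)"
    and "p \<in> carrier (free_prof A) \<Longrightarrow> q \<in> carrier (free_prof A) \<Longrightarrow>
      f (sg_mult (free_prof A) p q) = sg_mult (free_prof B) (f p) (f q)"
    and "f \<in> extensional (carrier (free_prof A))"
  using assms by (auto simp: prof_hom_def sg_hom_def)

lemma prof_hom_eqI: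
  assumes f: "f \<in> prof_hom A B" and g: "g \<in> prof_hom A B"
    and eq: "\<And>w. w \<in> carrier (free_sg A) \<Longrightarrow> f (emb A w) = g (emb A w)"
  shows "f = g"
proof (rule extensionalityI[OF prof_homD(4)[OF f] prof_homD(4)[OF g]])
  show "f p = g p" if "p \<in> carrier (free_prof A)" for p
    by (rule continuous_eq_if_eq_on_emb[OF prof_homD(1)[OF f] prof_homD(1)[OF g] Hausdorff_prof that eq])
qed

lemma sg_hom_compose:
  "h \<in> sg_hom S T \<Longrightarrow> k \<in> sg_hom T U \<Longrightarrow> k \<circ> h \<in> sg_hom S U"
  by (auto simp: sg_hom_def Pi_iff)

text \<open>The coordinate of the image at r is determined by that of p at \<open>k r\<close>, the
  pullback of r along h. This gives continuity coordinate by coordinate; compatibility holds because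
  k is monotone.\<close>

lemma extend_to_free_prof:
  fixes A :: "'a set" and B :: "'b set"
  assumes h: "h \<in> sg_hom (free_sg A) (free_sg B)"
  obtains f where "f \<in> prof_hom A B" "\<And>w. w \<in> carrier (free_sg A) \<Longrightarrow> f (emb A w) = emb B (h w)"
proof -
  note hD = sg_hom_freeD[OF h, unfolded mult_free_sg]
  define k where "k r = {(u, v). u \<in> carrier (free_sg A) \<and> v \<in> carrier (free_sg A) \<and>
    r `` {h u} = r `` {h v}}" for r :: "('b list \<times> 'b list) set"
  have k: "k r \<in> fin_congs A" if r: "r \<in> fin_congs B" for r
    unfolding k_def
  proof (rule fin_congs_pullback[of h A "carrier (free_sg B)" "\<lambda>w. r `` {w}"])
    show "h ` carrier (free_sg A) \<subseteq> carrier (free_sg B)"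
      using hD(1) by blast
    have "(\<lambda>w. r `` {w}) ` carrier (free_sg B) \<subseteq> carrier (free_sg B) // r"
      by (auto intro: quotientI)
    then show "finite ((\<lambda>w. r `` {w}) ` carrier (free_sg B))"
      by (rule finite_subset[OF _ fin_congsD(3)[OF r]])
    fix u u' v v'
    assume in_A: "{u, u', v, v'} \<subseteq> carrier (free_sg A)"
      and eq: "r `` {h u} = r `` {h u'}" "r `` {h v} = r `` {h v'}"
    have "r `` {h u @ h v} = r `` {h u' @ h v'}"
      using class_append[OF r, of "h u" "h v"] class_append[OF r, of "h u'" "h v'"] in_A hD(1)
      by (simp add: eq)
    then show "r `` {h (u @ v)} = r `` {h (u' @ v')}"
      using in_A by (simp add: hD(2))
  qed
  define f where "f = (\<lambda>p\<in>carrier (free_prof A). \<lambda>r\<in>fin_congs B. r `` {h (SOME w. w \<in> p (k r))})"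
  have f: "f p r = r `` {h w}"
    if p: "p \<in> carrier (free_prof A)" and r: "r \<in> fin_congs B" and w: "w \<in> p (k r)" for p r w
  proof -
    define x where "x = (SOME w. w \<in> p (k r))"
    have "x \<in> p (k r)"
      unfolding x_def using w by (rule someI)
    also have "p (k r) = k r `` {w}"
      by (rule free_profD(3)[OF p k[OF r] w])
    finally have "r `` {h x} = r `` {h w}"
      by (simp add: k_def)
    then show ?thesis
      using p r by (simp add: f_def x_def)
  qed
  have in_carrier: "f p \<in> carrier (free_prof B)" if p: "p \<in> carrier (free_prof A)" for p
    unfolding carrier_free_prof
  proof (intro conjI ballI impI PiE_I)
    fix r assume r: "r \<in> fin_congs B"
    obtain w where w: "w \<in> p (k r)"
      using free_profD(5)[OF p k[OF r]] by blast
    then have "h w \<in> carrier (free_sg B)"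
      using hD(1) free_profD(4)[OF p k[OF r]] by blast
    then show "f p r \<in> carrier (free_sg B) // r"
      by (simp add: f[OF p r w] quotientI)
    fix s assume s: "s \<in> fin_congs B" "r \<subseteq> s"
    have "k r \<subseteq> k s"
    proof
      fix z assume "z \<in> k r"
      then obtain u v where uv: "z = (u, v)" "u \<in> carrier (free_sg A)" "v \<in> carrier (free_sg A)"
        "r `` {h u} = r `` {h v}"
        by (auto simp: k_def)
      then have "h u \<in> r `` {h v}"
        using class_self[OF r hD(1)[OF uv(2)]] by simp
      then have "h u \<in> s `` {h v}"
        using s(2) by blast
      then have "s `` {h u} = s `` {h v}"
        by (rule fin_congs_class_eq(1)[OF s(1)])
      then show "z \<in> k s"
        using uv by (simp add: k_def)
    qed
    then have "w \<in> p (k s)"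
      using free_profD(2)[OF p k[OF r] k[OF s(1)]] w by blast
    then show "f p r \<subseteq> f p s"
      using s(2) by (auto simp: f[OF p r w] f[OF p s(1)])
  qed (use p in \<open>simp add: f_def\<close>)
  have emb: "f (emb A w) = emb B (h w)" if w: "w \<in> carrier (free_sg A)" for w
  proof (rule free_prof_eqI)
    show "f (emb A w) \<in> carrier (free_prof B)" "emb B (h w) \<in> carrier (free_prof B)"
      using w hD(1) by (simp_all add: in_carrier emb_in_carrier)
    show "f (emb A w) r = emb B (h w) r" if r: "r \<in> fin_congs B" for r
      using f[OF emb_in_carrier[OF w] r, of w] class_self[OF k[OF r] w] k[OF r] r
      by (simp add: emb_apply)
  qed
  have hom: "f (sg_mult (free_prof A) p q) = sg_mult (free_prof B) (f p) (f q)"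
    if pq: "p \<in> carrier (free_prof A)" "q \<in> carrier (free_prof A)" for p q
  proof (rule free_prof_eqI)
    show "f (sg_mult (free_prof A) p q) \<in> carrier (free_prof B)"
      "sg_mult (free_prof B) (f p) (f q) \<in> carrier (free_prof B)"
      using pq by (simp_all add: in_carrier mult_in_free_prof)
    fix r assume r: "r \<in> fin_congs B"
    obtain u v where uv: "u \<in> p (k r)" "v \<in> q (k r)"
      using free_profD(5)[OF pq(1) k[OF r]] free_profD(5)[OF pq(2) k[OF r]] by blast
    have uvA: "u \<in> carrier (free_sg A)" "v \<in> carrier (free_sg A)"
      using uv free_profD(4)[OF pq(1) k[OF r]] free_profD(4)[OF pq(2) k[OF r]] by blast+
    have "u @ v \<in> sg_mult (free_prof A) p q (k r)"
      using class_self[OF k[OF r] append_free_sg[OF uvA]] mult_free_prof_apply[OF pq k[OF r] uv] by simp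
    then have "f (sg_mult (free_prof A) p q) r = r `` {h u @ h v}"
      using f[OF mult_in_free_prof[OF pq] r] by (simp add: hD(2)[OF uvA])
    moreover have "h u \<in> f p r" "h v \<in> f q r"
      using class_self[OF r hD(1)[OF uvA(1)]] class_self[OF r hD(1)[OF uvA(2)]]
      by (simp_all add: f[OF pq(1) r uv(1)] f[OF pq(2) r uv(2)])
    ultimately show "f (sg_mult (free_prof A) p q) r = sg_mult (free_prof B) (f p) (f q) r"
      using mult_free_prof_apply[OF in_carrier[OF pq(1)] in_carrier[OF pq(2)] r] by simp
  qed
  have "continuous_map (prof_topology A) (prof_topology B) f"
    unfolding prof_topology_def[of B]
  proof (rule continuous_map_into_subtopology)
    show "f \<in> topspace (prof_topology A) \<rightarrow> carrier (free_prof B)"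
      using in_carrier by (simp add: topspace_prof)
    show "continuous_map (prof_topology A)
        (product_topology (\<lambda>r. discrete_topology (carrier (free_sg B) // r)) (fin_congs B)) f"
      unfolding continuous_map_componentwise
    proof (intro conjI ballI)
      show "f ` topspace (prof_topology A) \<subseteq> extensional (fin_congs B)"
        by (auto simp: f_def topspace_prof)
      fix r assume r: "r \<in> fin_congs B"
      have "continuous_map (prof_topology A) (discrete_topology (carrier (free_sg B) // r))
          ((\<lambda>X. r `` {h (SOME w. w \<in> X)}) \<circ> (\<lambda>p. p (k r)))"
      proof (rule continuous_map_compose[OF continuous_map_coordinate[OF k[OF r]]])
        have "r `` {h (SOME w. w \<in> X)} \<in> carrier (free_sg B) // r"
          if X: "X \<in> carrier (free_sg A) // k r" for X
        proof -
          have "\<exists>w. w \<in> X"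
            using X fin_congsD(1)[OF k[OF r]] in_quotient_imp_non_empty by blast
          then have "(SOME w. w \<in> X) \<in> X"
            by (rule someI_ex)
          then show ?thesis
            using quotient_class(2)[OF k[OF r] X] hD(1) by (blast intro: quotientI)
        qed
        then show "continuous_map (discrete_topology (carrier (free_sg A) // k r))
            (discrete_topology (carrier (free_sg B) // r)) (\<lambda>X. r `` {h (SOME w. w \<in> X)})"
          by simp
      qed
      then show "continuous_map (prof_topology A) (discrete_topology (carrier (free_sg B) // r)) (\<lambda>p. f p r)"
        by (rule continuous_map_eq) (simp add: f_def topspace_prof r)
    qed
  qed
  then have "f \<in> prof_hom A B"
    using in_carrier hom by (simp add: prof_hom_def sg_hom_def f_def)
  then show thesis
    using that emb by blast
qed

lemma prof_ext_props:
  assumes h: "h \<in> sg_hom (free_sg A) (free_sg B)"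
  shows "prof_ext A B h \<in> prof_hom A B"
    and "w \<in> carrier (free_sg A) \<Longrightarrow> prof_ext A B h (emb A w) = emb B (h w)"
proof -
  obtain f where f: "f \<in> prof_hom A B" "\<And>w. w \<in> carrier (free_sg A) \<Longrightarrow> f (emb A w) = emb B (h w)"
    by (rule extend_to_free_prof[OF h]) blast
  have "prof_ext A B h = f"
    unfolding prof_ext_def
  proof (rule the_equality)
    show "g = f" if "g \<in> prof_hom A B \<and> (\<forall>w\<in>carrier (free_sg A). g (emb A w) = emb B (h w))" for g
      using that f by (intro prof_hom_eqI[of g A B f]) simp_all
  qed (use f in blast)
  then show "prof_ext A B h \<in> prof_hom A B"
    and "w \<in> carrier (free_sg A) \<Longrightarrow> prof_ext A B h (emb A w) = emb B (h w)"
    using f by simp_all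
qed

lemma free_sg_induct [consumes 1, case_names letter append]:
  assumes "w \<in> carrier (free_sg A)"
    and "\<And>a. a \<in> A \<Longrightarrow> P [a]"
    and "\<And>a w. a \<in> A \<Longrightarrow> w \<in> carrier (free_sg A) \<Longrightarrow> P w \<Longrightarrow> P ([a] @ w)"
  shows "P w"
  using assms(1)
proof (induction w)
  case (Cons a w)
  then show ?case
    using assms(2)[of a] assms(3)[of a w] by (cases "w = []") (auto simp: carrier_free_sg)
qed (simp add: carrier_free_sg)

lemma prof_hom_determined_by_letters:
  assumes f: "f \<in> prof_hom A B" and h: "h \<in> sg_hom (free_sg A) (free_sg B)"
    and letters: "\<And>a. a \<in> A \<Longrightarrow> f (emb A [a]) = emb B (h [a])"
  shows "f = prof_ext A B h"
proof (rule prof_hom_eqI[OF f prof_ext_props(1)[OF h]])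
  fix w assume w: "w \<in> carrier (free_sg A)"
  then have "f (emb A w) = emb B (h w)"
  proof (induction w rule: free_sg_induct)
    case (append a w)
    have a: "[a] \<in> carrier (free_sg A)"
      using append(1) by (simp add: carrier_free_sg)
    have "f (emb A ([a] @ w)) = sg_mult (free_prof B) (f (emb A [a])) (f (emb A w))"
      using prof_homD(3)[OF f emb_in_carrier[OF a] emb_in_carrier[OF append(2)]]
      by (simp only: mult_emb[OF a append(2)])
    also have "\<dots> = emb B (h [a] @ h w)"
      unfolding append.IH letters[OF append(1)]
      using sg_hom_freeD(1)[OF h] a append(2) by (intro mult_emb)
    also have "h [a] @ h w = h ([a] @ w)"
      using sg_hom_freeD(2)[OF h a append(2)] by (simp add: mult_free_sg)
    finally show ?case .
  qed (use letters in simp)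
  then show "f (emb A w) = prof_ext A B h (emb A w)"
    using prof_ext_props(2)[OF h w] by simp
qed

section \<open>Limits of factorial iterates\<close>

lemma limitin_prof_iff:
  "limitin (prof_topology A) p q sequentially \<longleftrightarrow>
    q \<in> carrier (free_prof A) \<and> (\<forall>\<^sub>F n in sequentially. p n \<in> carrier (free_prof A)) \<and>
    limitin (product_topology (\<lambda>r. discrete_topology (carrier (free_sg A) // r)) (fin_congs A)) p q sequentially"
  by (simp add: prof_topology_def limitin_subtopology)

text \<open>A deterministic sequence in a finite set has some period P from an index i on. For n at
  least i + P, the factorial of n is past i and divisible by P, so consecutive factorials differ by
  multiples of P.\<close>

lemma eventually_const_at_factorials:
  fixes s :: "nat \<Rightarrow> 's"
  assumes fin: "finite (range s)" and det: "\<And>i j. s i = s j \<Longrightarrow> s (Suc i) = s (Suc j)"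
  obtains N where "\<And>n. n \<ge> N \<Longrightarrow> s (fact n) = s (fact N)"
proof -
  have "\<not> inj s"
    using fin finite_imageD infinite_UNIV_nat by blast
  then obtain i j where ij: "i < j" "s i = s j"
    unfolding inj_on_def by (metis linorder_neqE_nat)
  define P where "P = j - i"
  have P: "0 < P" "j = i + P"
    using ij by (simp_all add: P_def)
  have step: "s (i + k + P) = s (i + k)" for k
  proof (induction k)
    case 0
    then show ?case
      using ij P by simp
  next
    case (Suc k)
    then show ?case
      using det[of "i + k + P" "i + k"] by simp
  qed
  have shift: "s (n + P * k) = s n" if "i \<le> n" for n k
  proof (induction k)
    case (Suc k)
    then show ?case
      using step[of "n - i + P * k"] that by (simp add: ac_simps)
  qed simp
  define N where "N = i + P"
  have "s (fact n) = s (fact N)" if "n \<ge> N" for n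
    using that
  proof (induction n rule: dec_induct)
    case (step n)
    have "P dvd fact n"
      using step P by (intro dvd_fact) (simp_all add: N_def)
    then obtain k where k: "fact n = P * k" ..
    have "i \<le> fact n"
      using step fact_ge_self[of n] by (simp add: N_def)
    moreover have "fact (Suc n) = fact n + P * (k * n)"
      using k by (simp add: algebra_simps)
    ultimately have "s (fact (Suc n)) = s (fact n)"
      by (simp only: shift)
    then show ?case
      using step by simp
  qed simp
  then show thesis
    using that by blast
qed

lemma funpow_sg_hom:
  assumes "h \<in> sg_hom S S"
  shows "h ^^ n \<in> sg_hom S S"
proof (induction n)
  case (Suc n)
  then show ?case
    using sg_hom_compose[OF Suc assms] by (simp only: funpow.simps)
qed (auto simp: sg_hom_def)

text \<open>The state at n consists of the classes of the n-th iterates of all letters. There are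
  finitely many states, since A is finite. A state determines the classes of the n-th iterates of
  all words, in particular of \<open>h [a]\<close>, and thereby the next state.\<close>

lemma class_iterates_eventually_const:
  assumes "finite A" and h: "h \<in> sg_hom (free_sg A) (free_sg A)" and r: "r \<in> fin_congs A"
    and w: "w \<in> carrier (free_sg A)"
  shows "\<exists>X\<in>carrier (free_sg A) // r. \<forall>\<^sub>F n in sequentially. r `` {(h ^^ fact n) w} = X"
proof -
  note hn = sg_hom_freeD[OF funpow_sg_hom[OF h], unfolded mult_free_sg]
  have letter: "[a] \<in> carrier (free_sg A)" if "a \<in> A" for a
    using that by (simp add: carrier_free_sg)
  define s where "s n = (\<lambda>a\<in>A. r `` {(h ^^ n) [a]})" for n
  have "range s \<subseteq> (\<Pi>\<^sub>E a\<in>A. carrier (free_sg A) // r)"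
    by (auto simp: s_def letter hn(1) intro!: quotientI)
  moreover have "finite (\<Pi>\<^sub>E a\<in>A. carrier (free_sg A) // r)"
    by (intro finite_PiE \<open>finite A\<close> fin_congsD(3)[OF r])
  ultimately have fin: "finite (range s)"
    by (rule finite_subset)
  have s_eq: "r `` {(h ^^ i) u} = r `` {(h ^^ j) u}"
    if eq: "s i = s j" and u: "u \<in> carrier (free_sg A)" for i j u
    using u
  proof (induction u rule: free_sg_induct)
    case (letter a)
    then show ?case
      using fun_cong[OF eq, of a] by (simp add: s_def)
  next
    case (append a u)
    have "r `` {(h ^^ i) [a]} = r `` {(h ^^ j) [a]}"
      using fun_cong[OF eq, of a] append(1) by (simp add: s_def)
    then have "r `` {(h ^^ i) [a] @ (h ^^ i) u} = r `` {(h ^^ j) [a] @ (h ^^ j) u}"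
      using append class_append[OF r, of "(h ^^ i) [a]" "(h ^^ i) u"]
        class_append[OF r, of "(h ^^ j) [a]" "(h ^^ j) u"]
      by (simp add: hn(1) letter)
    then show ?case
      by (simp only: hn(2)[OF letter[OF append(1)] append(2)])
  qed
  have det: "s (Suc i) = s (Suc j)" if "s i = s j" for i j
  proof -
    have "r `` {(h ^^ i) (h [a])} = r `` {(h ^^ j) (h [a])}" if "a \<in> A" for a
      using s_eq[OF \<open>s i = s j\<close>] sg_hom_freeD(1)[OF h letter[OF that]] by blast
    then show ?thesis
      unfolding s_def by (intro restrict_ext) (simp add: funpow_swap1)
  qed
  obtain N where N: "\<And>n. n \<ge> N \<Longrightarrow> s (fact n) = s (fact N)"
    using eventually_const_at_factorials[of s, OF fin det] by blast
  have "\<forall>\<^sub>F n in sequentially. r `` {(h ^^ fact n) w} = r `` {(h ^^ fact N) w}"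
    unfolding eventually_sequentially by (intro exI[of _ N] allI impI s_eq[OF N w])
  moreover have "r `` {(h ^^ fact N) w} \<in> carrier (free_sg A) // r"
    by (intro quotientI hn(1) w)
  ultimately show ?thesis
    by blast
qed

text \<open>The coordinates of the limit are the eventual classes; any two are compatible because
  both are attained at a common n. Limits are unique in a Hausdorff space, so
  \<open>omega_power\<close> denotes this one.\<close>

lemma omega_power_limit:
  assumes A: "finite A" and h: "h \<in> sg_hom (free_sg A) (free_sg A)" and w: "w \<in> carrier (free_sg A)"
  shows "limitin (prof_topology A) (\<lambda>n. emb A ((h ^^ fact n) w))
    (omega_power A (prof_ext A A h) (emb A w)) sequentially"
proof -
  define u where "u n = (h ^^ fact n) w" for n
  have u: "u n \<in> carrier (free_sg A)" for n
    using sg_hom_freeD(1)[OF funpow_sg_hom[OF h] w] by (simp add: u_def)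
  obtain X where X: "X r \<in> carrier (free_sg A) // r" "\<forall>\<^sub>F n in sequentially. r `` {u n} = X r"
    if "r \<in> fin_congs A" for r
    using class_iterates_eventually_const[OF A h _ w] unfolding u_def by metis
  define q where "q = (\<lambda>r\<in>fin_congs A. X r)"
  have "q r \<subseteq> q s" if rs: "r \<in> fin_congs A" "s \<in> fin_congs A" "r \<subseteq> s" for r s
  proof -
    have "\<forall>\<^sub>F n in sequentially. r `` {u n} = X r \<and> s `` {u n} = X s"
      using X(2)[OF rs(1)] X(2)[OF rs(2)] by (rule eventually_conj)
    then obtain n where "r `` {u n} = X r" "s `` {u n} = X s"
      using eventually_happens'[OF sequentially_bot] by blast
    then show ?thesis
      using rs by (auto simp: q_def)
  qed
  then have q: "q \<in> carrier (free_prof A)"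
    using X(1) by (auto simp: carrier_free_prof q_def)
  have lim: "limitin (prof_topology A) (\<lambda>n. emb A (u n)) q sequentially"
    unfolding limitin_prof_iff limitin_componentwise
  proof (intro conjI ballI)
    show "\<forall>\<^sub>F n in sequentially. emb A (u n) \<in> carrier (free_prof A)"
      by (simp add: u emb_in_carrier)
    show "q \<in> extensional (fin_congs A)"
      by (simp add: q_def)
    show "\<forall>\<^sub>F n in sequentially. emb A (u n) \<in>
        topspace (product_topology (\<lambda>r. discrete_topology (carrier (free_sg A) // r)) (fin_congs A))"
      using u by (auto simp: emb_def intro!: quotientI always_eventually)
    fix r assume r: "r \<in> fin_congs A"
    show "limitin (discrete_topology (carrier (free_sg A) // r)) (\<lambda>n. emb A (u n) r) (q r) sequentially"
      using X[OF r] r by (intro limitin_eventually) (simp_all add: q_def emb_apply)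
  qed (rule q)
  have "(prof_ext A A h ^^ n) (emb A w) = emb A ((h ^^ n) w)" for n
    using sg_hom_freeD(1)[OF funpow_sg_hom[OF h] w]
    by (induction n) (simp_all add: prof_ext_props(2)[OF h])
  then have "omega_power A (prof_ext A A h) (emb A w) =
      (THE q. limitin (prof_topology A) (\<lambda>n. emb A (u n)) q sequentially)"
    by (simp add: omega_power_def u_def)
  also have "\<dots> = q"
    using lim limitin_Hausdorff_unique[OF _ lim sequentially_bot Hausdorff_prof]
    by (intro the_equality) blast+
  finally show ?thesis
    using lim by (simp add: u_def)
qed

text \<open>Along a convergent sequence, a continuous map into a discrete space is eventually
  constant. Moreover the homomorphisms of the free semigroup into S are the restrictions of the
  continuous ones of the profinite semigroup, so the pseudoidentity becomes a statement about
  words.\<close>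

lemma satisfies_limit_iff:
  assumes S: "finite (carrier S)" and u: "\<And>n. u n \<in> carrier (free_sg B)" "\<And>n. v n \<in> carrier (free_sg B)"
    and p: "limitin (prof_topology B) (\<lambda>n. emb B (u n)) p sequentially"
    and q: "limitin (prof_topology B) (\<lambda>n. emb B (v n)) q sequentially"
  shows "satisfies S B p q \<longleftrightarrow>
    (\<forall>\<theta>\<in>sg_hom (free_sg B) S. \<forall>\<^sub>F n in sequentially. \<theta> (u n) = \<theta> (v n))"
proof -
  have ev: "\<forall>\<^sub>F n in sequentially. \<theta> (emb B (u n)) = \<theta> p \<and> \<theta> (emb B (v n)) = \<theta> q"
    if "continuous_map (prof_topology B) (discrete_topology (carrier S)) \<theta>" for \<theta>
  proof (rule eventually_conj)
    have lim: "\<forall>\<^sub>F n in sequentially. \<theta> (x n) = \<theta> z"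
      if "limitin (prof_topology B) x z sequentially" for x z
    proof -
      have "limitin (discrete_topology (carrier S)) (\<theta> \<circ> x) (\<theta> z) sequentially"
        by (rule continuous_map_limit[OF \<open>continuous_map _ _ \<theta>\<close> that])
      then have "\<forall>\<^sub>F n in sequentially. (\<theta> \<circ> x) n \<in> {\<theta> z}"
        by (rule limitinD) (use \<open>limitin (discrete_topology _) _ _ _\<close> in \<open>auto dest: limitin_topspace\<close>)
      then show ?thesis
        by simp
    qed
    show "\<forall>\<^sub>F n in sequentially. \<theta> (emb B (u n)) = \<theta> p" "\<forall>\<^sub>F n in sequentially. \<theta> (emb B (v n)) = \<theta> q"
      by (rule lim[OF p], rule lim[OF q])
  qed
  show ?thesis
  proof
    assume sat: "satisfies S B p q"
    show "\<forall>\<theta>\<in>sg_hom (free_sg B) S. \<forall>\<^sub>F n in sequentially. \<theta> (u n) = \<theta> (v n)"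
    proof
      fix h assume h: "h \<in> sg_hom (free_sg B) S"
      obtain \<theta> where \<theta>: "\<theta> \<in> sg_hom (free_prof B) S"
        "continuous_map (prof_topology B) (discrete_topology (carrier S)) \<theta>"
        "\<And>w. w \<in> carrier (free_sg B) \<Longrightarrow> \<theta> (emb B w) = h w"
        using extend_to_finite_semigroup[OF h S] by blast
      have "\<theta> p = \<theta> q"
        using sat \<theta>(1,2) by (simp add: satisfies_def)
      with ev[OF \<theta>(2)] have "\<forall>\<^sub>F n in sequentially. \<theta> (emb B (u n)) = \<theta> (emb B (v n))"
        by (auto elim: eventually_mono)
      then show "\<forall>\<^sub>F n in sequentially. h (u n) = h (v n)"
        by (simp add: \<theta>(3) u)
    qed
  next
    assume R: "\<forall>\<theta>\<in>sg_hom (free_sg B) S. \<forall>\<^sub>F n in sequentially. \<theta> (u n) = \<theta> (v n)"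
    show "satisfies S B p q"
      unfolding satisfies_def
    proof (intro ballI impI)
      fix \<theta> assume \<theta>: "\<theta> \<in> sg_hom (free_prof B) S"
        "continuous_map (prof_topology B) (discrete_topology (carrier S)) \<theta>"
      have "\<theta> \<circ> emb B \<in> sg_hom (free_sg B) S"
        using \<theta>(1) by (auto simp: sg_hom_def Pi_iff emb_in_carrier mult_free_sg simp flip: mult_emb)
      then have "\<forall>\<^sub>F n in sequentially. (\<theta> \<circ> emb B) (u n) = (\<theta> \<circ> emb B) (v n)"
        using R by blast
      with ev[OF \<theta>(2)] have "\<forall>\<^sub>F n in sequentially. \<theta> p = \<theta> q"
        by eventually_elim simp
      then show "\<theta> p = \<theta> q"
        by simp
    qed
  qed
qed

section \<open>Substitutions\<close>

definition subst :: "('a \<Rightarrow> 'b list) \<Rightarrow> 'a list \<Rightarrow> 'b list" where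
  "subst \<sigma> w = concat (map \<sigma> w)"

lemma subst_sg_hom:
  assumes "\<And>a. a \<in> A \<Longrightarrow> \<sigma> a \<in> carrier (free_sg B)"
  shows "subst \<sigma> \<in> sg_hom (free_sg A) (free_sg B)"
proof -
  have "subst \<sigma> w \<in> carrier (free_sg B)" if "w \<in> carrier (free_sg A)" for w
    using that assms by (induction w rule: free_sg_induct) (auto simp: subst_def carrier_free_sg)
  then show ?thesis
    by (auto simp: sg_hom_def mult_free_sg subst_def)
qed

lemma subst_letter [simp]: "subst \<sigma> [a] = \<sigma> a"
  by (simp add: subst_def)

lemma prof_ext_unique:
  assumes h: "h \<in> sg_hom (free_sg A) (free_sg B)"
  shows "(THE f. f \<in> prof_hom A B \<and> (\<forall>a\<in>A. f (emb A [a]) = emb B (h [a]))) = prof_ext A B h"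
proof (rule the_equality)
  show "prof_ext A B h \<in> prof_hom A B \<and> (\<forall>a\<in>A. prof_ext A B h (emb A [a]) = emb B (h [a]))"
    using prof_ext_props[OF h] by (simp add: carrier_free_sg)
  show "f = prof_ext A B h" if "f \<in> prof_hom A B \<and> (\<forall>a\<in>A. f (emb A [a]) = emb B (h [a]))" for f
    using that by (intro prof_hom_determined_by_letters[OF _ h]) auto
qed

text \<open>Words of the free semigroup are nonempty and S need not have an identity, so the
  recursion stops at the last letter.\<close>

primrec sg_eval :: "'s sgp \<Rightarrow> ('a \<Rightarrow> 's) \<Rightarrow> 'a list \<Rightarrow> 's" where
  "sg_eval S e [] = undefined"
| "sg_eval S e (a # w) = (if w = [] then e a else sg_mult S (e a) (sg_eval S e w))"

lemma sg_eval_hom: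
  assumes S: "finite_semigroup S" and e: "\<And>a. a \<in> A \<Longrightarrow> e a \<in> carrier S"
  shows "sg_eval S e \<in> sg_hom (free_sg A) S"
proof -
  note D = finite_semigroupD[OF S]
  have in_S: "sg_eval S e w \<in> carrier S" if "w \<in> carrier (free_sg A)" for w
    using that by (induction w rule: free_sg_induct) (simp_all add: e D(3))
  have "sg_eval S e (u @ v) = sg_mult S (sg_eval S e u) (sg_eval S e v)"
    if "u \<in> carrier (free_sg A)" and v: "v \<in> carrier (free_sg A)" for u v
    using that(1)
  proof (induction u rule: free_sg_induct)
    case (letter a)
    then show ?case
      using v by (simp add: carrier_free_sg)
  next
    case (append a u)
    then show ?case
      using v by (simp add: e in_S D(4) carrier_free_sg)
  qed
  then show ?thesis
    using in_S by (auto simp: sg_hom_def mult_free_sg)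
qed

lemma eventually_at_factorials_iff:
  assumes "\<And>k. P k \<Longrightarrow> P (Suc k)"
  shows "(\<forall>\<^sub>F n in sequentially. P (fact n)) \<longleftrightarrow> (\<exists>n. P n)"
proof
  assume "\<exists>n. P n"
  then obtain n where "P n" ..
  have "P (fact k)" if "n \<le> k" for k
  proof -
    have "n \<le> fact k"
      using that fact_ge_self[of k] by linarith
    then show ?thesis
      using \<open>P n\<close> assms by (induction rule: dec_induct) blast+
  qed
  then show "\<forall>\<^sub>F n in sequentially. P (fact n)"
    by (auto simp: eventually_sequentially)
qed (use eventually_happens'[OF sequentially_bot] in blast)

section \<open>The two pseudovarieties\<close>

fun sigma_TM :: "letter \<Rightarrow> letter list" where
  "sigma_TM Lx = [Lx, Ly]" | "sigma_TM Ly = [Ly, Lx]" | "sigma_TM a = [a]"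

fun sigma_MN :: "letter \<Rightarrow> letter list" where
  "sigma_MN Lx = [Lx, Lz, Ly, Lt, Ly, Lz, Lx]" | "sigma_MN Ly = [Ly, Lz, Lx, Lt, Lx, Lz, Ly]"
| "sigma_MN a = [a]"

abbreviation (input) letters_TM :: "letter set" where "letters_TM \<equiv> {Lx, Ly}"
abbreviation (input) letters_MN :: "letter set" where "letters_MN \<equiv> {Lx, Ly, Lz, Lt}"

lemma sigma_TM_hom: "subst sigma_TM \<in> sg_hom (free_sg letters_TM) (free_sg letters_TM)"
  and sigma_MN_hom: "subst sigma_MN \<in> sg_hom (free_sg letters_MN) (free_sg letters_MN)"
  by (auto intro!: subst_sg_hom simp: carrier_free_sg)

lemma phi_TM_eq: "phi_TM = prof_ext letters_TM letters_TM (subst sigma_TM)"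
  unfolding phi_TM_def prof_ext_unique[OF sigma_TM_hom, symmetric] by simp

lemma phi_MN_eq: "phi_MN = prof_ext letters_MN letters_MN (subst sigma_MN)"
  unfolding phi_MN_def prof_ext_unique[OF sigma_MN_hom, symmetric] by simp

text \<open>With \<sigma> applied first, the n-th iterate distributes over the word
  \<open>\<sigma> a\<close>; this yields the recursions for the images of x and y.\<close>

lemma iterate_Suc_letter: "(subst \<sigma> ^^ Suc n) [a] = (subst \<sigma> ^^ n) (\<sigma> a)"
  by (simp add: funpow_swap1)

text \<open>The images of x and y under the iterates of \<phi> follow the recursion of lambda and
  rho with all parameters 1, so agreement at all late factorials means that the sequences
  meet.\<close>

lemma TM_models:
  "(TM :: 'a sgp set) = models letters_TM
    {(omega_power letters_TM phi_TM (emb letters_TM [Lx]), omega_power letters_TM phi_TM (emb letters_TM [Ly]))}"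
proof (rule Set.set_eqI)
  fix S :: "'a sgp"
  define h where "h = subst sigma_TM"
  note hn = sg_hom_freeD[OF funpow_sg_hom[OF sigma_TM_hom], unfolded mult_free_sg, folded h_def]
  have letter: "[Lx] \<in> carrier (free_sg letters_TM)" "[Ly] \<in> carrier (free_sg letters_TM)"
    by (simp_all add: carrier_free_sg)
  have steps: "\<theta> ((h ^^ Suc n) [Lx]) = sg_mult S (\<theta> ((h ^^ n) [Lx])) (\<theta> ((h ^^ n) [Ly]))"
    "\<theta> ((h ^^ Suc n) [Ly]) = sg_mult S (\<theta> ((h ^^ n) [Ly])) (\<theta> ((h ^^ n) [Lx]))"
    if \<theta>: "\<theta> \<in> sg_hom (free_sg letters_TM) S" for \<theta> n
  proof -
    have "(h ^^ Suc n) [Lx] = (h ^^ n) ([Lx] @ [Ly])" "(h ^^ Suc n) [Ly] = (h ^^ n) ([Ly] @ [Lx])"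
      unfolding h_def iterate_Suc_letter by simp_all
    then show "\<theta> ((h ^^ Suc n) [Lx]) = sg_mult S (\<theta> ((h ^^ n) [Lx])) (\<theta> ((h ^^ n) [Ly]))"
      "\<theta> ((h ^^ Suc n) [Ly]) = sg_mult S (\<theta> ((h ^^ n) [Ly])) (\<theta> ((h ^^ n) [Lx]))"
      by (simp_all only: hn letter sg_hom_freeD(2)[OF \<theta>])
  qed
  show "S \<in> TM \<longleftrightarrow> S \<in> models letters_TM
    {(omega_power letters_TM phi_TM (emb letters_TM [Lx]), omega_power letters_TM phi_TM (emb letters_TM [Ly]))}"
  proof (cases "finite_semigroup S")
    case True
    have "satisfies S letters_TM (omega_power letters_TM phi_TM (emb letters_TM [Lx]))
        (omega_power letters_TM phi_TM (emb letters_TM [Ly])) \<longleftrightarrow>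
      (\<forall>\<theta>\<in>sg_hom (free_sg letters_TM) S. \<forall>\<^sub>F n in sequentially.
        \<theta> ((h ^^ fact n) [Lx]) = \<theta> ((h ^^ fact n) [Ly]))"
      unfolding phi_TM_eq h_def
      by (rule satisfies_limit_iff[OF finite_semigroupD(1)[OF True] _ _
            omega_power_limit[OF _ sigma_TM_hom letter(1)] omega_power_limit[OF _ sigma_TM_hom letter(2)]])
        (simp_all add: hn[unfolded h_def] letter)
    also have "\<dots> \<longleftrightarrow> (\<forall>\<theta>\<in>sg_hom (free_sg letters_TM) S. \<exists>n. \<theta> ((h ^^ n) [Lx]) = \<theta> ((h ^^ n) [Ly]))"
    proof (rule ball_cong[OF refl])
      show "(\<forall>\<^sub>F n in sequentially. \<theta> ((h ^^ fact n) [Lx]) = \<theta> ((h ^^ fact n) [Ly])) \<longleftrightarrow>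
          (\<exists>n. \<theta> ((h ^^ n) [Lx]) = \<theta> ((h ^^ n) [Ly]))"
        if "\<theta> \<in> sg_hom (free_sg letters_TM) S" for \<theta>
        by (rule eventually_at_factorials_iff) (simp only: steps[OF that])
    qed
    also have "\<dots> \<longleftrightarrow> S \<in> TM"
    proof
      assume "S \<in> TM"
      then have *: "\<exists>n. g n = k n"
        if "g 0 \<in> carrier S" "k 0 \<in> carrier S"
          "\<And>n. g (Suc n) = sg_mult S (g n) (k n) \<and> k (Suc n) = sg_mult S (k n) (g n)" for g k
        using that unfolding TM_iff by blast
      show "\<forall>\<theta>\<in>sg_hom (free_sg letters_TM) S. \<exists>n. \<theta> ((h ^^ n) [Lx]) = \<theta> ((h ^^ n) [Ly])"
      proof
        fix \<theta> assume \<theta>: "\<theta> \<in> sg_hom (free_sg letters_TM) S"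
        show "\<exists>n. \<theta> ((h ^^ n) [Lx]) = \<theta> ((h ^^ n) [Ly])"
          by (rule *) (simp_all only: steps[OF \<theta>] hn sg_hom_freeD(1)[OF \<theta>] letter simp_thms)
      qed
    next
      assume R: "\<forall>\<theta>\<in>sg_hom (free_sg letters_TM) S. \<exists>n. \<theta> ((h ^^ n) [Lx]) = \<theta> ((h ^^ n) [Ly])"
      show "S \<in> TM"
        unfolding TM_iff
      proof (intro conjI True ballI allI impI)
        fix a b g k
        assume ab: "a \<in> carrier S" "b \<in> carrier S" "g 0 = a" "k 0 = b"
          and gk: "\<forall>n. g (Suc n) = sg_mult S (g n) (k n) \<and> k (Suc n) = sg_mult S (k n) (g n)"
        define \<theta> where "\<theta> = sg_eval S (\<lambda>l. if l = Lx then a else b)"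
        have \<theta>: "\<theta> \<in> sg_hom (free_sg letters_TM) S"
          unfolding \<theta>_def by (rule sg_eval_hom[OF True]) (use ab in auto)
        have "\<theta> ((h ^^ n) [Lx]) = g n \<and> \<theta> ((h ^^ n) [Ly]) = k n" for n
        proof (induction n)
          case 0
          then show ?case
            by (simp add: \<theta>_def ab)
        next
          case (Suc n)
          then show ?case
            using gk by (simp only: steps[OF \<theta>])
        qed
        then show "\<exists>n. g n = k n"
          using R \<theta> by metis
      qed
    qed
    finally show ?thesis
      using True by (simp add: models_def)
  qed (simp add: TM_def models_def)
qed

section \<open>Generated subsemigroups and the pseudoidentities for MN^(i)\<close>

lemma sg_span_subset:
  assumes "finite_semigroup S" "X \<subseteq> carrier S"
  shows "sg_span S X \<subseteq> carrier S"
proof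
  show "x \<in> carrier S" if "x \<in> sg_span S X" for x
    using that
  proof induction
    case (base x)
    then show ?case
      using assms(2) by blast
  qed (rule finite_semigroupD(3)[OF assms(1)])
qed

lemma finite_semigroup_subsg:
  assumes "finite_semigroup S" "X \<subseteq> carrier S" "X \<noteq> {}"
  shows "finite_semigroup (subsg S X)"
proof -
  note span = sg_span_subset[OF assms(1,2)]
  have "finite (sg_span S X)" "sg_span S X \<noteq> {}"
    using finite_subset[OF span finite_semigroupD(1)[OF assms(1)]] assms(3) by (auto intro: sg_span.base)
  then show ?thesis
    using finite_semigroupD(4)[OF assms(1)] span
    by (simp add: finite_semigroup_def subsg_def sg_span.mult subset_iff)
qed

lemma sg_hom_image_span:
  assumes "\<theta> \<in> sg_hom (free_sg B) S" "w \<in> carrier (free_sg B)"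
  shows "\<theta> w \<in> sg_span S ((\<lambda>b. \<theta> [b]) ` B)"
  using assms(2)
proof (induction w rule: free_sg_induct)
  case (append b w)
  have "[b] \<in> carrier (free_sg B)"
    using append by (simp add: carrier_free_sg)
  then have "\<theta> ([b] @ w) = sg_mult S (\<theta> [b]) (\<theta> w)"
    using append by (intro sg_hom_freeD(2)[OF assms(1)])
  then show ?case
    using append by (auto intro: sg_span.intros)
qed (auto intro: sg_span.base)

lemma sg_span_word:
  assumes \<theta>: "\<theta> \<in> sg_hom (free_sg B) S" and X: "X \<subseteq> (\<lambda>b. \<theta> [b]) ` B" and x: "x \<in> sg_span S X"
  shows "\<exists>w\<in>carrier (free_sg B). \<theta> w = x"
  using x
proof induction
  case (base x)
  then obtain b where "b \<in> B" "x = \<theta> [b]"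
    using X by blast
  then show ?case
    by (intro bexI[of _ "[b]"]) (simp_all add: carrier_free_sg)
next
  case (mult x y)
  then obtain u v where "u \<in> carrier (free_sg B)" "v \<in> carrier (free_sg B)" "\<theta> u = x" "\<theta> v = y"
    by blast
  then show ?case
    using sg_hom_freeD(2)[OF \<theta>] append_free_sg by metis
qed

text \<open>One application of \<phi> performs two steps: x z y t y z x is (x z y) t (y z x), which
  is lambda at index 2 for the parameters z, t.\<close>

lemma malcev_seq_sigma_MN:
  assumes \<eta>: "\<eta> \<in> sg_hom (free_sg letters_MN) S"
    and seq: "malcev_seq (sg_mult S) (\<lambda>k. if even k then \<eta> [Lz] else \<eta> [Lt]) g h"
    and init: "g 0 = \<eta> [Lx]" "h 0 = \<eta> [Ly]"
  shows "g (2 * n) = \<eta> ((subst sigma_MN ^^ n) [Lx]) \<and> h (2 * n) = \<eta> ((subst sigma_MN ^^ n) [Ly])"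
proof (induction n)
  case (Suc n)
  define s where "s = subst sigma_MN"
  note sn = sg_hom_freeD[OF funpow_sg_hom[OF sigma_MN_hom], unfolded mult_free_sg, folded s_def]
  note \<eta>D = sg_hom_freeD[OF \<eta>]
  have letter: "[Lx] \<in> carrier (free_sg letters_MN)" "[Ly] \<in> carrier (free_sg letters_MN)"
    "[Lz] \<in> carrier (free_sg letters_MN)" "[Lt] \<in> carrier (free_sg letters_MN)"
    by (simp_all add: carrier_free_sg)
  have fixed: "(s ^^ n) [Lz] = [Lz]" "(s ^^ n) [Lt] = [Lt]"
    by (induction n) (simp_all add: s_def)
  have g_Suc: "g (Suc k) = sg_mult S (sg_mult S (g k) (if even k then \<eta> [Lz] else \<eta> [Lt])) (h k)"
    and h_Suc: "h (Suc k) = sg_mult S (sg_mult S (h k) (if even k then \<eta> [Lz] else \<eta> [Lt])) (g k)" for k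
    using seq by (simp_all add: malcev_seq_def)
  have "(s ^^ Suc n) [Lx] = (s ^^ n) (((([Lx] @ [Lz]) @ [Ly]) @ [Lt]) @ (([Ly] @ [Lz]) @ [Lx]))"
    "(s ^^ Suc n) [Ly] = (s ^^ n) (((([Ly] @ [Lz]) @ [Lx]) @ [Lt]) @ (([Lx] @ [Lz]) @ [Ly]))"
    unfolding s_def iterate_Suc_letter by simp_all
  then have
    "\<eta> ((s ^^ Suc n) [Lx]) = sg_mult S
      (sg_mult S (sg_mult S (sg_mult S (\<eta> ((s ^^ n) [Lx])) (\<eta> [Lz])) (\<eta> ((s ^^ n) [Ly]))) (\<eta> [Lt]))
      (sg_mult S (sg_mult S (\<eta> ((s ^^ n) [Ly])) (\<eta> [Lz])) (\<eta> ((s ^^ n) [Lx])))"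
    "\<eta> ((s ^^ Suc n) [Ly]) = sg_mult S
      (sg_mult S (sg_mult S (sg_mult S (\<eta> ((s ^^ n) [Ly])) (\<eta> [Lz])) (\<eta> ((s ^^ n) [Lx]))) (\<eta> [Lt]))
      (sg_mult S (sg_mult S (\<eta> ((s ^^ n) [Lx])) (\<eta> [Lz])) (\<eta> ((s ^^ n) [Ly])))"
    by (simp_all only: sn \<eta>D letter append_free_sg fixed)
  then show ?case
    using Suc by (simp add: g_Suc h_Suc flip: s_def)
qed (simp add: init)

text \<open>Generating sets may have fewer elements than there are letters; the surplus letters are
  sent to some fixed element of X.\<close>

lemma ex_onto_finite:
  assumes "finite X" "X \<noteq> {}" "finite B" "card X \<le> card B"
  obtains e where "e ` B = X"
proof -
  obtain f where f: "f ` X \<subseteq> B" "inj_on f X"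
    using card_le_inj[OF assms(1,3,4)] by blast
  obtain x where x: "x \<in> X"
    using assms(2) by blast
  define e where "e b = (if b \<in> f ` X then inv_into X f b else x)" for b
  have "e ` B \<subseteq> X"
    using x by (auto simp: e_def intro: inv_into_into)
  moreover have "y \<in> e ` B" if "y \<in> X" for y
    using that f by (intro image_eqI[of _ _ "f y"]) (auto simp: e_def)
  ultimately show thesis
    using that by blast
qed

text \<open>The continuous extension of \<psi> carries limits of words to limits of words, and the
  previous computation applies to \<theta> \<circ> \<psi>. The quantifiers over g and h concern a
  single pair of sequences, fixed by recursion and initial values.\<close>

lemma satisfies_MN_iff:
  assumes S: "finite_semigroup S" and \<psi>: "\<psi> \<in> sg_hom (free_sg letters_MN) (free_sg B)"
  shows "satisfies S B
      (prof_ext letters_MN B \<psi> (omega_power letters_MN phi_MN (emb letters_MN [Lx])))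
      (prof_ext letters_MN B \<psi> (omega_power letters_MN phi_MN (emb letters_MN [Ly]))) \<longleftrightarrow>
    (\<forall>\<theta>\<in>sg_hom (free_sg B) S. \<forall>g h.
      malcev_seq (sg_mult S) (\<lambda>k. if even k then \<theta> (\<psi> [Lz]) else \<theta> (\<psi> [Lt])) g h \<longrightarrow>
      g 0 = \<theta> (\<psi> [Lx]) \<longrightarrow> h 0 = \<theta> (\<psi> [Ly]) \<longrightarrow> (\<exists>n. g n = h n))"
proof -
  define s where "s = subst sigma_MN"
  note sn = sg_hom_freeD(1)[OF funpow_sg_hom[OF sigma_MN_hom], folded s_def]
  have letter: "[Lx] \<in> carrier (free_sg letters_MN)" "[Ly] \<in> carrier (free_sg letters_MN)"
    by (simp_all add: carrier_free_sg)
  have lim: "limitin (prof_topology B) (\<lambda>n. emb B (\<psi> ((s ^^ fact n) w)))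
      (prof_ext letters_MN B \<psi> (omega_power letters_MN phi_MN (emb letters_MN w))) sequentially"
    if w: "w \<in> carrier (free_sg letters_MN)" for w
  proof -
    have "limitin (prof_topology B) (prof_ext letters_MN B \<psi> \<circ> (\<lambda>n. emb letters_MN ((s ^^ fact n) w)))
      (prof_ext letters_MN B \<psi> (omega_power letters_MN phi_MN (emb letters_MN w))) sequentially"
      unfolding phi_MN_eq s_def
      by (rule continuous_map_limit[OF prof_homD(1)[OF prof_ext_props(1)[OF \<psi>]]
            omega_power_limit[OF _ sigma_MN_hom w]]) simp
    then show ?thesis
      by (simp add: o_def prof_ext_props(2)[OF \<psi>] sn w)
  qed
  have "satisfies S B
      (prof_ext letters_MN B \<psi> (omega_power letters_MN phi_MN (emb letters_MN [Lx])))
      (prof_ext letters_MN B \<psi> (omega_power letters_MN phi_MN (emb letters_MN [Ly]))) \<longleftrightarrow>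
    (\<forall>\<theta>\<in>sg_hom (free_sg B) S. \<forall>\<^sub>F n in sequentially.
      \<theta> (\<psi> ((s ^^ fact n) [Lx])) = \<theta> (\<psi> ((s ^^ fact n) [Ly])))"
    by (rule satisfies_limit_iff[OF finite_semigroupD(1)[OF S] _ _ lim[OF letter(1)] lim[OF letter(2)]])
      (simp_all add: sg_hom_freeD(1)[OF \<psi>] sn letter)
  also have "\<dots> \<longleftrightarrow> (\<forall>\<theta>\<in>sg_hom (free_sg B) S. \<forall>g h.
      malcev_seq (sg_mult S) (\<lambda>k. if even k then \<theta> (\<psi> [Lz]) else \<theta> (\<psi> [Lt])) g h \<longrightarrow>
      g 0 = \<theta> (\<psi> [Lx]) \<longrightarrow> h 0 = \<theta> (\<psi> [Ly]) \<longrightarrow> (\<exists>n. g n = h n))"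
  proof (rule ball_cong[OF refl])
    fix \<theta> assume \<theta>: "\<theta> \<in> sg_hom (free_sg B) S"
    have \<eta>: "\<theta> \<circ> \<psi> \<in> sg_hom (free_sg letters_MN) S"
      by (rule sg_hom_compose[OF \<psi> \<theta>])
    have even_terms: "g (2 * n) = \<theta> (\<psi> ((s ^^ n) [Lx])) \<and> h (2 * n) = \<theta> (\<psi> ((s ^^ n) [Ly]))"
      if "malcev_seq (sg_mult S) (\<lambda>k. if even k then \<theta> (\<psi> [Lz]) else \<theta> (\<psi> [Lt])) g h"
        "g 0 = \<theta> (\<psi> [Lx])" "h 0 = \<theta> (\<psi> [Ly])" for g h n
      using malcev_seq_sigma_MN[OF \<eta>, unfolded o_apply, OF that] by (simp add: s_def)
    obtain g h where gh: "malcev_seq (sg_mult S) (\<lambda>k. if even k then \<theta> (\<psi> [Lz]) else \<theta> (\<psi> [Lt])) g h"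
        "g 0 = \<theta> (\<psi> [Lx])" "h 0 = \<theta> (\<psi> [Ly])"
      by (rule malcev_seq_exists)
    have "(\<forall>\<^sub>F n in sequentially. \<theta> (\<psi> ((s ^^ fact n) [Lx])) = \<theta> (\<psi> ((s ^^ fact n) [Ly]))) \<longleftrightarrow>
        (\<exists>n. \<theta> (\<psi> ((s ^^ n) [Lx])) = \<theta> (\<psi> ((s ^^ n) [Ly])))"
    proof (rule eventually_at_factorials_iff)
      show "\<theta> (\<psi> ((s ^^ Suc k) [Lx])) = \<theta> (\<psi> ((s ^^ Suc k) [Ly]))"
        if "\<theta> (\<psi> ((s ^^ k) [Lx])) = \<theta> (\<psi> ((s ^^ k) [Ly]))" for k
        using even_terms[OF gh, of k] even_terms[OF gh, of "Suc k"] that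
          malcev_seq_eq_mono[OF gh(1), of "2 * k" "2 * Suc k"] by simp
    qed
    also have "\<dots> \<longleftrightarrow> (\<forall>g h.
      malcev_seq (sg_mult S) (\<lambda>k. if even k then \<theta> (\<psi> [Lz]) else \<theta> (\<psi> [Lt])) g h \<longrightarrow>
      g 0 = \<theta> (\<psi> [Lx]) \<longrightarrow> h 0 = \<theta> (\<psi> [Ly]) \<longrightarrow> (\<exists>n. g n = h n))"
    proof
      assume "\<exists>n. \<theta> (\<psi> ((s ^^ n) [Lx])) = \<theta> (\<psi> ((s ^^ n) [Ly]))"
      then obtain n where n: "\<theta> (\<psi> ((s ^^ n) [Lx])) = \<theta> (\<psi> ((s ^^ n) [Ly]))" ..
      show "\<forall>g h.
        malcev_seq (sg_mult S) (\<lambda>k. if even k then \<theta> (\<psi> [Lz]) else \<theta> (\<psi> [Lt])) g h \<longrightarrow>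
        g 0 = \<theta> (\<psi> [Lx]) \<longrightarrow> h 0 = \<theta> (\<psi> [Ly]) \<longrightarrow> (\<exists>n. g n = h n)"
      proof (intro allI impI exI)
        show "g (2 * n) = h (2 * n)"
          if "malcev_seq (sg_mult S) (\<lambda>k. if even k then \<theta> (\<psi> [Lz]) else \<theta> (\<psi> [Lt])) g h"
            "g 0 = \<theta> (\<psi> [Lx])" "h 0 = \<theta> (\<psi> [Ly])" for g h
          using even_terms[OF that, of n] n by simp
      qed
    next
      assume "\<forall>g h.
        malcev_seq (sg_mult S) (\<lambda>k. if even k then \<theta> (\<psi> [Lz]) else \<theta> (\<psi> [Lt])) g h \<longrightarrow>
        g 0 = \<theta> (\<psi> [Lx]) \<longrightarrow> h 0 = \<theta> (\<psi> [Ly]) \<longrightarrow> (\<exists>n. g n = h n)"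
      then obtain n where "g n = h n"
        using gh by blast
      \<comment> \<open>The sequences may meet at an odd index, which no iterate of \<phi>
        represents; agreement persists up to \<open>2 * n\<close>.\<close>
      then have "g (2 * n) = h (2 * n)"
        by (rule malcev_seq_eq_mono[OF gh(1)]) simp
      then show "\<exists>n. \<theta> (\<psi> ((s ^^ n) [Lx])) = \<theta> (\<psi> ((s ^^ n) [Ly]))"
        using even_terms[OF gh, of n] by auto
    qed
    finally show "(\<forall>\<^sub>F n in sequentially. \<theta> (\<psi> ((s ^^ fact n) [Lx])) = \<theta> (\<psi> ((s ^^ fact n) [Ly]))) \<longleftrightarrow>
      (\<forall>g h.
        malcev_seq (sg_mult S) (\<lambda>k. if even k then \<theta> (\<psi> [Lz]) else \<theta> (\<psi> [Lt])) g h \<longrightarrow>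
        g 0 = \<theta> (\<psi> [Lx]) \<longrightarrow> h 0 = \<theta> (\<psi> [Ly]) \<longrightarrow> (\<exists>n. g n = h n))" .
  qed
  finally show ?thesis .
qed

text \<open>From left to right, the images of the letters of B generate a subsemigroup in MN that
  contains the starting values and parameters. Conversely, \<theta> maps the letters onto a given
  generating set, and \<psi> sends x, y, z, t to words for given starting values and parameters;
  this is where \<psi> has to run through all homomorphisms.\<close>

lemma MN_gen_iff_satisfies:
  fixes B :: "'b set"
  assumes S: "finite_semigroup S" and B: "finite B" "B \<noteq> {}" "card B = i"
  shows "S \<in> MN_gen i \<longleftrightarrow> (\<forall>\<psi>\<in>sg_hom (free_sg letters_MN) (free_sg B). satisfies S B
      (prof_ext letters_MN B \<psi> (omega_power letters_MN phi_MN (emb letters_MN [Lx])))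
      (prof_ext letters_MN B \<psi> (omega_power letters_MN phi_MN (emb letters_MN [Ly]))))"
    (is "_ \<longleftrightarrow> ?R")
proof
  assume MN: "S \<in> MN_gen i"
  show ?R
  proof
    fix \<psi> assume \<psi>: "\<psi> \<in> sg_hom (free_sg letters_MN) (free_sg B)"
    show "satisfies S B
      (prof_ext letters_MN B \<psi> (omega_power letters_MN phi_MN (emb letters_MN [Lx])))
      (prof_ext letters_MN B \<psi> (omega_power letters_MN phi_MN (emb letters_MN [Ly])))"
      unfolding satisfies_MN_iff[OF S \<psi>]
    proof (intro ballI allI impI)
      fix \<theta> g h
      assume \<theta>: "\<theta> \<in> sg_hom (free_sg B) S"
        and seq: "malcev_seq (sg_mult S) (\<lambda>k. if even k then \<theta> (\<psi> [Lz]) else \<theta> (\<psi> [Lt])) g h"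
        and init: "g 0 = \<theta> (\<psi> [Lx])" "h 0 = \<theta> (\<psi> [Ly])"
      define X where "X = (\<lambda>b. \<theta> [b]) ` B"
      have "X \<subseteq> carrier S"
        using sg_hom_freeD(1)[OF \<theta>] by (auto simp: X_def carrier_free_sg)
      moreover have "X \<noteq> {}" "card X \<le> i"
        using B card_image_le[OF B(1)] by (auto simp: X_def)
      ultimately have "subsg S X \<in> MN"
        using MN by (auto simp: MN_gen_def)
      then have alt: "alternating_nilpotent (sg_mult S) (sg_span S X)"
        using alternating_nilpotent_if_MN[of "subsg S X"] by (simp add: subsg_def)
      have "\<theta> (\<psi> [l]) \<in> sg_span S X" if "l \<in> letters_MN" for l
        unfolding X_def using that
        by (intro sg_hom_image_span[OF \<theta>] sg_hom_freeD(1)[OF \<psi>]) (simp add: carrier_free_sg)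
      then show "\<exists>n. g n = h n"
        using alt[unfolded alternating_nilpotent_def, rule_format, OF _ _ seq] init by simp
    qed
  qed
next
  assume R: ?R
  have "subsg S X \<in> MN" if X: "X \<subseteq> carrier S" "X \<noteq> {}" "card X \<le> i" for X
  proof (rule MN_if_alternating_nilpotent[OF finite_semigroup_subsg[OF S X(1,2)]])
    have "finite X"
      using X(1) finite_semigroupD(1)[OF S] by (rule finite_subset)
    then obtain e where e: "e ` B = X"
      using ex_onto_finite[of X B] X B by metis
    define \<theta> where "\<theta> = sg_eval S e"
    have \<theta>: "\<theta> \<in> sg_hom (free_sg B) S"
      unfolding \<theta>_def by (rule sg_eval_hom[OF S]) (use e X in blast)
    have X_eq: "X \<subseteq> (\<lambda>b. \<theta> [b]) ` B"
      by (simp add: \<theta>_def e)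
    show "alternating_nilpotent (sg_mult (subsg S X)) (carrier (subsg S X))"
      unfolding alternating_nilpotent_def
    proof (intro allI ballI impI)
      fix g h c d
      assume "c \<in> carrier (subsg S X)" "d \<in> carrier (subsg S X)"
        "g 0 \<in> carrier (subsg S X)" "h 0 \<in> carrier (subsg S X)"
        and seq: "malcev_seq (sg_mult (subsg S X)) (\<lambda>k. if even k then c else d) g h"
      then obtain wc wd wg wh where
        w: "wc \<in> carrier (free_sg B)" "wd \<in> carrier (free_sg B)" "wg \<in> carrier (free_sg B)"
          "wh \<in> carrier (free_sg B)"
        and \<theta>w: "\<theta> wc = c" "\<theta> wd = d" "\<theta> wg = g 0" "\<theta> wh = h 0"
        using sg_span_word[OF \<theta> X_eq] by (auto simp: subsg_def) metis
      define \<psi> where "\<psi> = subst (\<lambda>l. case l of Lx \<Rightarrow> wg | Ly \<Rightarrow> wh | Lz \<Rightarrow> wc | Lt \<Rightarrow> wd)"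
      have \<psi>: "\<psi> \<in> sg_hom (free_sg letters_MN) (free_sg B)"
        unfolding \<psi>_def by (rule subst_sg_hom) (use w in auto)
      then have "satisfies S B
          (prof_ext letters_MN B \<psi> (omega_power letters_MN phi_MN (emb letters_MN [Lx])))
          (prof_ext letters_MN B \<psi> (omega_power letters_MN phi_MN (emb letters_MN [Ly])))"
        using R by blast
      from this[unfolded satisfies_MN_iff[OF S \<psi>], rule_format, OF \<theta>, of g h]
      show "\<exists>n. g n = h n"
        using seq \<theta>w by (simp add: \<psi>_def subsg_def cong: if_cong)
    qed
  qed
  then show "S \<in> MN_gen i"
    using S by (auto simp: MN_gen_def)
qed

theorem theorem7p1:
  shows "(TM :: 'a sgp set) =
      models {Lx, Ly}
        {(omega_power {Lx, Ly} phi_TM (emb {Lx, Ly} [Lx]),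
          omega_power {Lx, Ly} phi_TM (emb {Lx, Ly} [Ly]))} \<and>
    (\<forall>i\<in>{2, 3}. (MN_gen i :: 'a sgp set) =
      models {1..i}
        {(prof_ext {Lx, Ly, Lz, Lt} {1..i} \<psi>
            (omega_power {Lx, Ly, Lz, Lt} phi_MN (emb {Lx, Ly, Lz, Lt} [Lx])),
          prof_ext {Lx, Ly, Lz, Lt} {1..i} \<psi>
            (omega_power {Lx, Ly, Lz, Lt} phi_MN (emb {Lx, Ly, Lz, Lt} [Ly]))) | \<psi>.
         \<psi> \<in> sg_hom (free_sg {Lx, Ly, Lz, Lt}) (free_sg {1..i})})"
proof (intro conjI ballI TM_models Set.set_eqI)
  fix i :: nat and S :: "'a sgp"
  assume "i \<in> {2, 3}"
  then have nonempty: "{1..i} \<noteq> {}"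
    by auto
  have card: "card {1..i} = i"
    by simp
  show "S \<in> MN_gen i \<longleftrightarrow> S \<in> models {1..i}
        {(prof_ext {Lx, Ly, Lz, Lt} {1..i} \<psi>
            (omega_power {Lx, Ly, Lz, Lt} phi_MN (emb {Lx, Ly, Lz, Lt} [Lx])),
          prof_ext {Lx, Ly, Lz, Lt} {1..i} \<psi>
            (omega_power {Lx, Ly, Lz, Lt} phi_MN (emb {Lx, Ly, Lz, Lt} [Ly]))) | \<psi>.
         \<psi> \<in> sg_hom (free_sg {Lx, Ly, Lz, Lt}) (free_sg {1..i})}"
  proof (cases "finite_semigroup S")
    case True
    show ?thesis
      unfolding MN_gen_iff_satisfies[OF True finite_atLeastAtMost nonempty card]
      using True by (auto simp: models_def)
  qed (simp add: models_def MN_gen_def)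
qed

end
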